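(* Let $\Lambda$ be a finite $k$-graph, and $(G,\Lambda)$ a self-similar groupoid action. Let $\mathcal T(G,\Lambda)=\mathcal{NT}(M)$ be the Nica–Toeplitz algebra of the product system $M=M(G,\Lambda)$ over $\mathbb N^k$, with universal Nica covariant representation $\psi$. Define $u:G\to\mathcal T(G,\Lambda)$ and $t:\Lambda\to\mathcal T(G,\Lambda)$ by $$u_g=\psi_0(i_g),\qquad t_v=\psi_0(i_v),\qquad t_\lambda=\psi_p(\delta_\lambda\otimes i_{s(\lambda)})$$ for $g\in G$, $v\in\Lambda^0$, and $\lambda\in\Lambda^p$ with $p\ne0$. Then the $C^*$-algebra $\mathcal T(G,\Lambda)$ is generated by $u(G)\cup t(\Lambda)$, and: (1) $u$ is a unitary representation of $G$ with $u_v=t_v$ for $v\in\Lambda^0$; (2) $\{t_\lambda:\lambda\in\Lambda\}$ is a Toeplitz–Cuntz–Krieger $\Lambda$-family in $\mathcal T(G,\Lambda)$, with $\sum_{v\in\Lambda^0}t_v$ the identity of $\mathcal T(G,\Lambda)$; (3) for $g\in G$ and $\lambda\in\Lambda$, $u_gt_\lambda=t_{g\cdot\lambda}u_{g|_\lambda}$ if $\operatorname{dom}(g)=r(\lambda)$, and $u_gt_\lambda=0$ otherwise.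
   Context: Conventions: $\mathbb N=\{0,1,2,\dots\}$ and $e_1,\dots,e_k$ are the standard generators of $\mathbb N^k$ ($k\ge1$). A $k$-graph is a countable small category $\Lambda$ with a degree functor $d:\Lambda\to\mathbb N^k$ such that whenever $d(\lambda)=p+q$ there are unique $\mu,\nu$ with $\lambda=\mu\nu$, $d(\mu)=p$, $d(\nu)=q$. Write $\Lambda^p=d^{-1}(p)$; $\Lambda^0$ is identified with the set of objects (vertices); $r,s:\Lambda\to\Lambda^0$ are the codomain and domain maps, so $\lambda\mu$ is defined iff $s(\lambda)=r(\mu)$. An edge is an element of some $\Lambda^{e_i}$. $v\Lambda=r^{-1}(v)$, $v\Lambda^p=v\Lambda\cap\Lambda^p$. $\Lambda$ is finite if every $\Lambda^p$ is finite. Self-similar actions: For a groupoid $G$, $\operatorname{dom},\operatorname{cod}$ are the source and range maps, and $gh$ is defined iff $\operatorname{dom}(g)=\operatorname{cod}(h)$. A partial isomorphism of $\Lambda$ consists of $v,w\in\Lambda^0$ and a bijection $g:v\Lambda\to w\Lambda$ with $g(v\Lambda^p)=w\Lambda^p$ for all $p$, and $g(\lambda e)\in g(\lambda)\Lambda$ for all $\lambda\in v\Lambda$ and edges $e\in s(\lambda)\Lambda$; put $\operatorname{dom}(g)=v$, $\operatorname{cod}(g)=w$. These form a groupoid $\operatorname{PIso}(\Lambda)$ under composition, with unit space $\Lambda^0$ ($v$ identified with $\mathrm{id}_{v\Lambda}$). An action of a groupoid $G$ with unit space $\Lambda^0$ on $\Lambda$ is a (unit-preserving) groupoid homomorphism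 $G\to\operatorname{PIso}(\Lambda)$, written $g\cdot\mu$; it is faithful if injective. A self-similar groupoid action $(G,\Lambda)$ is a faithful action such that for every $g\in G$ and edge $e\in\operatorname{dom}(g)\Lambda$ there is $h\in G$ with $g\cdot(e\lambda)=(g\cdot e)(h\cdot\lambda)$ for all $\lambda\in s(e)\Lambda$; this $h$ is unique and written $g|_e$. For $\lambda\in\operatorname{dom}(g)\Lambda$, factored into edges as $\lambda_1\cdots\lambda_l$, put $g|_\lambda=(\cdots(g|_{\lambda_1})|_{\lambda_2}\cdots)|_{\lambda_l}$ (independent of the factorisation; $g|_{\operatorname{dom}(g)}=g$). Representations: a unitary representation of $G$ in a $C^*$-algebra is a family of partial isometries $\{U_g:g\in G\}$ such that $\{U_v:v\in G^{(0)}\}$ are mutually orthogonal projections, $U_g^*=U_{g^{-1}}$, $U_gU_h=U_{gh}$ if $\operatorname{dom}(g)=\operatorname{cod}(h)$ and $0$ otherwise; $C^*(G)$ is generated by a universal one, $\{i_g\}$. With $\Lambda^{\min}(\lambda,\mu)=\{(\eta,\zeta):\lambda\eta=\mu\zeta,\ d(\lambda\eta)=d(\lambda)\vee d(\mu)\}$ ($\vee$ coordinatewise maximum), a Toeplitz–Cuntz–Krieger $\Lambda$-family is a set of partial isometries $\{T_\lambda\}$ such that $\{T_v:v\in\Lambda^0\}$ are mutually orthogonal projections, $T_\lambda T_\mu=T_{\lambda\mu}$ if $s(\lambda)=r(\mu)$, and $T_\lambda^*T_\mu=\sum_{(\eta,\zeta)\in\Lambda^{\min}(\lambda,\mu)}T_\eta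 T_\zeta^*$ for all $\lambda,\mu$ (empty sums are $0$). The product system $M(G,\Lambda)$: $A=C^*(G)$, $M_0={}_AA_A$ (with $\langle a,b\rangle=a^*b$). For $p\neq0$, $M_p=X(\Lambda^p)\otimes_{C(\Lambda^0)}C^*(G)$, where $X(\Lambda^p)=C(\Lambda^p)$ has $(x\cdot a)(\lambda)=x(\lambda)a(s(\lambda))$, $(a\cdot x)(\lambda)=a(r(\lambda))x(\lambda)$, $\langle x,y\rangle(v)=\sum_{s(\lambda)=v}\overline{x(\lambda)}y(\lambda)$, and $C(\Lambda^0)$ acts on $C^*(G)$ through $\delta_v\mapsto i_v$; $\delta_\lambda$ is the point mass. $M_p$ has right action $(x\otimes a)\cdot b=x\otimes ab$, inner product $\langle x\otimes a,y\otimes b\rangle=a^*\langle x,y\rangle b$, and left action $\varphi_p:A\to\mathcal L(M_p)$ (adjointable operators) determined by $i_g\cdot(\delta_\lambda\otimes a)=\delta_{g\cdot\lambda}\otimes i_{g|_\lambda}a$ if $r(\lambda)=\operatorname{dom}(g)$, $0$ otherwise. Multiplication $M_p\times M_q\to M_{p+q}$ ($p,q\ne0$) is determined by $(\delta_\lambda\otimes i_g)(\delta_\mu\otimes i_h)=\delta_{\lambda(g\cdot\mu)}\otimes i_{(g|_\mu)h}$ if $r(\mu)=\operatorname{dom}(g)$, $0$ otherwise (for $s(\lambda)=\operatorname{cod}(g)$, $s(\mu)=\operatorname{cod}(h)$); multiplication by $M_0$ is by the left and right actions. This is a compactly aligned product system with $M_p\otimes_AM_q\cong M_{p+q}$. Nica–Toeplitz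 algebra: $\mathcal K(M_p)$ is the closed span of the operators $\Theta_{x,y}(z)=x\cdot\langle y,z\rangle$; for $S\in\mathcal L(M_p)$, $S_p^{p\vee q}\in\mathcal L(M_{p\vee q})$ corresponds to $S\otimes1$ on $M_p\otimes_AM_{(p\vee q)-p}\cong M_{p\vee q}$. A Toeplitz representation of $M$ in a $C^*$-algebra $B$ is a map $\psi:M\to B$, $\psi_p=\psi|_{M_p}$, with $\psi_0$ a homomorphism, each $\psi_p$ linear, $\psi_p(x)^*\psi_p(y)=\psi_0(\langle x,y\rangle)$, and $\psi_{p+q}(xy)=\psi_p(x)\psi_q(y)$; $\psi^{(p)}:\mathcal K(M_p)\to B$ is the homomorphism with $\psi^{(p)}(\Theta_{x,y})=\psi_p(x)\psi_p(y)^*$. It is Nica covariant if $\psi^{(p)}(S)\psi^{(q)}(T)=\psi^{(p\vee q)}(S_p^{p\vee q}T_q^{p\vee q})$ for all $p,q$, $S\in\mathcal K(M_p)$, $T\in\mathcal K(M_q)$. $\mathcal{NT}(M)$ is the $C^*$-algebra generated by a universal Nica covariant representation. *)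

theory Defs
  imports "HOL-Analysis.Analysis" "HOL-Algebra.Module"
begin

section \<open>Complex Banach spaces and \<open>C\<^sup>*\<close>-algebras on carrier sets\<close>

text \<open>
  Algebras and modules are records with a carrier, since several of them (the fibres of a product
  system, the targets of representations) live on the same type.  They extend the record
  \<^type>\<open>module\<close> of HOL-Algebra.  As there, fields that make no sense for a structure (\<open>one\<close> in a
  non-unital algebra, \<open>mult\<close> and \<open>one\<close> in a module) are present but never constrained or used.
\<close>

definition complex_ring :: "complex ring" where
  "complex_ring = \<lparr>carrier = UNIV, monoid.mult = (*), one = 1, zero = 0, add = (+)\<rparr>"

record 'v nspace = "(complex, 'v) module" +
  vnorm :: "'v \<Rightarrow> real"

locale complex_banach =
  fixes V :: "('v, 'z) nspace_scheme" (structure)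
  assumes module: "Module.module complex_ring V"
    and norm_nonneg: "x \<in> carrier V \<Longrightarrow> 0 \<le> vnorm V x"
    and norm_eq_0: "x \<in> carrier V \<Longrightarrow> vnorm V x = 0 \<longleftrightarrow> x = \<zero>"
    and norm_smult: "x \<in> carrier V \<Longrightarrow> vnorm V (c \<odot> x) = cmod c * vnorm V x"
    and norm_triangle:
      "x \<in> carrier V \<Longrightarrow> y \<in> carrier V \<Longrightarrow> vnorm V (x \<oplus> y) \<le> vnorm V x + vnorm V y"
    and complete:
      "\<lbrakk>\<And>n. X n \<in> carrier V;
        \<And>\<epsilon>. 0 < \<epsilon> \<Longrightarrow> \<exists>N. \<forall>m\<ge>N. \<forall>n\<ge>N. vnorm V (X m \<ominus> X n) < \<epsilon>\<rbrakk>
       \<Longrightarrow> \<exists>x\<in>carrier V. (\<lambda>n::nat. vnorm V (X n \<ominus> x)) \<longlonglongrightarrow> 0"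

record 'a cstar = "'a nspace" +
  star :: "'a \<Rightarrow> 'a"

locale cstar_algebra = complex_banach A
  for A :: "('a, 'z) cstar_scheme" (structure) +
  assumes mult_closed: "x \<in> carrier A \<Longrightarrow> y \<in> carrier A \<Longrightarrow> x \<otimes> y \<in> carrier A"
    and mult_assoc: "x \<in> carrier A \<Longrightarrow> y \<in> carrier A \<Longrightarrow> z \<in> carrier A
      \<Longrightarrow> (x \<otimes> y) \<otimes> z = x \<otimes> (y \<otimes> z)"
    and distrib_right: "x \<in> carrier A \<Longrightarrow> y \<in> carrier A \<Longrightarrow> z \<in> carrier A
      \<Longrightarrow> (x \<oplus> y) \<otimes> z = x \<otimes> z \<oplus> y \<otimes> z"
    and distrib_left: "x \<in> carrier A \<Longrightarrow> y \<in> carrier A \<Longrightarrow> z \<in> carrier A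
      \<Longrightarrow> x \<otimes> (y \<oplus> z) = x \<otimes> y \<oplus> x \<otimes> z"
    and smult_mult: "x \<in> carrier A \<Longrightarrow> y \<in> carrier A \<Longrightarrow> (c \<odot> x) \<otimes> y = c \<odot> (x \<otimes> y)"
    and mult_smult: "x \<in> carrier A \<Longrightarrow> y \<in> carrier A \<Longrightarrow> x \<otimes> (c \<odot> y) = c \<odot> (x \<otimes> y)"
    and norm_mult: "x \<in> carrier A \<Longrightarrow> y \<in> carrier A \<Longrightarrow> vnorm A (x \<otimes> y) \<le> vnorm A x * vnorm A y"
    and star_closed: "x \<in> carrier A \<Longrightarrow> star A x \<in> carrier A"
    and star_star: "x \<in> carrier A \<Longrightarrow> star A (star A x) = x"
    and star_add: "x \<in> carrier A \<Longrightarrow> y \<in> carrier A \<Longrightarrow> star A (x \<oplus> y) = star A x \<oplus> star A y"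
    and star_smult: "x \<in> carrier A \<Longrightarrow> star A (c \<odot> x) = cnj c \<odot> star A x"
    and star_mult: "x \<in> carrier A \<Longrightarrow> y \<in> carrier A \<Longrightarrow> star A (x \<otimes> y) = star A y \<otimes> star A x"
    and cstar_identity: "x \<in> carrier A \<Longrightarrow> vnorm A (star A x \<otimes> x) = (vnorm A x)\<^sup>2"

definition closed_subspace :: "('v, 'z) nspace_scheme \<Rightarrow> 'v set \<Rightarrow> bool" where
  "closed_subspace V C \<longleftrightarrow>
     C \<subseteq> carrier V \<and> \<zero>\<^bsub>V\<^esub> \<in> C \<and>
     (\<forall>x\<in>C. \<forall>y\<in>C. x \<oplus>\<^bsub>V\<^esub> y \<in> C) \<and> (\<forall>c. \<forall>x\<in>C. c \<odot>\<^bsub>V\<^esub> x \<in> C) \<and>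
     (\<forall>X x. (\<forall>n::nat. X n \<in> C) \<and> x \<in> carrier V \<and> (\<lambda>n. vnorm V (X n \<ominus>\<^bsub>V\<^esub> x)) \<longlonglongrightarrow> 0
        \<longrightarrow> x \<in> C)"

definition closed_span :: "('v, 'z) nspace_scheme \<Rightarrow> 'v set \<Rightarrow> 'v set" where
  "closed_span V S = \<Inter>{C. closed_subspace V C \<and> S \<subseteq> C}"

definition cstar_subalgebra :: "('a, 'z) cstar_scheme \<Rightarrow> 'a set \<Rightarrow> bool" where
  "cstar_subalgebra A C \<longleftrightarrow>
     closed_subspace A C \<and> (\<forall>x\<in>C. \<forall>y\<in>C. x \<otimes>\<^bsub>A\<^esub> y \<in> C) \<and> (\<forall>x\<in>C. star A x \<in> C)"

definition cstar_generated :: "('a, 'z) cstar_scheme \<Rightarrow> 'a set \<Rightarrow> 'a set" where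
  "cstar_generated A S = \<Inter>{C. cstar_subalgebra A C \<and> S \<subseteq> C}"

definition linear_on :: "('v, 'y) nspace_scheme \<Rightarrow> ('w, 'z) nspace_scheme \<Rightarrow> ('v \<Rightarrow> 'w) \<Rightarrow> bool" where
  "linear_on V W f \<longleftrightarrow>
     f \<in> carrier V \<rightarrow> carrier W \<and>
     (\<forall>x\<in>carrier V. \<forall>y\<in>carrier V. f (x \<oplus>\<^bsub>V\<^esub> y) = f x \<oplus>\<^bsub>W\<^esub> f y) \<and>
     (\<forall>c. \<forall>x\<in>carrier V. f (c \<odot>\<^bsub>V\<^esub> x) = c \<odot>\<^bsub>W\<^esub> f x)"

definition star_hom :: "('a, 'y) cstar_scheme \<Rightarrow> ('b, 'z) cstar_scheme \<Rightarrow> ('a \<Rightarrow> 'b) \<Rightarrow> bool" where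
  "star_hom A B f \<longleftrightarrow>
     linear_on A B f \<and>
     (\<forall>x\<in>carrier A. \<forall>y\<in>carrier A. f (x \<otimes>\<^bsub>A\<^esub> y) = f x \<otimes>\<^bsub>B\<^esub> f y) \<and>
     (\<forall>x\<in>carrier A. f (star A x) = star B (f x))"

definition partial_isometry :: "('a, 'z) cstar_scheme \<Rightarrow> 'a \<Rightarrow> bool" where
  "partial_isometry A x \<longleftrightarrow> x \<in> carrier A \<and> x \<otimes>\<^bsub>A\<^esub> star A x \<otimes>\<^bsub>A\<^esub> x = x"

definition projection :: "('a, 'z) cstar_scheme \<Rightarrow> 'a \<Rightarrow> bool" where
  "projection A x \<longleftrightarrow> x \<in> carrier A \<and> x \<otimes>\<^bsub>A\<^esub> x = x \<and> star A x = x"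

definition orthogonal_projections :: "('a, 'z) cstar_scheme \<Rightarrow> 'i set \<Rightarrow> ('i \<Rightarrow> 'a) \<Rightarrow> bool" where
  "orthogonal_projections A I P \<longleftrightarrow>
     (\<forall>v\<in>I. projection A (P v)) \<and> (\<forall>v\<in>I. \<forall>w\<in>I. v \<noteq> w \<longrightarrow> P v \<otimes>\<^bsub>A\<^esub> P w = \<zero>\<^bsub>A\<^esub>)"

definition is_identity :: "('a, 'z) cstar_scheme \<Rightarrow> 'a \<Rightarrow> bool" where
  "is_identity A e \<longleftrightarrow>
     e \<in> carrier A \<and> (\<forall>x\<in>carrier A. e \<otimes>\<^bsub>A\<^esub> x = x \<and> x \<otimes>\<^bsub>A\<^esub> e = x)"

text \<open>
  A universal property must range over target algebras on one fixed type.  Every element of a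
  \<open>C\<^sup>*\<close>-algebra generated by a family indexed by \<open>'x \<times> N\<close> with \<open>N\<close> countable is the limit of a
  sequence of complex *-polynomials in the family, so such an algebra has at most
  \<open>max |'x| |\<complex>| ^ \<aleph>\<^sub>0\<close> elements and has an isomorphic copy on the following type.  As a
  representation may be corestricted to the algebra it generates, testing universality on this type
  amounts to testing it on all \<open>C\<^sup>*\<close>-algebras.
\<close>

type_synonym 'x test_space = "nat \<Rightarrow> 'x + complex"


section \<open>Hilbert modules\<close>

text \<open>Positive elements of a \<open>C\<^sup>*\<close>-algebra are the elements of the form \<open>b\<^sup>*b\<close>.\<close>

record ('a, 'm) hmod = "'m nspace" +
  ract :: "'m \<Rightarrow> 'a \<Rightarrow> 'm"
  inner_prod :: "'m \<Rightarrow> 'm \<Rightarrow> 'a"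
  lact :: "'a \<Rightarrow> 'm \<Rightarrow> 'm"

locale hilbert_module = A: cstar_algebra A + E: complex_banach E
  for A :: "('a, 'y) cstar_scheme" and E :: "('a, 'm, 'z) hmod_scheme" +
  assumes ract_closed: "x \<in> carrier E \<Longrightarrow> a \<in> carrier A \<Longrightarrow> ract E x a \<in> carrier E"
    and ract_add_left: "x \<in> carrier E \<Longrightarrow> y \<in> carrier E \<Longrightarrow> a \<in> carrier A
      \<Longrightarrow> ract E (x \<oplus>\<^bsub>E\<^esub> y) a = ract E x a \<oplus>\<^bsub>E\<^esub> ract E y a"
    and ract_add_right: "x \<in> carrier E \<Longrightarrow> a \<in> carrier A \<Longrightarrow> b \<in> carrier A
      \<Longrightarrow> ract E x (a \<oplus>\<^bsub>A\<^esub> b) = ract E x a \<oplus>\<^bsub>E\<^esub> ract E x b"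
    and ract_smult_left: "x \<in> carrier E \<Longrightarrow> a \<in> carrier A
      \<Longrightarrow> ract E (c \<odot>\<^bsub>E\<^esub> x) a = c \<odot>\<^bsub>E\<^esub> ract E x a"
    and ract_smult_right: "x \<in> carrier E \<Longrightarrow> a \<in> carrier A
      \<Longrightarrow> ract E x (c \<odot>\<^bsub>A\<^esub> a) = c \<odot>\<^bsub>E\<^esub> ract E x a"
    and ract_ract: "x \<in> carrier E \<Longrightarrow> a \<in> carrier A \<Longrightarrow> b \<in> carrier A
      \<Longrightarrow> ract E (ract E x a) b = ract E x (a \<otimes>\<^bsub>A\<^esub> b)"
    and ip_closed: "x \<in> carrier E \<Longrightarrow> y \<in> carrier E \<Longrightarrow> inner_prod E x y \<in> carrier A"
    and ip_add: "x \<in> carrier E \<Longrightarrow> y \<in> carrier E \<Longrightarrow> z \<in> carrier E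
      \<Longrightarrow> inner_prod E x (y \<oplus>\<^bsub>E\<^esub> z) = inner_prod E x y \<oplus>\<^bsub>A\<^esub> inner_prod E x z"
    and ip_smult: "x \<in> carrier E \<Longrightarrow> y \<in> carrier E
      \<Longrightarrow> inner_prod E x (c \<odot>\<^bsub>E\<^esub> y) = c \<odot>\<^bsub>A\<^esub> inner_prod E x y"
    and ip_ract: "x \<in> carrier E \<Longrightarrow> y \<in> carrier E \<Longrightarrow> a \<in> carrier A
      \<Longrightarrow> inner_prod E x (ract E y a) = inner_prod E x y \<otimes>\<^bsub>A\<^esub> a"
    and ip_star: "x \<in> carrier E \<Longrightarrow> y \<in> carrier E
      \<Longrightarrow> star A (inner_prod E x y) = inner_prod E y x"
    and ip_pos: "x \<in> carrier E
      \<Longrightarrow> \<exists>b\<in>carrier A. inner_prod E x x = star A b \<otimes>\<^bsub>A\<^esub> b"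
    and norm_ip: "x \<in> carrier E \<Longrightarrow> vnorm E x = sqrt (vnorm A (inner_prod E x x))"

text \<open>
  The \<open>C\<^sup>*\<close>-algebra of adjointable operators.  Operators are extensional functions, so that equality
  of operators is equality of functions.
\<close>

definition adjoint_pair :: "('a, 'm, 'z) hmod_scheme \<Rightarrow> ('m \<Rightarrow> 'm) \<Rightarrow> ('m \<Rightarrow> 'm) \<Rightarrow> bool" where
  "adjoint_pair E S R \<longleftrightarrow>
     S \<in> carrier E \<rightarrow>\<^sub>E carrier E \<and> R \<in> carrier E \<rightarrow>\<^sub>E carrier E \<and>
     (\<forall>x\<in>carrier E. \<forall>y\<in>carrier E. inner_prod E (S x) y = inner_prod E x (R y))"

definition adjointables :: "('a, 'm, 'z) hmod_scheme \<Rightarrow> ('m \<Rightarrow> 'm) cstar" where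
  "adjointables E = \<lparr>carrier = {S. \<exists>R. adjoint_pair E S R},
     monoid.mult = compose (carrier E),
     one = (\<lambda>x\<in>carrier E. x),
     zero = (\<lambda>x\<in>carrier E. \<zero>\<^bsub>E\<^esub>),
     add = (\<lambda>S T. \<lambda>x\<in>carrier E. S x \<oplus>\<^bsub>E\<^esub> T x),
     smult = (\<lambda>c S. \<lambda>x\<in>carrier E. c \<odot>\<^bsub>E\<^esub> S x),
     vnorm = (\<lambda>S. SUP x\<in>{x \<in> carrier E. vnorm E x \<le> 1}. vnorm E (S x)),
     star = (\<lambda>S. THE R. adjoint_pair E S R)\<rparr>"

definition Theta :: "('a, 'm, 'z) hmod_scheme \<Rightarrow> 'm \<Rightarrow> 'm \<Rightarrow> ('m \<Rightarrow> 'm)" where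
  "Theta E x y = (\<lambda>z\<in>carrier E. ract E x (inner_prod E y z))"

definition compacts :: "('a, 'm, 'z) hmod_scheme \<Rightarrow> ('m \<Rightarrow> 'm) cstar" where
  "compacts E = (adjointables E)
     \<lparr>carrier := closed_span (adjointables E) {Theta E x y |x y. x \<in> carrier E \<and> y \<in> carrier E}\<rparr>"

locale correspondence = hilbert_module A E
  for A :: "('a, 'y) cstar_scheme" and E :: "('a, 'm, 'z) hmod_scheme" +
  assumes left_action: "star_hom A (adjointables E) (\<lambda>a. \<lambda>x\<in>carrier E. lact E a x)"

definition std_bimodule :: "'a cstar \<Rightarrow> ('a, 'a) hmod" where
  "std_bimodule A = \<lparr>carrier = carrier A, monoid.mult = monoid.mult A, one = one A,
     zero = zero A, add = add A, smult = smult A, vnorm = vnorm A,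
     ract = (\<lambda>x a. x \<otimes>\<^bsub>A\<^esub> a), inner_prod = (\<lambda>x y. star A x \<otimes>\<^bsub>A\<^esub> y), lact = (\<lambda>a x. a \<otimes>\<^bsub>A\<^esub> x)\<rparr>"

text \<open>
  \<open>interior_tensor X C j A E tens\<close>: the Hilbert \<open>A\<close>-module \<open>E\<close> is the interior tensor product of
  the Hilbert \<open>C\<close>-module \<open>X\<close> with \<open>A\<close>, where \<open>C\<close> acts on \<open>A\<close> by left multiplication through
  \<open>j : C \<rightarrow> A\<close>, and \<open>tens x a\<close> is the elementary tensor of \<open>x\<close> and \<open>a\<close>.
\<close>

definition interior_tensor ::
  "('c, 'x, 'u) hmod_scheme \<Rightarrow> ('c, 'v) cstar_scheme \<Rightarrow> ('c \<Rightarrow> 'a) \<Rightarrow> ('a, 'y) cstar_scheme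
    \<Rightarrow> ('a, 'm, 'z) hmod_scheme \<Rightarrow> ('x \<Rightarrow> 'a \<Rightarrow> 'm) \<Rightarrow> bool" where
  "interior_tensor X C j A E tens \<longleftrightarrow>
     hilbert_module A E \<and>
     (\<forall>a\<in>carrier A. linear_on X E (\<lambda>x. tens x a)) \<and>
     (\<forall>x\<in>carrier X. linear_on A E (tens x)) \<and>
     (\<forall>x\<in>carrier X. \<forall>c\<in>carrier C. \<forall>a\<in>carrier A. tens (ract X x c) a = tens x (j c \<otimes>\<^bsub>A\<^esub> a)) \<and>
     (\<forall>x\<in>carrier X. \<forall>a\<in>carrier A. \<forall>b\<in>carrier A. ract E (tens x a) b = tens x (a \<otimes>\<^bsub>A\<^esub> b)) \<and>
     (\<forall>x\<in>carrier X. \<forall>y\<in>carrier X. \<forall>a\<in>carrier A. \<forall>b\<in>carrier A.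
        inner_prod E (tens x a) (tens y b) = star A a \<otimes>\<^bsub>A\<^esub> j (inner_prod X x y) \<otimes>\<^bsub>A\<^esub> b) \<and>
     closed_span E {tens x a |x a. x \<in> carrier X \<and> a \<in> carrier A} = carrier E"


section \<open>Product systems over \<open>\<nat>\<^sup>k\<close> and their Nica--Toeplitz algebras\<close>

text \<open>
  Elements of \<open>\<nat>\<^sup>k\<close> have type \<^typ>\<open>nat ^ 'k\<close>.  The fibres \<open>pmod M p\<close> and the coefficient algebra
  \<open>A = pmod M 0\<close> are carried by subsets of one type \<open>'m\<close>; the fibres need not be disjoint, because
  all maps on a product system carry the degree \<open>p\<close> as an argument.
\<close>

definition join :: "nat ^ 'k \<Rightarrow> nat ^ 'k \<Rightarrow> nat ^ 'k" where
  "join p q = (\<chi> i. max (p $ i) (q $ i))"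

record ('m, 'k) psystem =
  pmod :: "nat ^ 'k \<Rightarrow> ('m, 'm) hmod"
  pmul :: "nat ^ 'k \<Rightarrow> nat ^ 'k \<Rightarrow> 'm \<Rightarrow> 'm \<Rightarrow> 'm"

abbreviation fibre :: "('m, 'k::finite) psystem \<Rightarrow> nat ^ 'k \<Rightarrow> 'm set" where
  "fibre M p \<equiv> carrier (pmod M p)"

text \<open>
  The axioms \<open>mul_inner_prod\<close> and \<open>mul_dense\<close> say that multiplication induces an isomorphism of
  the interior tensor product \<open>M\<^sub>p \<otimes>\<^sub>A M\<^sub>q\<close> onto \<open>M\<^sub>p\<^sub>+\<^sub>q\<close>.
\<close>

locale product_system =
  fixes A :: "'m cstar" and M :: "('m, 'k::finite) psystem"
  assumes fibre_correspondence: "correspondence A (pmod M p)"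
    and fibre_zero: "pmod M 0 = std_bimodule A"
    and mul_linear_left: "y \<in> fibre M q \<Longrightarrow> linear_on (pmod M p) (pmod M (p + q)) (\<lambda>x. pmul M p q x y)"
    and mul_linear_right: "x \<in> fibre M p \<Longrightarrow> linear_on (pmod M q) (pmod M (p + q)) (pmul M p q x)"
    and mul_inner_prod: "x \<in> fibre M p \<Longrightarrow> y \<in> fibre M q \<Longrightarrow> x' \<in> fibre M p \<Longrightarrow> y' \<in> fibre M q
      \<Longrightarrow> inner_prod (pmod M (p + q)) (pmul M p q x y) (pmul M p q x' y')
        = inner_prod (pmod M q) y (lact (pmod M q) (inner_prod (pmod M p) x x') y')"
    and mul_dense: "closed_span (pmod M (p + q)) {pmul M p q x y |x y. x \<in> fibre M p \<and> y \<in> fibre M q}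
      = fibre M (p + q)"
    and mul_zero_left: "a \<in> carrier A \<Longrightarrow> y \<in> fibre M q \<Longrightarrow> pmul M 0 q a y = lact (pmod M q) a y"
    and mul_zero_right: "x \<in> fibre M p \<Longrightarrow> a \<in> carrier A \<Longrightarrow> pmul M p 0 x a = ract (pmod M p) x a"
    and mul_assoc: "x \<in> fibre M p \<Longrightarrow> y \<in> fibre M q \<Longrightarrow> z \<in> fibre M r
      \<Longrightarrow> pmul M (p + q) r (pmul M p q x y) z = pmul M p (q + r) x (pmul M q r y z)"

text \<open>
  For \<open>p \<le> r\<close> and \<open>S \<in> \<L>(M\<^sub>p)\<close>, the operator on \<open>M\<^sub>r\<close> that corresponds to \<open>S \<otimes> 1\<close> under
  \<open>M\<^sub>p \<otimes>\<^sub>A M\<^sub>r\<^sub>-\<^sub>p \<cong> M\<^sub>r\<close>.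
\<close>

definition extend_op ::
  "('m, 'k::finite) psystem \<Rightarrow> nat ^ 'k \<Rightarrow> nat ^ 'k \<Rightarrow> ('m \<Rightarrow> 'm) \<Rightarrow> ('m \<Rightarrow> 'm)" where
  "extend_op M p r S = (THE R. R \<in> carrier (adjointables (pmod M r)) \<and>
     (\<forall>x\<in>fibre M p. \<forall>y\<in>fibre M (r - p). R (pmul M p (r - p) x y) = pmul M p (r - p) (S x) y))"

definition toeplitz_rep ::
  "'m cstar \<Rightarrow> ('m, 'k::finite) psystem \<Rightarrow> 'b cstar \<Rightarrow> (nat ^ 'k \<Rightarrow> 'm \<Rightarrow> 'b) \<Rightarrow> bool" where
  "toeplitz_rep A M B \<psi> \<longleftrightarrow>
     star_hom A B (\<psi> 0) \<and>
     (\<forall>p. linear_on (pmod M p) B (\<psi> p)) \<and>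
     (\<forall>p. \<forall>x\<in>fibre M p. \<forall>y\<in>fibre M p.
        star B (\<psi> p x) \<otimes>\<^bsub>B\<^esub> \<psi> p y = \<psi> 0 (inner_prod (pmod M p) x y)) \<and>
     (\<forall>p q. \<forall>x\<in>fibre M p. \<forall>y\<in>fibre M q. \<psi> (p + q) (pmul M p q x y) = \<psi> p x \<otimes>\<^bsub>B\<^esub> \<psi> q y)"

text \<open>
  The family \<open>\<Psi>\<close> below is \<open>p \<mapsto> \<psi>\<^sup>(\<^sup>p\<^sup>)\<close>: each \<open>\<Psi> p\<close> exists and is unique on \<open>\<K>(M\<^sub>p)\<close>, for every
  Toeplitz representation.
\<close>

definition nica_covariant ::
  "'m cstar \<Rightarrow> ('m, 'k::finite) psystem \<Rightarrow> 'b cstar \<Rightarrow> (nat ^ 'k \<Rightarrow> 'm \<Rightarrow> 'b) \<Rightarrow> bool" where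
  "nica_covariant A M B \<psi> \<longleftrightarrow>
     toeplitz_rep A M B \<psi> \<and>
     (\<exists>\<Psi>. (\<forall>p. star_hom (compacts (pmod M p)) B (\<Psi> p) \<and>
               (\<forall>x\<in>fibre M p. \<forall>y\<in>fibre M p.
                  \<Psi> p (Theta (pmod M p) x y) = \<psi> p x \<otimes>\<^bsub>B\<^esub> star B (\<psi> p y))) \<and>
          (\<forall>p q. \<forall>S\<in>carrier (compacts (pmod M p)). \<forall>T\<in>carrier (compacts (pmod M q)).
             \<Psi> p S \<otimes>\<^bsub>B\<^esub> \<Psi> q T =
             \<Psi> (join p q) (extend_op M p (join p q) S
                             \<otimes>\<^bsub>adjointables (pmod M (join p q))\<^esub> extend_op M q (join p q) T)))"

definition nica_toeplitz_algebra ::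
  "'m cstar \<Rightarrow> ('m, 'k::finite) psystem \<Rightarrow> 'b cstar \<Rightarrow> (nat ^ 'k \<Rightarrow> 'm \<Rightarrow> 'b) \<Rightarrow> bool" where
  "nica_toeplitz_algebra A M T \<psi> \<longleftrightarrow>
     cstar_algebra T \<and> nica_covariant A M T \<psi> \<and>
     cstar_generated T (\<Union>p. \<psi> p ` fibre M p) = carrier T \<and>
     (\<forall>(B :: 'm test_space cstar) \<rho>. cstar_algebra B \<and> nica_covariant A M B \<rho> \<longrightarrow>
        (\<exists>f. star_hom T B f \<and> (\<forall>p. \<forall>x\<in>fibre M p. f (\<psi> p x) = \<rho> p x)))"


section \<open>\<open>k\<close>-graphs\<close>

text \<open>
  A small category is given by its set of morphisms; an object is identified with its identity
  morphism, so \<open>rng\<close> and \<open>src\<close> (codomain and domain) take values in the identity morphisms.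
\<close>

record ('l, 'k) kgraph = "'l partial_object" +
  rng :: "'l \<Rightarrow> 'l"
  src :: "'l \<Rightarrow> 'l"
  kcomp :: "'l \<Rightarrow> 'l \<Rightarrow> 'l"
  deg :: "'l \<Rightarrow> nat ^ 'k"

definition paths :: "('l, 'k::finite) kgraph \<Rightarrow> nat ^ 'k \<Rightarrow> 'l set" where
  "paths \<Lambda> p = {\<alpha>\<in>carrier \<Lambda>. deg \<Lambda> \<alpha> = p}"

abbreviation vertices :: "('l, 'k::finite) kgraph \<Rightarrow> 'l set" where
  "vertices \<Lambda> \<equiv> paths \<Lambda> 0"

definition edges :: "('l, 'k::finite) kgraph \<Rightarrow> 'l set" where
  "edges \<Lambda> = (\<Union>j. paths \<Lambda> (axis j 1))"

definition paths_to :: "('l, 'k::finite) kgraph \<Rightarrow> 'l \<Rightarrow> 'l set" where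
  "paths_to \<Lambda> v = {\<alpha>\<in>carrier \<Lambda>. rng \<Lambda> \<alpha> = v}"

locale kgraph =
  fixes \<Lambda> :: "('l, 'k::finite) kgraph"
  assumes countable: "countable (carrier \<Lambda>)"
    and rng_closed: "\<alpha> \<in> carrier \<Lambda> \<Longrightarrow> rng \<Lambda> \<alpha> \<in> carrier \<Lambda>"
    and src_closed: "\<alpha> \<in> carrier \<Lambda> \<Longrightarrow> src \<Lambda> \<alpha> \<in> carrier \<Lambda>"
    and rng_rng: "\<alpha> \<in> carrier \<Lambda> \<Longrightarrow> rng \<Lambda> (rng \<Lambda> \<alpha>) = rng \<Lambda> \<alpha>"
    and src_rng: "\<alpha> \<in> carrier \<Lambda> \<Longrightarrow> src \<Lambda> (rng \<Lambda> \<alpha>) = rng \<Lambda> \<alpha>"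
    and rng_src: "\<alpha> \<in> carrier \<Lambda> \<Longrightarrow> rng \<Lambda> (src \<Lambda> \<alpha>) = src \<Lambda> \<alpha>"
    and src_src: "\<alpha> \<in> carrier \<Lambda> \<Longrightarrow> src \<Lambda> (src \<Lambda> \<alpha>) = src \<Lambda> \<alpha>"
    and comp_closed: "\<alpha> \<in> carrier \<Lambda> \<Longrightarrow> \<mu> \<in> carrier \<Lambda> \<Longrightarrow> src \<Lambda> \<alpha> = rng \<Lambda> \<mu>
      \<Longrightarrow> kcomp \<Lambda> \<alpha> \<mu> \<in> carrier \<Lambda>"
    and rng_comp: "\<alpha> \<in> carrier \<Lambda> \<Longrightarrow> \<mu> \<in> carrier \<Lambda> \<Longrightarrow> src \<Lambda> \<alpha> = rng \<Lambda> \<mu>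
      \<Longrightarrow> rng \<Lambda> (kcomp \<Lambda> \<alpha> \<mu>) = rng \<Lambda> \<alpha>"
    and src_comp: "\<alpha> \<in> carrier \<Lambda> \<Longrightarrow> \<mu> \<in> carrier \<Lambda> \<Longrightarrow> src \<Lambda> \<alpha> = rng \<Lambda> \<mu>
      \<Longrightarrow> src \<Lambda> (kcomp \<Lambda> \<alpha> \<mu>) = src \<Lambda> \<mu>"
    and comp_assoc: "\<alpha> \<in> carrier \<Lambda> \<Longrightarrow> \<mu> \<in> carrier \<Lambda> \<Longrightarrow> \<nu> \<in> carrier \<Lambda>
      \<Longrightarrow> src \<Lambda> \<alpha> = rng \<Lambda> \<mu> \<Longrightarrow> src \<Lambda> \<mu> = rng \<Lambda> \<nu>
      \<Longrightarrow> kcomp \<Lambda> (kcomp \<Lambda> \<alpha> \<mu>) \<nu> = kcomp \<Lambda> \<alpha> (kcomp \<Lambda> \<mu> \<nu>)"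
    and rng_id: "\<alpha> \<in> carrier \<Lambda> \<Longrightarrow> kcomp \<Lambda> (rng \<Lambda> \<alpha>) \<alpha> = \<alpha>"
    and src_id: "\<alpha> \<in> carrier \<Lambda> \<Longrightarrow> kcomp \<Lambda> \<alpha> (src \<Lambda> \<alpha>) = \<alpha>"
    and deg_rng: "\<alpha> \<in> carrier \<Lambda> \<Longrightarrow> deg \<Lambda> (rng \<Lambda> \<alpha>) = 0"
    and deg_src: "\<alpha> \<in> carrier \<Lambda> \<Longrightarrow> deg \<Lambda> (src \<Lambda> \<alpha>) = 0"
    and deg_comp: "\<alpha> \<in> carrier \<Lambda> \<Longrightarrow> \<mu> \<in> carrier \<Lambda> \<Longrightarrow> src \<Lambda> \<alpha> = rng \<Lambda> \<mu>
      \<Longrightarrow> deg \<Lambda> (kcomp \<Lambda> \<alpha> \<mu>) = deg \<Lambda> \<alpha> + deg \<Lambda> \<mu>"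
    and unique_factorisation: "\<alpha> \<in> carrier \<Lambda> \<Longrightarrow> deg \<Lambda> \<alpha> = p + q
      \<Longrightarrow> \<exists>!(\<mu>, \<nu>). \<mu> \<in> carrier \<Lambda> \<and> \<nu> \<in> carrier \<Lambda> \<and> src \<Lambda> \<mu> = rng \<Lambda> \<nu> \<and>
            \<alpha> = kcomp \<Lambda> \<mu> \<nu> \<and> deg \<Lambda> \<mu> = p \<and> deg \<Lambda> \<nu> = q"

definition finite_kgraph :: "('l, 'k::finite) kgraph \<Rightarrow> bool" where
  "finite_kgraph \<Lambda> \<longleftrightarrow> (\<forall>p. finite (paths \<Lambda> p))"

definition min_extensions :: "('l, 'k::finite) kgraph \<Rightarrow> 'l \<Rightarrow> 'l \<Rightarrow> ('l \<times> 'l) set" where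
  "min_extensions \<Lambda> \<alpha> \<mu> = {(\<eta>, \<zeta>). \<eta> \<in> carrier \<Lambda> \<and> \<zeta> \<in> carrier \<Lambda> \<and>
     src \<Lambda> \<alpha> = rng \<Lambda> \<eta> \<and> src \<Lambda> \<mu> = rng \<Lambda> \<zeta> \<and> kcomp \<Lambda> \<alpha> \<eta> = kcomp \<Lambda> \<mu> \<zeta> \<and>
     deg \<Lambda> (kcomp \<Lambda> \<alpha> \<eta>) = join (deg \<Lambda> \<alpha>) (deg \<Lambda> \<mu>)}"

definition tck_family :: "('l, 'k::finite) kgraph \<Rightarrow> 'b cstar \<Rightarrow> ('l \<Rightarrow> 'b) \<Rightarrow> bool" where
  "tck_family \<Lambda> B T \<longleftrightarrow>
     (\<forall>\<alpha>\<in>carrier \<Lambda>. partial_isometry B (T \<alpha>)) \<and>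
     orthogonal_projections B (vertices \<Lambda>) T \<and>
     (\<forall>\<alpha>\<in>carrier \<Lambda>. \<forall>\<mu>\<in>carrier \<Lambda>. src \<Lambda> \<alpha> = rng \<Lambda> \<mu> \<longrightarrow> T \<alpha> \<otimes>\<^bsub>B\<^esub> T \<mu> = T (kcomp \<Lambda> \<alpha> \<mu>)) \<and>
     (\<forall>\<alpha>\<in>carrier \<Lambda>. \<forall>\<mu>\<in>carrier \<Lambda>.
        star B (T \<alpha>) \<otimes>\<^bsub>B\<^esub> T \<mu> =
        (\<Oplus>\<^bsub>B\<^esub>x\<in>min_extensions \<Lambda> \<alpha> \<mu>. T (fst x) \<otimes>\<^bsub>B\<^esub> star B (T (snd x))))"


section \<open>Groupoids and self-similar actions\<close>

text \<open>
  A groupoid is given with a set \<open>V\<close> of objects; \<open>gunit G v\<close> is the unit at \<open>v\<close>, with which the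
  object \<open>v\<close> is identified informally.
\<close>

record ('g, 'v) groupoid = "'g partial_object" +
  gdom :: "'g \<Rightarrow> 'v"
  gcod :: "'g \<Rightarrow> 'v"
  gcomp :: "'g \<Rightarrow> 'g \<Rightarrow> 'g"
  gunit :: "'v \<Rightarrow> 'g"

definition gunits :: "('g, 'v) groupoid \<Rightarrow> 'g set" where
  "gunits G = {g\<in>carrier G. g = gunit G (gdom G g)}"

definition is_ginv :: "('g, 'v) groupoid \<Rightarrow> 'g \<Rightarrow> 'g \<Rightarrow> bool" where
  "is_ginv G g h \<longleftrightarrow> h \<in> carrier G \<and> gdom G h = gcod G g \<and> gcod G h = gdom G g \<and>
     gcomp G h g = gunit G (gdom G g) \<and> gcomp G g h = gunit G (gcod G g)"

definition ginv :: "('g, 'v) groupoid \<Rightarrow> 'g \<Rightarrow> 'g" where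
  "ginv G g = (THE h. is_ginv G g h)"

locale groupoid_over =
  fixes V :: "'v set" and G :: "('g, 'v) groupoid"
  assumes dom_closed: "g \<in> carrier G \<Longrightarrow> gdom G g \<in> V"
    and cod_closed: "g \<in> carrier G \<Longrightarrow> gcod G g \<in> V"
    and unit_closed: "v \<in> V \<Longrightarrow> gunit G v \<in> carrier G"
    and dom_unit: "v \<in> V \<Longrightarrow> gdom G (gunit G v) = v"
    and cod_unit: "v \<in> V \<Longrightarrow> gcod G (gunit G v) = v"
    and comp_closed: "g \<in> carrier G \<Longrightarrow> h \<in> carrier G \<Longrightarrow> gdom G g = gcod G h
      \<Longrightarrow> gcomp G g h \<in> carrier G"
    and dom_comp: "g \<in> carrier G \<Longrightarrow> h \<in> carrier G \<Longrightarrow> gdom G g = gcod G h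
      \<Longrightarrow> gdom G (gcomp G g h) = gdom G h"
    and cod_comp: "g \<in> carrier G \<Longrightarrow> h \<in> carrier G \<Longrightarrow> gdom G g = gcod G h
      \<Longrightarrow> gcod G (gcomp G g h) = gcod G g"
    and comp_assoc: "f \<in> carrier G \<Longrightarrow> g \<in> carrier G \<Longrightarrow> h \<in> carrier G
      \<Longrightarrow> gdom G f = gcod G g \<Longrightarrow> gdom G g = gcod G h
      \<Longrightarrow> gcomp G (gcomp G f g) h = gcomp G f (gcomp G g h)"
    and unit_left: "g \<in> carrier G \<Longrightarrow> gcomp G (gunit G (gcod G g)) g = g"
    and unit_right: "g \<in> carrier G \<Longrightarrow> gcomp G g (gunit G (gdom G g)) = g"
    and inverse_exists: "g \<in> carrier G \<Longrightarrow> \<exists>h. is_ginv G g h"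

text \<open>
  A partial isomorphism \<open>g : v\<Lambda> \<rightarrow> w\<Lambda>\<close> is the triple \<open>(v, w, g)\<close> with \<open>g\<close> extensional on \<open>v\<Lambda>\<close>.
\<close>

definition PIso :: "('l, 'k::finite) kgraph \<Rightarrow> ('l \<times> 'l \<times> ('l \<Rightarrow> 'l), 'l) groupoid" where
  "PIso \<Lambda> = \<lparr>carrier = {(v, w, f).
       v \<in> vertices \<Lambda> \<and> w \<in> vertices \<Lambda> \<and>
       f \<in> extensional (paths_to \<Lambda> v) \<and> bij_betw f (paths_to \<Lambda> v) (paths_to \<Lambda> w) \<and>
       (\<forall>p. f ` (paths_to \<Lambda> v \<inter> paths \<Lambda> p) = paths_to \<Lambda> w \<inter> paths \<Lambda> p) \<and>
       (\<forall>\<alpha>\<in>paths_to \<Lambda> v. \<forall>e\<in>edges \<Lambda> \<inter> paths_to \<Lambda> (src \<Lambda> \<alpha>).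
          f (kcomp \<Lambda> \<alpha> e) \<in> kcomp \<Lambda> (f \<alpha>) ` paths_to \<Lambda> (src \<Lambda> (f \<alpha>)))},
     gdom = (\<lambda>(v, w, f). v),
     gcod = (\<lambda>(v, w, f). w),
     gcomp = (\<lambda>(v', w', f') (v, w, f). (v, w', compose (paths_to \<Lambda> v) f' f)),
     gunit = (\<lambda>v. (v, v, \<lambda>\<mu>\<in>paths_to \<Lambda> v. \<mu>))\<rparr>"

definition unit_preserving_hom ::
  "'v set \<Rightarrow> ('g, 'v) groupoid \<Rightarrow> ('h, 'v) groupoid \<Rightarrow> ('g \<Rightarrow> 'h) \<Rightarrow> bool" where
  "unit_preserving_hom V G H \<pi> \<longleftrightarrow>
     \<pi> \<in> carrier G \<rightarrow> carrier H \<and>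
     (\<forall>g\<in>carrier G. gdom H (\<pi> g) = gdom G g \<and> gcod H (\<pi> g) = gcod G g) \<and>
     (\<forall>v\<in>V. \<pi> (gunit G v) = gunit H v) \<and>
     (\<forall>g\<in>carrier G. \<forall>h\<in>carrier G. gdom G g = gcod G h \<longrightarrow> \<pi> (gcomp G g h) = gcomp H (\<pi> g) (\<pi> h))"

definition act :: "('g \<Rightarrow> 'l \<times> 'l \<times> ('l \<Rightarrow> 'l)) \<Rightarrow> 'g \<Rightarrow> 'l \<Rightarrow> 'l" where
  "act \<pi> g = snd (snd (\<pi> g))"

text \<open>The equations require \<open>h \<cdot> \<alpha>\<close> and \<open>(g \<cdot> e)(h \<cdot> \<alpha>)\<close> to be defined for \<open>\<alpha> \<in> s(e)\<Lambda>\<close>, whence the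
  conditions on domain and codomain of \<open>h\<close>.\<close>

definition is_edge_restriction ::
  "('l, 'k::finite) kgraph \<Rightarrow> ('g, 'l) groupoid \<Rightarrow> ('g \<Rightarrow> 'l \<times> 'l \<times> ('l \<Rightarrow> 'l)) \<Rightarrow> 'g \<Rightarrow> 'l \<Rightarrow> 'g \<Rightarrow> bool"
  where
  "is_edge_restriction \<Lambda> G \<pi> g e h \<longleftrightarrow>
     h \<in> carrier G \<and> gdom G h = src \<Lambda> e \<and> gcod G h = src \<Lambda> (act \<pi> g e) \<and>
     (\<forall>\<alpha>\<in>paths_to \<Lambda> (src \<Lambda> e). act \<pi> g (kcomp \<Lambda> e \<alpha>) = kcomp \<Lambda> (act \<pi> g e) (act \<pi> h \<alpha>))"

locale self_similar_action = kgraph \<Lambda> + groupoid_over "vertices \<Lambda>" G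
  for \<Lambda> :: "('l, 'k::finite) kgraph" and G :: "('g, 'l) groupoid" +
  fixes \<pi> :: "'g \<Rightarrow> 'l \<times> 'l \<times> ('l \<Rightarrow> 'l)"
  assumes action: "unit_preserving_hom (vertices \<Lambda>) G (PIso \<Lambda>) \<pi>"
    and faithful: "inj_on \<pi> (carrier G)"
    and self_similar: "g \<in> carrier G \<Longrightarrow> e \<in> edges \<Lambda> \<inter> paths_to \<Lambda> (gdom G g)
      \<Longrightarrow> \<exists>h. is_edge_restriction \<Lambda> G \<pi> g e h"

definition edge_restriction ::
  "('l, 'k::finite) kgraph \<Rightarrow> ('g, 'l) groupoid \<Rightarrow> ('g \<Rightarrow> 'l \<times> 'l \<times> ('l \<Rightarrow> 'l)) \<Rightarrow> 'g \<Rightarrow> 'l \<Rightarrow> 'g" where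
  "edge_restriction \<Lambda> G \<pi> g e = (THE h. is_edge_restriction \<Lambda> G \<pi> g e h)"

fun edge_factorisation :: "('l, 'k::finite) kgraph \<Rightarrow> 'l \<Rightarrow> 'l list \<Rightarrow> bool" where
  "edge_factorisation \<Lambda> \<alpha> [] \<longleftrightarrow> \<alpha> \<in> vertices \<Lambda>"
| "edge_factorisation \<Lambda> \<alpha> (e # es) \<longleftrightarrow>
     e \<in> edges \<Lambda> \<and> (\<exists>\<mu>\<in>paths_to \<Lambda> (src \<Lambda> e). \<alpha> = kcomp \<Lambda> e \<mu> \<and> edge_factorisation \<Lambda> \<mu> es)"

text \<open>The restriction does not depend on the factorisation chosen by \<open>SOME\<close>.\<close>

definition restriction ::
  "('l, 'k::finite) kgraph \<Rightarrow> ('g, 'l) groupoid \<Rightarrow> ('g \<Rightarrow> 'l \<times> 'l \<times> ('l \<Rightarrow> 'l)) \<Rightarrow> 'g \<Rightarrow> 'l \<Rightarrow> 'g" where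
  "restriction \<Lambda> G \<pi> g \<alpha> =
     foldl (edge_restriction \<Lambda> G \<pi>) g (SOME es. edge_factorisation \<Lambda> \<alpha> es)"

definition unitary_rep :: "('g, 'v) groupoid \<Rightarrow> 'b cstar \<Rightarrow> ('g \<Rightarrow> 'b) \<Rightarrow> bool" where
  "unitary_rep G B U \<longleftrightarrow>
     (\<forall>g\<in>carrier G. partial_isometry B (U g)) \<and>
     orthogonal_projections B (gunits G) U \<and>
     (\<forall>g\<in>carrier G. star B (U g) = U (ginv G g)) \<and>
     (\<forall>g\<in>carrier G. \<forall>h\<in>carrier G.
        U g \<otimes>\<^bsub>B\<^esub> U h = (if gdom G g = gcod G h then U (gcomp G g h) else \<zero>\<^bsub>B\<^esub>))"

definition groupoid_cstar :: "('g, 'v) groupoid \<Rightarrow> 'a cstar \<Rightarrow> ('g \<Rightarrow> 'a) \<Rightarrow> bool" where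
  "groupoid_cstar G A i \<longleftrightarrow>
     cstar_algebra A \<and> unitary_rep G A i \<and>
     cstar_generated A (i ` carrier G) = carrier A \<and>
     (\<forall>(B :: 'g test_space cstar) U. cstar_algebra B \<and> unitary_rep G B U \<longrightarrow>
        (\<exists>f. star_hom A B f \<and> (\<forall>g\<in>carrier G. f (i g) = U g)))"


section \<open>The product system \<open>M(G, \<Lambda>)\<close>\<close>

definition point_mass :: "'l \<Rightarrow> 'l \<Rightarrow> complex" where
  "point_mass \<alpha> = (\<lambda>\<mu>. if \<mu> = \<alpha> then 1 else 0)"

text \<open>Functions on a finite set \<open>S\<close> are functions on the whole type that vanish off \<open>S\<close>.\<close>

definition fun_algebra :: "'l set \<Rightarrow> ('l \<Rightarrow> complex) cstar" where
  "fun_algebra S = \<lparr>carrier = {f. \<forall>x. x \<notin> S \<longrightarrow> f x = 0},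
     monoid.mult = (\<lambda>f g x. f x * g x), one = (\<lambda>x. if x \<in> S then 1 else 0),
     zero = (\<lambda>x. 0), add = (\<lambda>f g x. f x + g x), smult = (\<lambda>c f x. c * f x),
     vnorm = (\<lambda>f. Max (insert 0 ((\<lambda>x. cmod (f x)) ` S))),
     star = (\<lambda>f x. cnj (f x))\<rparr>"

definition path_inner_prod ::
  "('l, 'k::finite) kgraph \<Rightarrow> nat ^ 'k \<Rightarrow> ('l \<Rightarrow> complex) \<Rightarrow> ('l \<Rightarrow> complex) \<Rightarrow> 'l \<Rightarrow> complex" where
  "path_inner_prod \<Lambda> p x y = (\<lambda>v. \<Sum>\<alpha>\<in>{\<alpha>\<in>paths \<Lambda> p. src \<Lambda> \<alpha> = v}. cnj (x \<alpha>) * y \<alpha>)"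

definition path_module ::
  "('l, 'k::finite) kgraph \<Rightarrow> nat ^ 'k \<Rightarrow> ('l \<Rightarrow> complex, 'l \<Rightarrow> complex) hmod" where
  "path_module \<Lambda> p = \<lparr>carrier = carrier (fun_algebra (paths \<Lambda> p)),
     monoid.mult = monoid.mult (fun_algebra (paths \<Lambda> p)), one = one (fun_algebra (paths \<Lambda> p)),
     zero = zero (fun_algebra (paths \<Lambda> p)), add = add (fun_algebra (paths \<Lambda> p)),
     smult = smult (fun_algebra (paths \<Lambda> p)),
     vnorm = (\<lambda>x. sqrt (vnorm (fun_algebra (vertices \<Lambda>)) (path_inner_prod \<Lambda> p x x))),
     ract = (\<lambda>x a \<alpha>. x \<alpha> * a (src \<Lambda> \<alpha>)),
     inner_prod = path_inner_prod \<Lambda> p,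
     lact = (\<lambda>a x \<alpha>. a (rng \<Lambda> \<alpha>) * x \<alpha>)\<rparr>"

definition vertex_hom ::
  "('l, 'k::finite) kgraph \<Rightarrow> ('g, 'l) groupoid \<Rightarrow> 'm cstar \<Rightarrow> ('g \<Rightarrow> 'm) \<Rightarrow> ('l \<Rightarrow> complex) \<Rightarrow> 'm" where
  "vertex_hom \<Lambda> G A i a = (\<Oplus>\<^bsub>A\<^esub>v\<in>vertices \<Lambda>. a v \<odot>\<^bsub>A\<^esub> i (gunit G v))"

text \<open>
  \<open>self_similar_system \<Lambda> G \<pi> A i M tens\<close>: \<open>M\<close> is the product system \<open>M(G, \<Lambda>)\<close> over
  \<open>A = C\<^sup>*(G)\<close>, and \<open>tens p x a\<close> is the elementary tensor of \<open>x \<in> X(\<Lambda>\<^sup>p)\<close> and \<open>a \<in> A\<close> in \<open>M\<^sub>p\<close>.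
  The elementary tensors of point masses and generators \<open>i\<^sub>g\<close> are total, so the formulas determine
  the left actions and the multiplication.
\<close>

locale self_similar_system = product_system A M
  for \<Lambda> :: "('l, 'k::finite) kgraph" and G :: "('g, 'l) groupoid"
    and \<pi> :: "'g \<Rightarrow> 'l \<times> 'l \<times> ('l \<Rightarrow> 'l)"
    and A :: "'m cstar" and i :: "'g \<Rightarrow> 'm" and M :: "('m, 'k) psystem"
    and tens :: "nat ^ 'k \<Rightarrow> ('l \<Rightarrow> complex) \<Rightarrow> 'm \<Rightarrow> 'm" +
  assumes fibre_tensor: "p \<noteq> 0
      \<Longrightarrow> interior_tensor (path_module \<Lambda> p) (fun_algebra (vertices \<Lambda>)) (vertex_hom \<Lambda> G A i)
            A (pmod M p) (tens p)"
    and left_action_formula: "p \<noteq> 0 \<Longrightarrow> g \<in> carrier G \<Longrightarrow> \<alpha> \<in> paths \<Lambda> p \<Longrightarrow> a \<in> carrier A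
      \<Longrightarrow> lact (pmod M p) (i g) (tens p (point_mass \<alpha>) a) =
          (if rng \<Lambda> \<alpha> = gdom G g
           then tens p (point_mass (act \<pi> g \<alpha>)) (i (restriction \<Lambda> G \<pi> g \<alpha>) \<otimes>\<^bsub>A\<^esub> a)
           else \<zero>\<^bsub>pmod M p\<^esub>)"
    and multiplication_formula: "p \<noteq> 0 \<Longrightarrow> q \<noteq> 0 \<Longrightarrow> \<alpha> \<in> paths \<Lambda> p \<Longrightarrow> \<mu> \<in> paths \<Lambda> q
      \<Longrightarrow> g \<in> carrier G \<Longrightarrow> h \<in> carrier G \<Longrightarrow> src \<Lambda> \<alpha> = gcod G g \<Longrightarrow> src \<Lambda> \<mu> = gcod G h
      \<Longrightarrow> pmul M p q (tens p (point_mass \<alpha>) (i g)) (tens q (point_mass \<mu>) (i h)) =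
          (if rng \<Lambda> \<mu> = gdom G g
           then tens (p + q) (point_mass (kcomp \<Lambda> \<alpha> (act \<pi> g \<mu>)))
                  (i (gcomp G (restriction \<Lambda> G \<pi> g \<mu>) h))
           else \<zero>\<^bsub>pmod M (p + q)\<^esub>)"

end

theory Submission
  imports Defs
begin

text \<open>
  For a path \<open>\<alpha>\<close> of degree \<open>p\<close> let \<open>x\<^sub>\<alpha> = \<delta>\<^sub>\<alpha> \<otimes> i\<^sub>s\<^sub>(\<^sub>\<alpha>\<^sub>) \<in> M\<^sub>p\<close>, so that \<open>t\<^sub>\<alpha> = \<psi>\<^sub>p(x\<^sub>\<alpha>)\<close>.  As \<open>\<Lambda>\<^sup>p\<close> is
  finite, the \<open>x\<^sub>\<alpha>\<close> form a finite orthogonal frame of \<open>M\<^sub>p\<close>: \<open>z = \<Sum>\<^sub>\<alpha> x\<^sub>\<alpha>\<langle>x\<^sub>\<alpha>, z\<rangle>\<close>.  Hence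
  \<open>\<psi>\<^sub>p(z) = \<Sum>\<^sub>\<alpha> t\<^sub>\<alpha> \<psi>\<^sub>0(\<langle>x\<^sub>\<alpha>, z\<rangle>)\<close>, which gives generation, and the operator that corresponds to
  \<open>\<Theta>\<^sub>x\<^sub>\<alpha>\<^sub>,\<^sub>x\<^sub>\<alpha> \<otimes> 1\<close> on \<open>M\<^sub>r\<close> is the sum of the \<open>\<Theta>\<^sub>x\<^sub>\<gamma>\<^sub>,\<^sub>x\<^sub>\<gamma>\<close> over the extensions \<open>\<gamma>\<close> of \<open>\<alpha>\<close> of degree \<open>r\<close>.
  For \<open>r = p \<or> q\<close>, Nica covariance then turns \<open>t\<^sub>\<alpha> t\<^sub>\<alpha>\<^sup>* t\<^sub>\<mu> t\<^sub>\<mu>\<^sup>*\<close> into the sum of \<open>t\<^sub>\<gamma> t\<^sub>\<gamma>\<^sup>*\<close> over the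
  common extensions \<open>\<gamma>\<close> of \<open>\<alpha>\<close> and \<open>\<mu>\<close> of degree \<open>r\<close>; compressing by \<open>t\<^sub>\<alpha>\<^sup>*\<close> and \<open>t\<^sub>\<mu>\<close> yields the
  Toeplitz--Cuntz--Krieger relation.  The analytic input is that *-homomorphisms out of a unital
  \<open>C\<^sup>*\<close>-algebra are contractive: a self-adjoint \<open>h\<close> with \<open>\<parallel>h\<parallel> < 1\<close> is the real part of
  \<open>w = h + i(1 - h\<^sup>2)\<^sup>1\<^sup>/\<^sup>2\<close>, and \<open>w\<^sup>* w = 1\<close>.
\<close>

section \<open>Banach spaces and bounded maps\<close>

sublocale complex_banach \<subseteq> mod: Module.module complex_ring V
  by (rule module)

lemma complex_ring_simps [simp]:
  "carrier complex_ring = UNIV" "x \<oplus>\<^bsub>complex_ring\<^esub> y = x + y"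
  "x \<otimes>\<^bsub>complex_ring\<^esub> y = x * y" "\<one>\<^bsub>complex_ring\<^esub> = 1" "\<zero>\<^bsub>complex_ring\<^esub> = 0"
  by (simp_all add: complex_ring_def)

lemma null_comparison:
  fixes f g :: "nat \<Rightarrow> real"
  assumes "g \<longlonglongrightarrow> 0" "\<And>n. 0 \<le> f n" "\<And>n. f n \<le> g n"
  shows "f \<longlonglongrightarrow> 0"
  using assms tendsto_sandwich[of "\<lambda>_. 0" f sequentially g 0] by simp

definition converges :: "('v, 'z) nspace_scheme \<Rightarrow> (nat \<Rightarrow> 'v) \<Rightarrow> 'v \<Rightarrow> bool" where
  "converges V X x \<longleftrightarrow> (\<lambda>n. vnorm V (X n \<ominus>\<^bsub>V\<^esub> x)) \<longlonglongrightarrow> 0"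

section \<open>Vector space and norm rules\<close>

context complex_banach
begin

lemma smult_in [simp, intro]: "x \<in> carrier V \<Longrightarrow> c \<odot> x \<in> carrier V"
  using mod.smult_closed[of c x] by simp

lemma smult_zero_left [simp]: "x \<in> carrier V \<Longrightarrow> 0 \<odot> x = \<zero>"
  using mod.smult_l_null[of x] by simp

lemma smult_zero_right [simp]: "c \<odot> \<zero> = \<zero>"
  using mod.smult_r_null[of c] by simp

lemma smult_one_left [simp]: "x \<in> carrier V \<Longrightarrow> 1 \<odot> x = x"
  using mod.smult_one[of x] by simp

lemma smult_smult: "x \<in> carrier V \<Longrightarrow> c \<odot> (d \<odot> x) = (c * d) \<odot> x"
  using mod.smult_assoc1[of c d x] by simp

lemma smult_add: "x \<in> carrier V \<Longrightarrow> y \<in> carrier V \<Longrightarrow> c \<odot> (x \<oplus> y) = c \<odot> x \<oplus> c \<odot> y"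
  using mod.smult_r_distr[of c x y] by simp

lemma add_smult: "x \<in> carrier V \<Longrightarrow> (c + d) \<odot> x = c \<odot> x \<oplus> d \<odot> x"
  using mod.smult_l_distr[of c d x] by simp

lemma a_inv_smult: "x \<in> carrier V \<Longrightarrow> \<ominus> x = (-1) \<odot> x"
proof -
  assume x: "x \<in> carrier V"
  have "(-1) \<odot> x \<oplus> x = (-1 + 1) \<odot> x"
    using x add_smult[of x "-1" 1] by simp
  then show ?thesis
    using x mod.M.minus_equality[of "(-1) \<odot> x" x] by simp
qed

lemma minus_smult: "x \<in> carrier V \<Longrightarrow> y \<in> carrier V \<Longrightarrow> x \<ominus> y = x \<oplus> (-1) \<odot> y"
  by (simp add: mod.M.minus_eq a_inv_smult)

lemma minus_add_minus:
  "x \<in> carrier V \<Longrightarrow> y \<in> carrier V \<Longrightarrow> z \<in> carrier V \<Longrightarrow> (x \<ominus> y) \<oplus> (y \<ominus> z) = x \<ominus> z"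
  by (simp add: mod.M.minus_eq mod.M.a_assoc mod.M.r_neg1)

lemma minus_swap: "x \<in> carrier V \<Longrightarrow> y \<in> carrier V \<Longrightarrow> y \<ominus> x = (-1) \<odot> (x \<ominus> y)"
  by (simp add: minus_smult smult_add smult_smult mod.M.a_comm)

lemma minus_self [simp]: "x \<in> carrier V \<Longrightarrow> x \<ominus> x = \<zero>"
  by (simp add: mod.M.minus_eq mod.M.r_neg)

lemma minus_zero [simp]: "x \<in> carrier V \<Longrightarrow> x \<ominus> \<zero> = x"
  by (simp add: minus_smult)

lemma minus_eq_zero_iff: "x \<in> carrier V \<Longrightarrow> y \<in> carrier V \<Longrightarrow> x \<ominus> y = \<zero> \<longleftrightarrow> x = y"
  using minus_add_minus[of x y \<zero>] by auto

lemma norm_zero [simp]: "vnorm V \<zero> = 0"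
  by (simp add: norm_eq_0)

lemma norm_minus_swap: "x \<in> carrier V \<Longrightarrow> y \<in> carrier V \<Longrightarrow> vnorm V (x \<ominus> y) = vnorm V (y \<ominus> x)"
  using minus_swap[of x y] norm_smult[of "x \<ominus> y" "-1"] by simp

lemma norm_minus_triangle:
  assumes "x \<in> carrier V" "y \<in> carrier V" "z \<in> carrier V"
  shows "vnorm V (x \<ominus> z) \<le> vnorm V (x \<ominus> y) + vnorm V (y \<ominus> z)"
  using norm_triangle[of "x \<ominus> y" "y \<ominus> z"] minus_add_minus[of x y z] assms by simp

lemma norm_minus_le: "x \<in> carrier V \<Longrightarrow> y \<in> carrier V \<Longrightarrow> vnorm V (x \<ominus> y) \<le> vnorm V x + vnorm V y"
  using norm_minus_triangle[of x \<zero> y] norm_minus_swap[of \<zero> y] by simp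

lemma converges_unique:
  assumes X: "\<And>n. X n \<in> carrier V" and x: "x \<in> carrier V" "converges V X x"
    and y: "y \<in> carrier V" "converges V X y"
  shows "x = y"
proof -
  have "(\<lambda>n. vnorm V (X n \<ominus> x) + vnorm V (X n \<ominus> y)) \<longlonglongrightarrow> 0"
    using tendsto_add[of _ 0 _ _ 0] x y unfolding converges_def by fastforce
  moreover have "vnorm V (x \<ominus> y) \<le> vnorm V (X n \<ominus> x) + vnorm V (X n \<ominus> y)" for n
    using norm_minus_triangle[of x "X n" y] norm_minus_swap[of x "X n"] X x y by simp
  ultimately have "vnorm V (x \<ominus> y) \<le> 0"
    by (meson LIMSEQ_le_const)
  then show ?thesis
    using norm_nonneg[of "x \<ominus> y"] norm_eq_0[of "x \<ominus> y"] minus_eq_zero_iff[of x y] x y by simp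
qed

section \<open>Closed subspaces and closed spans\<close>

lemma closed_subspace_carrier: "closed_subspace V (carrier V)"
  by (auto simp: closed_subspace_def)

text \<open>The vectors with property P form one of the closed subspaces over which the closed span
  is the intersection. The predicate is confined to the carrier, so \<open>base\<close> asks for
  membership in the carrier as well.\<close>

lemma closed_span_induct [consumes 1, case_names closed base]:
  assumes "x \<in> closed_span V S" "closed_subspace V {x \<in> carrier V. P x}"
    and "\<And>x. x \<in> S \<Longrightarrow> x \<in> carrier V \<and> P x"
  shows "P x"
  using assms by (auto simp: closed_span_def)

end

lemma closed_subspace_converges:
  "\<lbrakk>closed_subspace V C; \<And>n. X n \<in> C; x \<in> carrier V; converges V X x\<rbrakk> \<Longrightarrow> x \<in> C"
  unfolding closed_subspace_def converges_def by blast

text \<open>The family has to be nonempty because the intersection of no sets is the whole type,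
  which need not lie inside the carrier.\<close>

lemma closed_subspace_Inter:
  assumes "\<F> \<noteq> {}" "\<And>C. C \<in> \<F> \<Longrightarrow> closed_subspace V C"
  shows "closed_subspace V (\<Inter>\<F>)"
  unfolding closed_subspace_def
proof (intro conjI allI impI ballI)
  show "\<Inter>\<F> \<subseteq> carrier V" "\<zero>\<^bsub>V\<^esub> \<in> \<Inter>\<F>"
    using assms unfolding closed_subspace_def by blast+
  show "x \<oplus>\<^bsub>V\<^esub> y \<in> \<Inter>\<F>" if "x \<in> \<Inter>\<F>" "y \<in> \<Inter>\<F>" for x y
    using assms that unfolding closed_subspace_def by blast
  show "c \<odot>\<^bsub>V\<^esub> x \<in> \<Inter>\<F>" if "x \<in> \<Inter>\<F>" for c x
    using assms that unfolding closed_subspace_def by blast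
  show "x \<in> \<Inter>\<F>" if *: "(\<forall>n::nat. X n \<in> \<Inter>\<F>) \<and> x \<in> carrier V \<and> (\<lambda>n. vnorm V (X n \<ominus>\<^bsub>V\<^esub> x)) \<longlonglongrightarrow> 0"
    for X x
  proof
    fix C assume C: "C \<in> \<F>"
    then show "x \<in> C"
      using closed_subspace_converges[OF assms(2)[OF C], of X x] * unfolding converges_def by blast
  qed
qed

lemma closed_subspace_Int:
  "closed_subspace V C \<Longrightarrow> closed_subspace V D \<Longrightarrow> closed_subspace V (C \<inter> D)"
  using closed_subspace_Inter[of "{C, D}" V] by auto

text \<open>Some bound is asked for, not the operator norm: boundedness serves only to pass to
  limits, so the constant 6 in \<open>norm_ip_le\<close> does no harm.\<close>

definition bounded_linear_on ::
  "('v, 'y) nspace_scheme \<Rightarrow> ('w, 'z) nspace_scheme \<Rightarrow> ('v \<Rightarrow> 'w) \<Rightarrow> bool" where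
  "bounded_linear_on V W f \<longleftrightarrow>
     linear_on V W f \<and> (\<exists>K. \<forall>x\<in>carrier V. vnorm W (f x) \<le> K * vnorm V x)"

locale banach_pair = V: complex_banach V + W: complex_banach W
  for V :: "('v, 'y) nspace_scheme" and W :: "('w, 'z) nspace_scheme"
begin

lemma linear_closed: "linear_on V W f \<Longrightarrow> x \<in> carrier V \<Longrightarrow> f x \<in> carrier W"
  by (auto simp: linear_on_def)

lemma linear_add: "linear_on V W f \<Longrightarrow> x \<in> carrier V \<Longrightarrow> y \<in> carrier V
    \<Longrightarrow> f (x \<oplus>\<^bsub>V\<^esub> y) = f x \<oplus>\<^bsub>W\<^esub> f y"
  by (auto simp: linear_on_def)

lemma linear_smult: "linear_on V W f \<Longrightarrow> x \<in> carrier V \<Longrightarrow> f (c \<odot>\<^bsub>V\<^esub> x) = c \<odot>\<^bsub>W\<^esub> f x"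
  by (auto simp: linear_on_def)

lemma linear_zero: "linear_on V W f \<Longrightarrow> f \<zero>\<^bsub>V\<^esub> = \<zero>\<^bsub>W\<^esub>"
  using linear_smult[of f "\<zero>\<^bsub>V\<^esub>" 0] linear_closed[of f "\<zero>\<^bsub>V\<^esub>"] by simp

lemma linear_minus: "linear_on V W f \<Longrightarrow> x \<in> carrier V \<Longrightarrow> y \<in> carrier V
    \<Longrightarrow> f (x \<ominus>\<^bsub>V\<^esub> y) = f x \<ominus>\<^bsub>W\<^esub> f y"
  by (simp add: V.minus_smult W.minus_smult linear_add linear_smult linear_closed)

lemma linear_finsum:
  assumes "linear_on V W f" "finite I" "x \<in> I \<rightarrow> carrier V"
  shows "f (finsum V x I) = finsum W (\<lambda>i. f (x i)) I"
  using assms(2,3)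
proof (induction I rule: finite_induct)
  case empty
  then show ?case
    using linear_zero[OF assms(1)] by simp
next
  case (insert j I)
  moreover have "(\<lambda>i. f (x i)) \<in> insert j I \<rightarrow> carrier W"
    using insert.prems linear_closed[OF assms(1)] by auto
  ultimately show ?case
    using linear_add[OF assms(1)] by simp
qed

lemma bounded_linear_converges:
  assumes f: "bounded_linear_on V W f" and X: "\<And>n. X n \<in> carrier V" "x \<in> carrier V" "converges V X x"
  shows "converges W (\<lambda>n. f (X n)) (f x)"
proof -
  obtain K where K: "\<And>x. x \<in> carrier V \<Longrightarrow> vnorm W (f x) \<le> K * vnorm V x" and lin: "linear_on V W f"
    using f unfolding bounded_linear_on_def by blast
  have "(\<lambda>n. K * vnorm V (X n \<ominus>\<^bsub>V\<^esub> x)) \<longlonglongrightarrow> 0"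
    using X(3) tendsto_mult_right_zero unfolding converges_def by blast
  moreover have "0 \<le> vnorm W (f (X n) \<ominus>\<^bsub>W\<^esub> f x)" for n
    using X linear_closed[OF lin] by (intro W.norm_nonneg) simp
  moreover have "vnorm W (f (X n) \<ominus>\<^bsub>W\<^esub> f x) \<le> K * vnorm V (X n \<ominus>\<^bsub>V\<^esub> x)" for n
    using K[of "X n \<ominus>\<^bsub>V\<^esub> x"] linear_minus[OF lin] X by simp
  ultimately have "(\<lambda>n. vnorm W (f (X n) \<ominus>\<^bsub>W\<^esub> f x)) \<longlonglongrightarrow> 0"
    by (rule null_comparison)
  then show ?thesis
    by (simp add: converges_def)
qed

text \<open>Bounded maps carry limits to limits, so closedness passes to preimages. This is how
  C*-subalgebras are later pulled back along *-homomorphisms.\<close>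

lemma closed_subspace_vimage:
  assumes f: "bounded_linear_on V W f" and C: "closed_subspace W C"
  shows "closed_subspace V {x \<in> carrier V. f x \<in> C}"
proof -
  have lin: "linear_on V W f"
    using f by (simp add: bounded_linear_on_def)
  show ?thesis
    unfolding closed_subspace_def
  proof (intro conjI allI impI ballI)
    show "\<zero>\<^bsub>V\<^esub> \<in> {x \<in> carrier V. f x \<in> C}"
      using C by (simp add: linear_zero[OF lin] closed_subspace_def)
    show "x \<oplus>\<^bsub>V\<^esub> y \<in> {x \<in> carrier V. f x \<in> C}"
      if "x \<in> {x \<in> carrier V. f x \<in> C}" "y \<in> {x \<in> carrier V. f x \<in> C}" for x y
      using C that by (simp add: linear_add[OF lin] closed_subspace_def)
    show "c \<odot>\<^bsub>V\<^esub> x \<in> {x \<in> carrier V. f x \<in> C}" if "x \<in> {x \<in> carrier V. f x \<in> C}" for c x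
      using C that by (simp add: linear_smult[OF lin] closed_subspace_def)
    show "x \<in> {x \<in> carrier V. f x \<in> C}"
      if "(\<forall>n. X n \<in> {x \<in> carrier V. f x \<in> C}) \<and> x \<in> carrier V \<and> (\<lambda>n. vnorm V (X n \<ominus>\<^bsub>V\<^esub> x)) \<longlonglongrightarrow> 0"
      for X x
      using that closed_subspace_converges[OF C, of "\<lambda>n. f (X n)" "f x"]
        bounded_linear_converges[OF f, of X x] linear_closed[OF lin, of x]
      unfolding converges_def by blast
  qed auto
qed

lemma linear_on_minus:
  assumes "linear_on V W f" "linear_on V W g"
  shows "linear_on V W (\<lambda>x. f x \<ominus>\<^bsub>W\<^esub> g x)"
  using assms unfolding linear_on_def Pi_iff
  by (auto simp: W.minus_smult W.smult_add W.smult_smult W.mod.M.a_ac)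

text \<open>The equaliser is the preimage under f - g of the zero subspace, which is closed by
  uniqueness of limits. Identities between bounded maps thus extend from a set to its closed
  span.\<close>

lemma closed_subspace_equaliser:
  assumes "bounded_linear_on V W f" "bounded_linear_on V W g"
  shows "closed_subspace V {x \<in> carrier V. f x = g x}"
proof -
  let ?h = "\<lambda>x. f x \<ominus>\<^bsub>W\<^esub> g x"
  obtain K L where KL: "\<And>x. x \<in> carrier V \<Longrightarrow> vnorm W (f x) \<le> K * vnorm V x"
      "\<And>x. x \<in> carrier V \<Longrightarrow> vnorm W (g x) \<le> L * vnorm V x"
    and lin: "linear_on V W f" "linear_on V W g"
    using assms unfolding bounded_linear_on_def by blast
  have "vnorm W (?h x) \<le> (K + L) * vnorm V x" if x: "x \<in> carrier V" for x
    using KL[OF x] W.norm_minus_le[of "f x" "g x"] linear_closed[OF lin(1) x] linear_closed[OF lin(2) x]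
    by (simp add: distrib_right)
  then have "bounded_linear_on V W ?h"
    unfolding bounded_linear_on_def using linear_on_minus[OF lin] by blast
  moreover have "closed_subspace W {\<zero>\<^bsub>W\<^esub>}"
    unfolding closed_subspace_def
  proof (intro conjI allI impI)
    fix X x
    assume *: "(\<forall>n::nat. X n \<in> {\<zero>\<^bsub>W\<^esub>}) \<and> x \<in> carrier W \<and> (\<lambda>n. vnorm W (X n \<ominus>\<^bsub>W\<^esub> x)) \<longlonglongrightarrow> 0"
    then have "converges W X x" "converges W X \<zero>\<^bsub>W\<^esub>" "\<And>n. X n \<in> carrier W"
      unfolding converges_def by (blast, auto)
    then show "x \<in> {\<zero>\<^bsub>W\<^esub>}"
      using W.converges_unique[of X x "\<zero>\<^bsub>W\<^esub>"] * by simp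
  qed simp_all
  ultimately have "closed_subspace V {x \<in> carrier V. ?h x \<in> {\<zero>\<^bsub>W\<^esub>}}"
    by (rule closed_subspace_vimage)
  moreover have "{x \<in> carrier V. ?h x \<in> {\<zero>\<^bsub>W\<^esub>}} = {x \<in> carrier V. f x = g x}"
    using W.minus_eq_zero_iff linear_closed[OF lin(1)] linear_closed[OF lin(2)] by blast
  ultimately show ?thesis
    by simp
qed

end

lemma (in complex_banach) bounded_linear_id: "bounded_linear_on V V (\<lambda>x. x)"
proof -
  have "\<forall>x\<in>carrier V. vnorm V x \<le> 1 * vnorm V x"
    by simp
  then show ?thesis
    unfolding bounded_linear_on_def linear_on_def by blast
qed

section \<open>\<open>C\<^sup>*\<close>-algebras\<close>

context cstar_algebra
begin

sublocale self: banach_pair A A ..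

lemma mult_in [simp, intro]: "x \<in> carrier A \<Longrightarrow> y \<in> carrier A \<Longrightarrow> x \<otimes> y \<in> carrier A"
  by (rule mult_closed)

lemma star_in [simp, intro]: "x \<in> carrier A \<Longrightarrow> star A x \<in> carrier A"
  by (rule star_closed)

declare star_star [simp]

lemma bounded_linear_mult_left: "a \<in> carrier A \<Longrightarrow> bounded_linear_on A A (\<lambda>x. a \<otimes> x)"
proof -
  assume a: "a \<in> carrier A"
  then have "linear_on A A (\<lambda>x. a \<otimes> x)"
    by (simp add: linear_on_def distrib_left mult_smult)
  moreover have "\<forall>x\<in>carrier A. vnorm A (a \<otimes> x) \<le> vnorm A a * vnorm A x"
    using a norm_mult by blast
  ultimately show ?thesis
    unfolding bounded_linear_on_def by blast
qed

lemma bounded_linear_mult_right: "a \<in> carrier A \<Longrightarrow> bounded_linear_on A A (\<lambda>x. x \<otimes> a)"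
proof -
  assume a: "a \<in> carrier A"
  then have "linear_on A A (\<lambda>x. x \<otimes> a)"
    by (simp add: linear_on_def distrib_right smult_mult)
  moreover have "\<forall>x\<in>carrier A. vnorm A (x \<otimes> a) \<le> vnorm A a * vnorm A x"
    using a norm_mult by (simp add: mult.commute)
  ultimately show ?thesis
    unfolding bounded_linear_on_def by blast
qed

lemma linear_mult_left: "a \<in> carrier A \<Longrightarrow> linear_on A A (\<lambda>x. a \<otimes> x)"
  and linear_mult_right: "a \<in> carrier A \<Longrightarrow> linear_on A A (\<lambda>x. x \<otimes> a)"
  using bounded_linear_mult_left bounded_linear_mult_right by (simp_all add: bounded_linear_on_def)

lemmas mult_zero_right [simp] = self.linear_zero[OF linear_mult_left]
  and mult_zero_left [simp] = self.linear_zero[OF linear_mult_right]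
  and mult_finsum_right = self.linear_finsum[OF linear_mult_left]
  and mult_finsum_left = self.linear_finsum[OF linear_mult_right]
  and mult_minus_right = self.linear_minus[OF linear_mult_left]
  and mult_minus_left = self.linear_minus[OF linear_mult_right]

lemma star_zero [simp]: "star A \<zero> = \<zero>"
  using star_smult[of \<zero> 0] by simp

lemma star_minus: "x \<in> carrier A \<Longrightarrow> y \<in> carrier A \<Longrightarrow> star A (x \<ominus> y) = star A x \<ominus> star A y"
  by (simp add: minus_smult star_add star_smult)

text \<open>Divide the inequality obtained from the C*-identity, that the square of the norm of x is
  at most the norm of x* times that of x, by the norm of x.\<close>

lemma norm_le_star: "x \<in> carrier A \<Longrightarrow> vnorm A x \<le> vnorm A (star A x)"
proof (cases "vnorm A x = 0")
  case False
  assume x: "x \<in> carrier A"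
  have "vnorm A x * vnorm A x \<le> vnorm A (star A x) * vnorm A x"
    using norm_mult[of "star A x" x] cstar_identity[of x] x by (simp add: power2_eq_square)
  then show ?thesis
    using False norm_nonneg[OF x] by simp
qed (simp add: norm_nonneg)

lemma norm_star: "x \<in> carrier A \<Longrightarrow> vnorm A (star A x) = vnorm A x"
  using norm_le_star[of x] norm_le_star[of "star A x"] by simp

lemma star_converges:
  assumes "\<And>n. X n \<in> carrier A" "x \<in> carrier A" "converges A X x"
  shows "converges A (\<lambda>n. star A (X n)) (star A x)"
  using assms norm_star[of "X _ \<ominus> x"] by (simp add: converges_def star_minus[symmetric])

lemma cstar_subalgebra_carrier: "cstar_subalgebra A (carrier A)"
  by (simp add: cstar_subalgebra_def closed_subspace_carrier)

lemma cstar_generated_eqI: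
  assumes "S \<subseteq> carrier A" "\<And>C. cstar_subalgebra A C \<Longrightarrow> S \<subseteq> C \<Longrightarrow> carrier A \<subseteq> C"
  shows "cstar_generated A S = carrier A"
  using assms cstar_subalgebra_carrier unfolding cstar_generated_def by blast

text \<open>Uniqueness of limits makes the set of elements fixed by \<open>e\<close> on both sides a \<open>C\<^sup>*\<close>-subalgebra.\<close>

lemma is_identity_if_generated:
  assumes S: "cstar_generated A S = carrier A" "S \<subseteq> carrier A"
    and e: "e \<in> carrier A" "star A e = e" "\<And>s. s \<in> S \<Longrightarrow> e \<otimes> s = s" "\<And>s. s \<in> S \<Longrightarrow> s \<otimes> e = s"
  shows "is_identity A e"
proof -
  let ?C = "{x \<in> carrier A. e \<otimes> x = x} \<inter> {x \<in> carrier A. x \<otimes> e = x}"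
  have "closed_subspace A {x \<in> carrier A. e \<otimes> x = x}" "closed_subspace A {x \<in> carrier A. x \<otimes> e = x}"
    using self.closed_subspace_equaliser[OF _ bounded_linear_id]
      bounded_linear_mult_left[OF e(1)] bounded_linear_mult_right[OF e(1)] by blast+
  then have "closed_subspace A ?C"
    by (rule closed_subspace_Int)
  moreover have "x \<otimes> y \<in> ?C" if "x \<in> ?C" "y \<in> ?C" for x y
    using that e(1) mult_assoc[of e x y] mult_assoc[of x y e] by simp
  moreover have "star A x \<in> ?C" if "x \<in> ?C" for x
    using that e star_mult[of x e] star_mult[of e x] by simp
  ultimately have "cstar_subalgebra A ?C"
    unfolding cstar_subalgebra_def by blast
  moreover have "S \<subseteq> ?C"
    using S e by auto
  ultimately have "carrier A \<subseteq> ?C"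
    using S(1) unfolding cstar_generated_def by blast
  then show ?thesis
    using e(1) unfolding is_identity_def by blast
qed

end

section \<open>Square roots of e - h^2 and self-adjoint elements as real parts\<close>

context cstar_algebra
begin

text \<open>Writing x^2 - y^2 as x(x - y) + (x - y)y requires no commutation of x and y. This is the
  contraction estimate for the map that sends x to (t + x^2)/2.\<close>

lemma norm_half_square_diff:
  assumes "t \<in> carrier A" "x \<in> carrier A" "y \<in> carrier A"
  shows "vnorm A ((1/2) \<odot> (t \<oplus> x \<otimes> x) \<ominus> (1/2) \<odot> (t \<oplus> y \<otimes> y))
    \<le> (vnorm A x + vnorm A y) / 2 * vnorm A (x \<ominus> y)"
proof -
  have "x \<otimes> (x \<ominus> y) \<oplus> (x \<ominus> y) \<otimes> y = x \<otimes> x \<ominus> y \<otimes> y"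
    using assms by (simp add: mult_minus_right mult_minus_left minus_add_minus)
  moreover have "(t \<oplus> x \<otimes> x) \<ominus> (t \<oplus> y \<otimes> y) = x \<otimes> x \<ominus> y \<otimes> y"
    using assms by (simp add: mod.M.minus_eq mod.M.minus_add mod.M.a_ac mod.M.r_neg1 mod.M.r_neg2)
  moreover have "(1/2) \<odot> (t \<oplus> x \<otimes> x) \<ominus> (1/2) \<odot> (t \<oplus> y \<otimes> y)
      = (1/2) \<odot> ((t \<oplus> x \<otimes> x) \<ominus> (t \<oplus> y \<otimes> y))"
    using assms by (simp add: minus_smult smult_add smult_smult)
  moreover have "vnorm A (x \<otimes> (x \<ominus> y) \<oplus> (x \<ominus> y) \<otimes> y)
      \<le> vnorm A x * vnorm A (x \<ominus> y) + vnorm A (x \<ominus> y) * vnorm A y"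
    using assms norm_triangle[of "x \<otimes> (x \<ominus> y)" "(x \<ominus> y) \<otimes> y"] norm_mult[of x "x \<ominus> y"]
      norm_mult[of "x \<ominus> y" y] by simp
  ultimately show ?thesis
    using assms by (simp add: norm_smult norm_divide algebra_simps)
qed

text \<open>\<open>e - g\<close> is the square root of \<open>e - h\<^sup>2\<close>; \<open>g\<close> is the fixed point of a contraction of the ball of
  radius \<open>\<parallel>h\<parallel>\<close>.\<close>

lemma self_adjoint_sqrt_exists:
  assumes h: "h \<in> carrier A" "star A h = h" "vnorm A h < 1"
  shows "\<exists>g\<in>carrier A. star A g = g \<and> h \<otimes> g = g \<otimes> h \<and> g \<oplus> g = h \<otimes> h \<oplus> g \<otimes> g"
proof -
  define s where "s = vnorm A h"
  \<comment> \<open>Expanding (e - g)^2 = e - h^2 leaves g + g = h^2 + g^2, that is g = F g, an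
    equation in which the unit no longer occurs.\<close>
  define F where "F x = (1/2) \<odot> (h \<otimes> h \<oplus> x \<otimes> x)" for x
  define X where "X n = (F ^^ n) \<zero>" for n
  have s: "0 \<le> s" "s < 1"
    using h norm_nonneg unfolding s_def by auto
  have X_Suc: "X (Suc n) = F (X n)" and X_0: "X 0 = \<zero>" for n
    by (simp_all add: X_def)
  have F_in: "F x \<in> carrier A" if "x \<in> carrier A" for x
    using that h by (simp add: F_def)
  have X_in: "X n \<in> carrier A" for n
    by (induction n) (simp_all add: X_Suc X_0 F_in)
  have X_norm: "vnorm A (X n) \<le> s" for n
  proof (induction n)
    case (Suc n)
    have "vnorm A (h \<otimes> h \<oplus> X n \<otimes> X n) \<le> s * s + vnorm A (X n) * vnorm A (X n)"
      using h X_in norm_triangle[of "h \<otimes> h" "X n \<otimes> X n"] norm_mult[of h h] norm_mult[of "X n" "X n"]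
      by (simp add: s_def)
    also have "\<dots> \<le> s * s + s * s"
      using Suc norm_nonneg[OF X_in] s by (intro add_left_mono mult_mono) auto
    \<comment> \<open>As s < 1, s^2 is at most s; with the factor 1/2 this shows that F maps the
      ball of radius s into itself.\<close>
    also have "\<dots> \<le> 2 * s"
      using s mult_left_mono[of s 1 s] by simp
    finally show ?case
      using h X_in by (simp add: X_Suc F_def norm_smult norm_divide)
  qed (simp add: X_0 s)
  have X_star: "star A (X n) = X n" for n
    by (induction n) (simp_all add: X_Suc X_0 F_def X_in h star_smult star_add star_mult)
  have X_comm: "h \<otimes> X n = X n \<otimes> h" for n
  proof (induction n)
    case (Suc n)
    have "h \<otimes> (X n \<otimes> X n) = (X n \<otimes> X n) \<otimes> h"
      using Suc X_in h(1) mult_assoc[of h "X n" "X n"] mult_assoc[of "X n" h "X n"] mult_assoc[of "X n" "X n" h]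
      by simp
    then show ?case
      using h(1) X_in by (simp add: X_Suc F_def mult_smult smult_mult distrib_left distrib_right mult_assoc)
  qed (simp add: X_0 h)
  have step: "vnorm A (F x \<ominus> F y) \<le> (vnorm A x + vnorm A y) / 2 * vnorm A (x \<ominus> y)"
    if "x \<in> carrier A" "y \<in> carrier A" for x y
    unfolding F_def using norm_half_square_diff[of "h \<otimes> h" x y] that h by simp
  \<comment> \<open>On the ball of radius s the map F has Lipschitz constant (s + s)/2 = s. Starting
    from the bound s for X j - X 0, this gives a geometric rate that is uniform in j.\<close>
  have diff: "vnorm A (X (n + j) \<ominus> X n) \<le> s ^ n * s" for n j
  proof (induction n)
    case 0
    show ?case
      using X_norm[of j] X_in by (simp add: X_0)
  next
    case (Suc n)
    have "vnorm A (X (Suc n + j) \<ominus> X (Suc n))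
        \<le> (vnorm A (X (n + j)) + vnorm A (X n)) / 2 * vnorm A (X (n + j) \<ominus> X n)"
      using step[OF X_in[of "n + j"] X_in[of n]] by (simp add: X_Suc)
    also have "\<dots> \<le> s * (s ^ n * s)"
      using X_norm[of "n + j"] X_norm[of n] Suc s X_in norm_nonneg by (intro mult_mono) auto
    finally show ?case
      by (simp add: mult_ac)
  qed
  have "\<exists>x\<in>carrier A. (\<lambda>n. vnorm A (X n \<ominus> x)) \<longlonglongrightarrow> 0"
  proof (rule complete)
    fix \<epsilon> :: real assume "0 < \<epsilon>"
    then obtain N where N: "s ^ N < \<epsilon> / 2"
      using s real_arch_pow_inv[of "\<epsilon> / 2" s] by auto
    have half: "vnorm A (X m \<ominus> X N) < \<epsilon> / 2" if "m \<ge> N" for m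
      using diff[of N "m - N"] that s N mult_left_le[of s "s ^ N"] by simp
    have "vnorm A (X m \<ominus> X n) < \<epsilon>" if "m \<ge> N" "n \<ge> N" for m n
      using half[OF that(1)] half[OF that(2)] norm_minus_triangle[OF X_in[of m] X_in[of N] X_in[of n]] norm_minus_swap[OF X_in[of n] X_in[of N]]
      by linarith
    then show "\<exists>N. \<forall>m\<ge>N. \<forall>n\<ge>N. vnorm A (X m \<ominus> X n) < \<epsilon>"
      by blast
  qed (rule X_in)
  then obtain g where g: "g \<in> carrier A" "converges A X g"
    unfolding converges_def by blast
  have "star A g = g"
    using converges_unique[OF X_in _ _ g, of "star A g"] star_converges[OF X_in g] g(1) by (simp add: X_star)
  moreover have "h \<otimes> g = g \<otimes> h"
    using closed_subspace_converges[OF self.closed_subspace_equaliser[OF bounded_linear_mult_left[OF h(1)]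
      bounded_linear_mult_right[OF h(1)]], of X g] X_in X_comm g by simp
  moreover have "g = F g"
  proof (rule converges_unique[of "\<lambda>n. X (Suc n)"])
    show "converges A (\<lambda>n. X (Suc n)) g"
      using g(2) unfolding converges_def by (rule LIMSEQ_Suc)
    \<comment> \<open>Only continuity of F at g is wanted here, so the factor may exceed 1 and the
      norm of g is left as it is.\<close>
    have bound: "vnorm A (F (X n) \<ominus> F g) \<le> (s + vnorm A g) / 2 * vnorm A (X n \<ominus> g)" for n
    proof -
      have "vnorm A (F (X n) \<ominus> F g) \<le> (vnorm A (X n) + vnorm A g) / 2 * vnorm A (X n \<ominus> g)"
        by (rule step[OF X_in g(1)])
      also have "\<dots> \<le> (s + vnorm A g) / 2 * vnorm A (X n \<ominus> g)"
        using X_norm[of n] norm_nonneg[of "X n \<ominus> g"] X_in[of n] g(1) by (intro mult_right_mono) auto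
      finally show ?thesis .
    qed
    have lim: "(\<lambda>n. (s + vnorm A g) / 2 * vnorm A (X n \<ominus> g)) \<longlonglongrightarrow> 0"
      using g(2) unfolding converges_def by (rule tendsto_mult_right_zero)
    have "0 \<le> vnorm A (F (X n) \<ominus> F g)" for n
      using F_in X_in g(1) by (intro norm_nonneg) simp
    from null_comparison[OF lim this bound] have "(\<lambda>n. vnorm A (F (X n) \<ominus> F g)) \<longlonglongrightarrow> 0" .
    then show "converges A (\<lambda>n. X (Suc n)) (F g)"
      by (simp add: converges_def X_Suc)
  qed (use X_in F_in g(1) in auto)
  then have "2 \<odot> g = 2 \<odot> F g"
    by simp
  then have "g \<oplus> g = h \<otimes> h \<oplus> g \<otimes> g"
    using add_smult[of g 1 1] smult_smult[of "h \<otimes> h \<oplus> g \<otimes> g" 2 "1/2"] g(1) h(1) by (simp add: F_def)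
  ultimately show ?thesis
    using g(1) by blast
qed

text \<open>With c = e - g and w = h + ic, the cross terms of w* w cancel because h and c commute,
  and h^2 + c^2 = e by the equation for g. The imaginary parts cancel in w + w*.\<close>

lemma self_adjoint_is_real_part_of_isometry:
  assumes e: "is_identity A e" and h: "h \<in> carrier A" "star A h = h" "vnorm A h < 1"
  shows "\<exists>w\<in>carrier A. star A w \<otimes> w = e \<and> w \<oplus> star A w = 2 \<odot> h"
proof -
  obtain g where g: "g \<in> carrier A" "star A g = g" "h \<otimes> g = g \<otimes> h" "g \<oplus> g = h \<otimes> h \<oplus> g \<otimes> g"
    using self_adjoint_sqrt_exists[OF h] by blast
  have e_in: "e \<in> carrier A" and e_mult: "\<And>x. x \<in> carrier A \<Longrightarrow> e \<otimes> x = x" "\<And>x. x \<in> carrier A \<Longrightarrow> x \<otimes> e = x"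
    using e unfolding is_identity_def by auto
  have "star A e = e"
    using e_mult[of "star A e"] star_mult[of "star A e" e] e_in e_mult by simp
  define c where "c = e \<ominus> g"
  define w where "w = h \<oplus> \<i> \<odot> c"
  have c: "c \<in> carrier A" "star A c = c" "h \<otimes> c = c \<otimes> h"
    using e_in g e_mult h(1) \<open>star A e = e\<close> by (simp_all add: c_def star_minus mult_minus_left mult_minus_right)
  have w_star: "star A w = h \<oplus> (- \<i>) \<odot> c"
    using h c by (simp add: w_def star_add star_smult)
  have "c \<otimes> c = (e \<ominus> g) \<ominus> (g \<ominus> g \<otimes> g)"
    using e_in g e_mult by (simp add: c_def mult_minus_left mult_minus_right)
  also have "\<dots> = (e \<oplus> g \<otimes> g) \<ominus> (g \<oplus> g)"
    using e_in g(1) by (simp add: minus_smult smult_add smult_smult mod.M.a_ac)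
  finally have "h \<otimes> h \<oplus> c \<otimes> c = h \<otimes> h \<oplus> ((e \<oplus> g \<otimes> g) \<ominus> (h \<otimes> h \<oplus> g \<otimes> g))"
    by (simp add: g(4))
  also have "\<dots> = e \<oplus> ((h \<otimes> h \<oplus> g \<otimes> g) \<ominus> (h \<otimes> h \<oplus> g \<otimes> g))"
    using e_in g(1) h(1) by (simp add: mod.M.minus_eq mod.M.a_ac del: minus_self)
  finally have cc: "h \<otimes> h \<oplus> c \<otimes> c = e"
    using e_in g(1) h(1) by simp
  have "\<i> \<odot> (h \<otimes> c) \<oplus> (- \<i>) \<odot> (h \<otimes> c) = \<zero>"
    using add_smult[of "h \<otimes> c" \<i> "- \<i>"] h(1) c(1) by simp
  then have "\<i> \<odot> (h \<otimes> c) \<oplus> ((- \<i>) \<odot> (h \<otimes> c) \<oplus> c \<otimes> c) = c \<otimes> c"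
    using mod.M.a_assoc[of "\<i> \<odot> (h \<otimes> c)" "(- \<i>) \<odot> (h \<otimes> c)" "c \<otimes> c"] h(1) c(1) by simp
  moreover have "star A w \<otimes> w = h \<otimes> h \<oplus> (\<i> \<odot> (h \<otimes> c) \<oplus> ((- \<i>) \<odot> (h \<otimes> c) \<oplus> c \<otimes> c))"
    unfolding w_star unfolding w_def
    using h(1) c by (simp add: distrib_left distrib_right smult_mult mult_smult smult_smult smult_add mod.M.a_ac)
  ultimately have "star A w \<otimes> w = e"
    using cc by simp
  moreover have "w \<oplus> star A w = 2 \<odot> h"
  proof -
    have "\<i> \<odot> c \<oplus> (- \<i>) \<odot> c = \<zero>"
      using add_smult[of c \<i> "- \<i>"] c(1) by simp
    moreover have "w \<oplus> star A w = (h \<oplus> h) \<oplus> (\<i> \<odot> c \<oplus> (- \<i>) \<odot> c)"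
      unfolding w_star unfolding w_def using h(1) c(1) by (simp add: mod.M.a_ac)
    ultimately show ?thesis
      using h(1) add_smult[of h 1 1] by simp
  qed
  moreover have "w \<in> carrier A"
    using h(1) c(1) by (simp add: w_def)
  ultimately show ?thesis
    by blast
qed

end

section \<open>Contractivity of *-homomorphisms\<close>

locale cstar_hom = A: cstar_algebra A + B: cstar_algebra B
  for A :: "('a, 'y) cstar_scheme" and B :: "('b, 'z) cstar_scheme" +
  fixes f :: "'a \<Rightarrow> 'b"
  assumes star_hom: "star_hom A B f"
begin

sublocale banach_pair A B ..

lemma linear: "linear_on A B f"
  and hom_mult: "x \<in> carrier A \<Longrightarrow> y \<in> carrier A \<Longrightarrow> f (x \<otimes>\<^bsub>A\<^esub> y) = f x \<otimes>\<^bsub>B\<^esub> f y"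
  and hom_star: "x \<in> carrier A \<Longrightarrow> f (star A x) = star B (f x)"
  using star_hom by (auto simp: star_hom_def)

lemmas hom_closed [simp, intro] = linear_closed[OF linear]
  and hom_add = linear_add[OF linear]
  and hom_smult = linear_smult[OF linear]
  and hom_zero [simp] = linear_zero[OF linear]

text \<open>2 f(h) = f(w) + f(w)*, and the squared norm of f(w) is the norm of f(e), which is at
  most 1 because f(e) is a projection; f(e) need not be a unit of B.\<close>

lemma norm_hom_le_1:
  assumes e: "is_identity A e" and h: "h \<in> carrier A" "star A h = h" "vnorm A h < 1"
  shows "vnorm B (f h) \<le> 1"
proof -
  obtain w where w: "w \<in> carrier A" "star A w \<otimes>\<^bsub>A\<^esub> w = e" "w \<oplus>\<^bsub>A\<^esub> star A w = 2 \<odot>\<^bsub>A\<^esub> h"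
    using A.self_adjoint_is_real_part_of_isometry[OF e h] by blast
  have e_in: "e \<in> carrier A" and e_idem: "e \<otimes>\<^bsub>A\<^esub> e = e" and "star A e \<otimes>\<^bsub>A\<^esub> e = star A e"
    using e unfolding is_identity_def by (auto intro: A.star_in)
  then have "star A e = e"
    using A.star_mult[of "star A e" e] by simp
  have "(vnorm B (f e))\<^sup>2 = vnorm B (f e)"
    using B.cstar_identity[of "f e"] hom_star[OF e_in] hom_mult[OF e_in e_in] e_in e_idem \<open>star A e = e\<close> by simp
  then have "vnorm B (f e) \<le> 1"
    by (auto simp: power2_eq_square)
  moreover have "(vnorm B (f w))\<^sup>2 = vnorm B (f e)"
    using B.cstar_identity[of "f w"] hom_star[OF w(1)] hom_mult[of "star A w" w] w by simp
  ultimately have fw: "vnorm B (f w) \<le> 1"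
    using power_le_one_iff[of "vnorm B (f w)" 2] B.norm_nonneg[of "f w"] w(1) by simp
  have "2 * vnorm B (f h) = vnorm B (f w \<oplus>\<^bsub>B\<^esub> star B (f w))"
    using hom_add[of w "star A w"] hom_smult[of h 2] hom_star[OF w(1)] B.norm_smult[of "f h" 2] w h by simp
  also have "\<dots> \<le> 2"
    using B.norm_triangle[of "f w" "star B (f w)"] B.norm_star[of "f w"] w(1) fw by simp
  finally show ?thesis
    by simp
qed

text \<open>A self-adjoint h is scaled by 1/r for every r above its norm, and r is then lowered to
  the norm. The general case follows from the C*-identity for a* a.\<close>

lemma norm_hom_le:
  assumes e: "is_identity A e" and a: "a \<in> carrier A"
  shows "vnorm B (f a) \<le> vnorm A a"
proof -
  have bound: "vnorm B (f h) \<le> r" if h: "h \<in> carrier A" "star A h = h" "vnorm A h < r" for h r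
  proof -
    have r: "0 < r"
      using h A.norm_nonneg[of h] by simp
    then have "vnorm B (f (complex_of_real (1 / r) \<odot>\<^bsub>A\<^esub> h)) \<le> 1"
      using h by (intro norm_hom_le_1[OF e]) (simp_all add: A.star_smult A.norm_smult norm_divide)
    then show ?thesis
      using h r by (simp add: hom_smult B.norm_smult norm_divide divide_simps)
  qed
  have "vnorm B (f h) \<le> vnorm A h" if "h \<in> carrier A" "star A h = h" for h
    using bound[OF that] by (rule dense_ge)
  from this[of "star A a \<otimes>\<^bsub>A\<^esub> a"] have "(vnorm B (f a))\<^sup>2 \<le> (vnorm A a)\<^sup>2"
    using a A.cstar_identity[of a] B.cstar_identity[of "f a"] hom_mult[of "star A a" a]
    by (simp add: A.star_mult hom_star)
  then show ?thesis
    using A.norm_nonneg[OF a] by (rule power2_le_imp_le)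
qed

lemma bounded_linear_hom: "is_identity A e \<Longrightarrow> bounded_linear_on A B f"
  unfolding bounded_linear_on_def using linear norm_hom_le by (auto intro!: exI[of _ 1])

text \<open>Contractivity of f gives closedness of the preimage. To see that f maps A into C it then
  suffices to look at generators of A.\<close>

lemma cstar_subalgebra_vimage:
  assumes "is_identity A e" "cstar_subalgebra B C"
  shows "cstar_subalgebra A {a \<in> carrier A. f a \<in> C}"
  using closed_subspace_vimage[OF bounded_linear_hom[OF assms(1)], of C] assms(2)
  unfolding cstar_subalgebra_def by (simp add: hom_mult hom_star)

end


section \<open>Hilbert modules\<close>

context hilbert_module
begin

sublocale EA: banach_pair E A ..

sublocale EE: banach_pair E E ..

declare ract_closed [simp, intro] ip_closed [simp, intro]

lemma ip_linear: "y \<in> carrier E \<Longrightarrow> linear_on E A (inner_prod E y)"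
  unfolding linear_on_def by (simp add: ip_add ip_smult)

lemma ip_add_left: "x \<in> carrier E \<Longrightarrow> y \<in> carrier E \<Longrightarrow> z \<in> carrier E
    \<Longrightarrow> inner_prod E (x \<oplus>\<^bsub>E\<^esub> y) z = inner_prod E x z \<oplus>\<^bsub>A\<^esub> inner_prod E y z"
  using ip_star[of z "x \<oplus>\<^bsub>E\<^esub> y"] ip_star[of z x] ip_star[of z y] by (simp add: ip_add A.star_add)

lemma ip_smult_left: "x \<in> carrier E \<Longrightarrow> y \<in> carrier E
    \<Longrightarrow> inner_prod E (c \<odot>\<^bsub>E\<^esub> x) y = cnj c \<odot>\<^bsub>A\<^esub> inner_prod E x y"
  using ip_star[of y "c \<odot>\<^bsub>E\<^esub> x"] ip_star[of y x] by (simp add: ip_smult A.star_smult)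

lemma ip_ract_left: "x \<in> carrier E \<Longrightarrow> y \<in> carrier E \<Longrightarrow> a \<in> carrier A
    \<Longrightarrow> inner_prod E (ract E x a) y = star A a \<otimes>\<^bsub>A\<^esub> inner_prod E x y"
  using ip_star[of y "ract E x a"] ip_star[of y x] by (simp add: ip_ract A.star_mult)

lemma ip_zero [simp]: "y \<in> carrier E \<Longrightarrow> inner_prod E y \<zero>\<^bsub>E\<^esub> = \<zero>\<^bsub>A\<^esub>"
  by (rule EA.linear_zero[OF ip_linear])

lemma ract_linear: "a \<in> carrier A \<Longrightarrow> linear_on E E (\<lambda>x. ract E x a)"
  unfolding linear_on_def by (simp add: ract_add_left ract_smult_left)

lemma norm_ip_square: "x \<in> carrier E \<Longrightarrow> vnorm A (inner_prod E x x) = (vnorm E x)\<^sup>2"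
  using A.norm_nonneg[of "inner_prod E x x"] by (simp add: norm_ip)

lemma ip_eq_zero_iff: "x \<in> carrier E \<Longrightarrow> inner_prod E x x = \<zero>\<^bsub>A\<^esub> \<longleftrightarrow> x = \<zero>\<^bsub>E\<^esub>"
  using norm_ip_square[of x] A.norm_eq_0[of "inner_prod E x x"] E.norm_eq_0[of x] by auto

lemma ip_eqI:
  assumes "x \<in> carrier E" "y \<in> carrier E"
    and "\<And>z. z \<in> carrier E \<Longrightarrow> inner_prod E z x = inner_prod E z y"
  shows "x = y"
  using assms ip_eq_zero_iff[of "x \<ominus>\<^bsub>E\<^esub> y"] EA.linear_minus[OF ip_linear, of "x \<ominus>\<^bsub>E\<^esub> y" x y]
    E.minus_eq_zero_iff[of x y] by simp

text \<open>Polarisation replaces the Cauchy--Schwarz inequality, at the cost of a constant.\<close>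

lemma norm_ip_symm_le:
  assumes x: "x \<in> carrier E" "vnorm E x \<le> 1" and y: "y \<in> carrier E" "vnorm E y \<le> 1"
  shows "vnorm A (inner_prod E x y \<oplus>\<^bsub>A\<^esub> inner_prod E y x) \<le> 6"
proof -
  let ?S = "inner_prod E x y \<oplus>\<^bsub>A\<^esub> inner_prod E y x"
  let ?T = "inner_prod E x x \<oplus>\<^bsub>A\<^esub> inner_prod E y y"
  have sq: "(vnorm E z)\<^sup>2 \<le> c\<^sup>2" if "vnorm E z \<le> c" "z \<in> carrier E" for z c
    using that E.norm_nonneg by (intro power_mono) auto
  have "vnorm E (x \<oplus>\<^bsub>E\<^esub> y) \<le> 2"
    using E.norm_triangle[of x y] x y by simp
  then have xy: "vnorm A (inner_prod E (x \<oplus>\<^bsub>E\<^esub> y) (x \<oplus>\<^bsub>E\<^esub> y)) \<le> 4"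
    using x y sq[of "x \<oplus>\<^bsub>E\<^esub> y" 2] by (simp add: norm_ip_square)
  have T: "vnorm A ?T \<le> 2"
    using A.norm_triangle[of "inner_prod E x x" "inner_prod E y y"] x y sq[of x 1] sq[of y 1]
    by (simp add: norm_ip_square)
  have "inner_prod E (x \<oplus>\<^bsub>E\<^esub> y) (x \<oplus>\<^bsub>E\<^esub> y) = ?S \<oplus>\<^bsub>A\<^esub> ?T"
    using x y by (simp add: ip_add ip_add_left A.mod.M.a_ac)
  moreover have "?S = (?S \<oplus>\<^bsub>A\<^esub> ?T) \<ominus>\<^bsub>A\<^esub> ?T"
    using x y by (simp add: A.mod.M.minus_eq A.mod.M.a_assoc A.mod.M.r_neg del: A.mod.M.minus_add)
  \<comment> \<open>The two summands are at most 4 and 2, which is where 6 comes from.\<close>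
  ultimately have "vnorm A ?S \<le> vnorm A (inner_prod E (x \<oplus>\<^bsub>E\<^esub> y) (x \<oplus>\<^bsub>E\<^esub> y)) + vnorm A ?T"
    using A.norm_minus_le[of "?S \<oplus>\<^bsub>A\<^esub> ?T" ?T] x y by simp
  then show ?thesis
    using xy T by simp
qed

text \<open>For p = \<langle>x, y\<rangle> and q = \<langle>y, x\<rangle>, replacing y by iy in the
  symmetric estimate bounds ip - iq by 6 as well, and 2q = (p + q) + i(ip - iq).\<close>

lemma norm_ip_le_6:
  assumes x: "x \<in> carrier E" "vnorm E x \<le> 1" and y: "y \<in> carrier E" "vnorm E y \<le> 1"
  shows "vnorm A (inner_prod E y x) \<le> 6"
proof -
  let ?p = "inner_prod E x y" and ?q = "inner_prod E y x"
  have P: "vnorm A (?p \<oplus>\<^bsub>A\<^esub> ?q) \<le> 6"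
    by (rule norm_ip_symm_le[OF x y])
  have Q: "vnorm A (\<i> \<odot>\<^bsub>A\<^esub> ?p \<oplus>\<^bsub>A\<^esub> (- \<i>) \<odot>\<^bsub>A\<^esub> ?q) \<le> 6"
    using norm_ip_symm_le[OF x, of "\<i> \<odot>\<^bsub>E\<^esub> y"] x y by (simp add: ip_smult ip_smult_left E.norm_smult)
  have "?p \<oplus>\<^bsub>A\<^esub> (-1) \<odot>\<^bsub>A\<^esub> ?p = \<zero>\<^bsub>A\<^esub>" "?q \<oplus>\<^bsub>A\<^esub> ?q = 2 \<odot>\<^bsub>A\<^esub> ?q"
    using x y A.add_smult[of ?p 1 "-1"] A.add_smult[of ?q 1 1] by simp_all
  moreover have "(?p \<oplus>\<^bsub>A\<^esub> ?q) \<oplus>\<^bsub>A\<^esub> \<i> \<odot>\<^bsub>A\<^esub> (\<i> \<odot>\<^bsub>A\<^esub> ?p \<oplus>\<^bsub>A\<^esub> (- \<i>) \<odot>\<^bsub>A\<^esub> ?q)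
      = (?p \<oplus>\<^bsub>A\<^esub> (-1) \<odot>\<^bsub>A\<^esub> ?p) \<oplus>\<^bsub>A\<^esub> (?q \<oplus>\<^bsub>A\<^esub> ?q)"
    using x y by (simp add: A.smult_add A.smult_smult A.mod.M.a_ac)
  ultimately have "2 \<odot>\<^bsub>A\<^esub> ?q = (?p \<oplus>\<^bsub>A\<^esub> ?q) \<oplus>\<^bsub>A\<^esub> \<i> \<odot>\<^bsub>A\<^esub> (\<i> \<odot>\<^bsub>A\<^esub> ?p \<oplus>\<^bsub>A\<^esub> (- \<i>) \<odot>\<^bsub>A\<^esub> ?q)"
    using x y by simp
  then have "vnorm A (2 \<odot>\<^bsub>A\<^esub> ?q) \<le> vnorm A (?p \<oplus>\<^bsub>A\<^esub> ?q) +
      vnorm A (\<i> \<odot>\<^bsub>A\<^esub> (\<i> \<odot>\<^bsub>A\<^esub> ?p \<oplus>\<^bsub>A\<^esub> (- \<i>) \<odot>\<^bsub>A\<^esub> ?q))"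
    using x y A.norm_triangle by simp
  then show ?thesis
    using P Q x y by (simp add: A.norm_smult)
qed

lemma norm_ip_le:
  assumes x: "x \<in> carrier E" and y: "y \<in> carrier E"
  shows "vnorm A (inner_prod E y x) \<le> 6 * vnorm E y * vnorm E x"
proof (cases "x = \<zero>\<^bsub>E\<^esub> \<or> y = \<zero>\<^bsub>E\<^esub>")
  case True
  then show ?thesis
    using x y ip_star[of x "\<zero>\<^bsub>E\<^esub>", symmetric] by auto
next
  case False
  then have pos: "vnorm E x > 0" "vnorm E y > 0"
    using x y E.norm_nonneg E.norm_eq_0 less_eq_real_def by metis+
  let ?n = "\<lambda>z. complex_of_real (1 / vnorm E z) \<odot>\<^bsub>E\<^esub> z"
  have "vnorm A (inner_prod E (?n y) (?n x)) \<le> 6"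
    using x y pos by (intro norm_ip_le_6) (simp_all add: E.norm_smult norm_divide)
  then show ?thesis
    using x y pos by (simp add: ip_smult ip_smult_left A.norm_smult norm_divide divide_simps mult_ac)
qed

lemma bounded_linear_ip: "y \<in> carrier E \<Longrightarrow> bounded_linear_on E A (inner_prod E y)"
  unfolding bounded_linear_on_def using ip_linear norm_ip_le by blast

section \<open>Adjointable operators\<close>

lemma adjoint_pair_swap: "adjoint_pair E S R \<Longrightarrow> adjoint_pair E R S"
  unfolding adjoint_pair_def by (metis PiE_mem ip_star)

lemma adjoint_pair_closed: "adjoint_pair E S R \<Longrightarrow> x \<in> carrier E \<Longrightarrow> S x \<in> carrier E"
  unfolding adjoint_pair_def by auto

lemma adjoint_pair_ip: "adjoint_pair E S R \<Longrightarrow> x \<in> carrier E \<Longrightarrow> y \<in> carrier E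
    \<Longrightarrow> inner_prod E y (S x) = inner_prod E (R y) x"
  using adjoint_pair_swap[of S R] unfolding adjoint_pair_def by metis

text \<open>Adjoints turn \<open>S z = T z\<close> into equations between bounded maps, so boundedness of \<open>S\<close> and \<open>T\<close>
  is not an issue.\<close>

lemma closed_subspace_adjoint_equaliser:
  assumes S: "adjoint_pair E S S'" and T: "adjoint_pair E T T'"
  shows "closed_subspace E {z \<in> carrier E. S z = T z}"
proof -
  let ?C = "\<lambda>y. {z \<in> carrier E. inner_prod E (S' y) z = inner_prod E (T' y) z}"
  have "closed_subspace E (?C y)" if "y \<in> carrier E" for y
    using that adjoint_pair_closed[OF adjoint_pair_swap[OF S]] adjoint_pair_closed[OF adjoint_pair_swap[OF T]]
    by (intro EA.closed_subspace_equaliser bounded_linear_ip)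
  then have "closed_subspace E (\<Inter>(?C ` carrier E))"
    by (intro closed_subspace_Inter) auto
  moreover have "\<Inter>(?C ` carrier E) = {z \<in> carrier E. S z = T z}"
  proof (rule Set.equalityI; rule subsetI)
    fix z assume z: "z \<in> \<Inter>(?C ` carrier E)"
    then have "z \<in> carrier E"
      using E.mod.M.zero_closed by blast
    moreover from this have "S z = T z"
      using z adjoint_pair_closed[OF S] adjoint_pair_closed[OF T]
      by (intro ip_eqI) (auto simp: adjoint_pair_ip[OF S] adjoint_pair_ip[OF T])
    ultimately show "z \<in> {z \<in> carrier E. S z = T z}"
      by simp
  next
    fix z assume "z \<in> {z \<in> carrier E. S z = T z}"
    then show "z \<in> \<Inter>(?C ` carrier E)"
      by (auto simp: adjoint_pair_ip[OF S, symmetric] adjoint_pair_ip[OF T, symmetric])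
  qed
  ultimately show ?thesis
    by simp
qed

lemma adjoint_pair_id: "adjoint_pair E (\<lambda>x\<in>carrier E. x) (\<lambda>x\<in>carrier E. x)"
  by (auto simp: adjoint_pair_def)

end

text \<open>The operator given by the sum of the \<open>Theta E (x j) (x j)\<close>; for orthogonal
  x_j with x_j\<langle>x_j, x_j\<rangle> = x_j it is the projection onto the submodule that they
  generate. The sum is taken pointwise in E, so that only the additive structure of E
  enters.\<close>

definition frame_sum :: "('a, 'm, 'z) hmod_scheme \<Rightarrow> ('i \<Rightarrow> 'm) \<Rightarrow> 'i set \<Rightarrow> 'm \<Rightarrow> 'm" where
  "frame_sum E x S = (\<lambda>z\<in>carrier E. \<Oplus>\<^bsub>E\<^esub>j\<in>S. ract E (x j) (inner_prod E (x j) z))"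

section \<open>Compact operators and frame sums\<close>

lemma adjointables_simps:
  "carrier (adjointables E) = {S. \<exists>R. adjoint_pair E S R}"
  "S \<otimes>\<^bsub>adjointables E\<^esub> T = compose (carrier E) S T"
  "\<zero>\<^bsub>adjointables E\<^esub> = (\<lambda>x\<in>carrier E. \<zero>\<^bsub>E\<^esub>)"
  "S \<oplus>\<^bsub>adjointables E\<^esub> T = (\<lambda>x\<in>carrier E. S x \<oplus>\<^bsub>E\<^esub> T x)"
  "c \<odot>\<^bsub>adjointables E\<^esub> S = (\<lambda>x\<in>carrier E. c \<odot>\<^bsub>E\<^esub> S x)"
  by (simp_all add: adjointables_def)

lemma compacts_simps:
  "carrier (compacts E) =
    closed_span (adjointables E) {Theta E x y |x y. x \<in> carrier E \<and> y \<in> carrier E}"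
  "\<zero>\<^bsub>compacts E\<^esub> = (\<lambda>x\<in>carrier E. \<zero>\<^bsub>E\<^esub>)"
  "S \<oplus>\<^bsub>compacts E\<^esub> T = (\<lambda>x\<in>carrier E. S x \<oplus>\<^bsub>E\<^esub> T x)"
  "c \<odot>\<^bsub>compacts E\<^esub> S = (\<lambda>x\<in>carrier E. c \<odot>\<^bsub>E\<^esub> S x)"
  by (simp_all add: compacts_def adjointables_def)

lemma zero_in_compacts: "\<zero>\<^bsub>compacts E\<^esub> \<in> carrier (compacts E)"
  unfolding compacts_simps adjointables_simps[symmetric] closed_span_def closed_subspace_def by blast

lemma add_in_compacts:
  "S \<in> carrier (compacts E) \<Longrightarrow> T \<in> carrier (compacts E) \<Longrightarrow> S \<oplus>\<^bsub>compacts E\<^esub> T \<in> carrier (compacts E)"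
  unfolding compacts_simps adjointables_simps[symmetric] closed_span_def closed_subspace_def by blast

lemma Theta_in_compacts:
  "x \<in> carrier E \<Longrightarrow> y \<in> carrier E \<Longrightarrow> Theta E x y \<in> carrier (compacts E)"
  unfolding compacts_simps closed_span_def by blast

context hilbert_module
begin

lemma adjoint_pair_Theta:
  "x \<in> carrier E \<Longrightarrow> y \<in> carrier E \<Longrightarrow> adjoint_pair E (Theta E x y) (Theta E y x)"
  unfolding adjoint_pair_def Theta_def
  by (auto simp: ip_ract ip_ract_left ip_star)

lemma adjoint_pair_add:
  "adjoint_pair E S R \<Longrightarrow> adjoint_pair E T Q \<Longrightarrow>
    adjoint_pair E (\<lambda>x\<in>carrier E. S x \<oplus>\<^bsub>E\<^esub> T x) (\<lambda>x\<in>carrier E. R x \<oplus>\<^bsub>E\<^esub> Q x)"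
  unfolding adjoint_pair_def by (auto simp: ip_add ip_add_left Pi_iff PiE_iff)

lemma ip_zero_left [simp]: "y \<in> carrier E \<Longrightarrow> inner_prod E \<zero>\<^bsub>E\<^esub> y = \<zero>\<^bsub>A\<^esub>"
  using ip_star[of y "\<zero>\<^bsub>E\<^esub>"] by simp

lemma adjoint_pair_zero: "adjoint_pair E (\<lambda>x\<in>carrier E. \<zero>\<^bsub>E\<^esub>) (\<lambda>x\<in>carrier E. \<zero>\<^bsub>E\<^esub>)"
  unfolding adjoint_pair_def by auto

lemma frame_sum_empty: "frame_sum E x {} = (\<lambda>z\<in>carrier E. \<zero>\<^bsub>E\<^esub>)"
  by (simp add: frame_sum_def)

text \<open>Splitting off one \<open>Theta\<close> turns statements on frame sums into inductions
  over S with binary operator sums.\<close>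

lemma frame_sum_insert:
  assumes "finite S" "j \<notin> S" "x \<in> insert j S \<rightarrow> carrier E"
  shows "frame_sum E x (insert j S) = (\<lambda>z\<in>carrier E. Theta E (x j) (x j) z \<oplus>\<^bsub>E\<^esub> frame_sum E x S z)"
  unfolding frame_sum_def Theta_def
proof (rule restrict_ext)
  fix z assume z: "z \<in> carrier E"
  have "(\<lambda>k. ract E (x k) (inner_prod E (x k) z)) \<in> insert j S \<rightarrow> carrier E"
    using assms(3) z by auto
  then show "(\<Oplus>\<^bsub>E\<^esub>k\<in>insert j S. ract E (x k) (inner_prod E (x k) z)) =
      (\<lambda>z\<in>carrier E. ract E (x j) (inner_prod E (x j) z)) z \<oplus>\<^bsub>E\<^esub>
      (\<lambda>z\<in>carrier E. \<Oplus>\<^bsub>E\<^esub>k\<in>S. ract E (x k) (inner_prod E (x k) z)) z"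
    using assms z by simp
qed

lemma adjoint_pair_frame_sum:
  "finite S \<Longrightarrow> x \<in> S \<rightarrow> carrier E \<Longrightarrow> adjoint_pair E (frame_sum E x S) (frame_sum E x S)"
proof (induction S rule: finite_induct)
  case empty
  then show ?case
    unfolding frame_sum_empty by (intro adjoint_pair_zero)
next
  case (insert j S)
  then have "x j \<in> carrier E" "adjoint_pair E (frame_sum E x S) (frame_sum E x S)"
    by auto
  then show ?case
    unfolding frame_sum_insert[OF insert.hyps insert.prems]
    using adjoint_pair_add[OF adjoint_pair_Theta] by blast
qed

lemma frame_sum_in_compacts:
  "finite S \<Longrightarrow> x \<in> S \<rightarrow> carrier E \<Longrightarrow> frame_sum E x S \<in> carrier (compacts E)"
proof (induction S rule: finite_induct)
  case empty
  show ?case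
    using zero_in_compacts[of E] unfolding frame_sum_empty compacts_simps(2) .
next
  case (insert j S)
  then have "Theta E (x j) (x j) \<oplus>\<^bsub>compacts E\<^esub> frame_sum E x S \<in> carrier (compacts E)"
    by (intro add_in_compacts Theta_in_compacts) auto
  then show ?case
    unfolding frame_sum_insert[OF insert.hyps insert.prems] compacts_simps(3) .
qed

text \<open>Linearity of \<Psi> speaks of two summands at a time, while the frame sum is a pointwise
  sum in E; induction over S mediates between the two.\<close>

lemma linear_frame_sum:
  assumes B: "complex_banach B" and \<Psi>: "linear_on (compacts E) B \<Psi>"
    and "finite S" "x \<in> S \<rightarrow> carrier E"
  shows "\<Psi> (frame_sum E x S) = (\<Oplus>\<^bsub>B\<^esub>j\<in>S. \<Psi> (Theta E (x j) (x j)))"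
  using assms(3,4)
proof (induction S rule: finite_induct)
  interpret B: complex_banach B by (rule B)
  case empty
  \<comment> \<open>\<Psi> sends the zero operator to zero because it commutes with scaling by
    0.\<close>
  have "\<Psi> (0 \<odot>\<^bsub>compacts E\<^esub> \<zero>\<^bsub>compacts E\<^esub>) = 0 \<odot>\<^bsub>B\<^esub> \<Psi> \<zero>\<^bsub>compacts E\<^esub>" "\<Psi> \<zero>\<^bsub>compacts E\<^esub> \<in> carrier B"
    using \<Psi> zero_in_compacts[of E] unfolding linear_on_def by blast+
  moreover have "0 \<odot>\<^bsub>compacts E\<^esub> \<zero>\<^bsub>compacts E\<^esub> = frame_sum E x {}"
    by (auto simp: frame_sum_empty compacts_simps)
  ultimately show ?case
    by simp
next
  interpret B: complex_banach B by (rule B)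
  case (insert j S)
  have T: "Theta E (x k) (x k) \<in> carrier (compacts E)" if "k \<in> insert j S" for k
    using funcset_mem[OF insert.prems that] by (intro Theta_in_compacts)
  have \<Psi>_in: "\<Psi> R \<in> carrier B" if "R \<in> carrier (compacts E)" for R
    using \<Psi> that unfolding linear_on_def by (auto dest: funcset_mem)
  have x_S: "x \<in> S \<rightarrow> carrier E"
    using insert.prems by auto
  have "\<Psi> (Theta E (x j) (x j) \<oplus>\<^bsub>compacts E\<^esub> frame_sum E x S)
      = \<Psi> (Theta E (x j) (x j)) \<oplus>\<^bsub>B\<^esub> \<Psi> (frame_sum E x S)"
    using \<Psi> T[of j] frame_sum_in_compacts[OF insert.hyps(1) x_S] unfolding linear_on_def by blast
  then have "\<Psi> (frame_sum E x (insert j S)) = \<Psi> (Theta E (x j) (x j)) \<oplus>\<^bsub>B\<^esub> \<Psi> (frame_sum E x S)"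
    unfolding frame_sum_insert[OF insert.hyps insert.prems] compacts_simps(3) .
  moreover have "(\<Oplus>\<^bsub>B\<^esub>k\<in>insert j S. \<Psi> (Theta E (x k) (x k)))
      = \<Psi> (Theta E (x j) (x j)) \<oplus>\<^bsub>B\<^esub> (\<Oplus>\<^bsub>B\<^esub>k\<in>S. \<Psi> (Theta E (x k) (x k)))"
    using insert.hyps T \<Psi>_in by (intro B.mod.M.finsum_insert) auto
  ultimately show ?case
    using insert.IH[OF x_S] by simp
qed

lemma ip_frame_sum:
  assumes S: "finite S" "x \<in> S \<rightarrow> carrier E" and z: "z \<in> carrier E" and y: "y \<in> carrier E"
  shows "inner_prod E y (frame_sum E x S z) =
    (\<Oplus>\<^bsub>A\<^esub>j\<in>S. inner_prod E y (x j) \<otimes>\<^bsub>A\<^esub> inner_prod E (x j) z)"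
proof -
  have "inner_prod E y (frame_sum E x S z) =
      (\<Oplus>\<^bsub>A\<^esub>j\<in>S. inner_prod E y (ract E (x j) (inner_prod E (x j) z)))"
    using EA.linear_finsum[OF ip_linear[OF y] S(1), of "\<lambda>j. ract E (x j) (inner_prod E (x j) z)"] S(2) z
    by (auto simp: frame_sum_def Pi_iff)
  also have "\<dots> = (\<Oplus>\<^bsub>A\<^esub>j\<in>S. inner_prod E y (x j) \<otimes>\<^bsub>A\<^esub> inner_prod E (x j) z)"
    using S z y by (intro A.mod.M.finsum_cong') (auto simp: ip_ract Pi_iff)
  finally show ?thesis .
qed

text \<open>In \<langle>x_j, F_T z\<rangle> only the term k = j survives, and its factor
  \<langle>x_j, x_j\<rangle> is absorbed by x_j, so the outer sum keeps exactly the j in T. Products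
  of range projections are computed by this rule.\<close>

lemma frame_sum_compose:
  assumes S: "finite S" "x \<in> S \<rightarrow> carrier E" and T: "finite T" "x \<in> T \<rightarrow> carrier E"
    and orth: "\<And>j k. j \<in> S \<Longrightarrow> k \<in> T \<Longrightarrow> j \<noteq> k \<Longrightarrow> inner_prod E (x j) (x k) = \<zero>\<^bsub>A\<^esub>"
    and unit: "\<And>j. j \<in> S \<Longrightarrow> ract E (x j) (inner_prod E (x j) (x j)) = x j"
  shows "compose (carrier E) (frame_sum E x S) (frame_sum E x T) = frame_sum E x (S \<inter> T)"
proof -
  have *: "frame_sum E x S (frame_sum E x T z) = frame_sum E x (S \<inter> T) z" if z: "z \<in> carrier E" for z
  proof -
    have x_in: "x j \<in> carrier E" if "j \<in> S" for j
      using S that by auto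
    have term_eq: "ract E (x j) (inner_prod E (x j) (frame_sum E x T z)) =
        (if j \<in> T then ract E (x j) (inner_prod E (x j) z) else \<zero>\<^bsub>E\<^esub>)" if j: "j \<in> S" for j
    proof -
      have "inner_prod E (x j) (frame_sum E x T z) =
          (\<Oplus>\<^bsub>A\<^esub>k\<in>T. if j = k then inner_prod E (x j) (x j) \<otimes>\<^bsub>A\<^esub> inner_prod E (x j) z else \<zero>\<^bsub>A\<^esub>)"
        unfolding ip_frame_sum[OF T z x_in[OF j]]
        using T x_in[OF j] z orth[OF j] by (intro A.mod.M.finsum_cong') (auto simp: Pi_iff)
      also have "\<dots> = (if j \<in> T then inner_prod E (x j) (x j) \<otimes>\<^bsub>A\<^esub> inner_prod E (x j) z else \<zero>\<^bsub>A\<^esub>)"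
      proof (cases "j \<in> T")
        case True
        then show ?thesis
          using A.mod.M.finsum_singleton[OF True T(1), of "\<lambda>_. inner_prod E (x j) (x j) \<otimes>\<^bsub>A\<^esub> inner_prod E (x j) z"]
            x_in[OF j] z by simp
      next
        case False
        then have "(\<Oplus>\<^bsub>A\<^esub>k\<in>T. if j = k then inner_prod E (x j) (x j) \<otimes>\<^bsub>A\<^esub> inner_prod E (x j) z else \<zero>\<^bsub>A\<^esub>)
            = (\<Oplus>\<^bsub>A\<^esub>k\<in>T. \<zero>\<^bsub>A\<^esub>)"
          by (intro A.mod.M.finsum_cong') auto
        then show ?thesis
          using False by simp
      qed
      finally show ?thesis
        using ract_ract[of "x j" "inner_prod E (x j) (x j)" "inner_prod E (x j) z", symmetric]
          unit[OF j] x_in[OF j] z ract_smult_right[of "x j" "\<zero>\<^bsub>A\<^esub>" 0] by auto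
    qed
    have "frame_sum E x T z \<in> carrier E"
      by (rule adjoint_pair_closed[OF adjoint_pair_frame_sum[OF T] z])
    then have "frame_sum E x S (frame_sum E x T z) =
        (\<Oplus>\<^bsub>E\<^esub>j\<in>S. ract E (x j) (inner_prod E (x j) (frame_sum E x T z)))"
      by (simp add: frame_sum_def)
    also have "\<dots> = (\<Oplus>\<^bsub>E\<^esub>j\<in>S. if j \<in> T then ract E (x j) (inner_prod E (x j) z) else \<zero>\<^bsub>E\<^esub>)"
      using term_eq x_in z by (intro E.mod.M.finsum_cong') (auto simp: Pi_iff)
    also have "\<dots> = (\<Oplus>\<^bsub>E\<^esub>j\<in>S \<inter> T. ract E (x j) (inner_prod E (x j) z))"
      using S(1) x_in z by (intro E.mod.M.add.finprod_mono_neutral_cong_right) (auto simp: Pi_iff)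
    finally show ?thesis
      using z by (simp add: frame_sum_def)
  qed
  show ?thesis
  proof
    fix z
    show "compose (carrier E) (frame_sum E x S) (frame_sum E x T) z = frame_sum E x (S \<inter> T) z"
      using * by (cases "z \<in> carrier E") (simp_all add: compose_def, simp add: frame_sum_def)
  qed
qed

end


section \<open>Representations of groupoids\<close>

text \<open>Inverses are unique, by h' = h'(gh) = (h'g)h = h, so the description in
  \<open>ginv\<close> denotes an inverse.\<close>

lemma (in groupoid_over) ginv_closed:
  assumes g: "g \<in> carrier G"
  shows "ginv G g \<in> carrier G"
proof -
  obtain h where h: "is_ginv G g h"
    using inverse_exists[OF g] by blast
  have "h' = h" if h': "is_ginv G g h'" for h'
  proof -
    have "h' = gcomp G h' (gcomp G g h)"
      using h h' g unit_right[of h'] unfolding is_ginv_def by simp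
    also have "\<dots> = gcomp G (gcomp G h' g) h"
      using h h' g comp_assoc[of h' g h] unfolding is_ginv_def by simp
    also have "\<dots> = h"
      using h h' g unit_left[of h] unfolding is_ginv_def by simp
    finally show ?thesis .
  qed
  then have "ginv G g = h"
    unfolding ginv_def using h by (intro the_equality)
  then show ?thesis
    using h by (simp add: is_ginv_def)
qed

text \<open>Instantiated twice, by i in C*(G) and by u in the Nica--Toeplitz algebra. Finiteness of
  the set of objects makes the sum of all unit projections available.\<close>

locale groupoid_rep = groupoid_over V G + B: cstar_algebra B
  for V :: "'v set" and G :: "('g, 'v) groupoid" and B :: "'b cstar" +
  fixes U :: "'g \<Rightarrow> 'b"
  assumes finite_objects: "finite V" and unitary: "unitary_rep G B U"
begin

lemma rep_closed [simp, intro]: "g \<in> carrier G \<Longrightarrow> U g \<in> carrier B"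
  using unitary unfolding unitary_rep_def partial_isometry_def by blast

lemma rep_mult: "g \<in> carrier G \<Longrightarrow> h \<in> carrier G \<Longrightarrow>
    U g \<otimes>\<^bsub>B\<^esub> U h = (if gdom G g = gcod G h then U (gcomp G g h) else \<zero>\<^bsub>B\<^esub>)"
  using unitary unfolding unitary_rep_def by blast

lemma unit_in_gunits: "v \<in> V \<Longrightarrow> gunit G v \<in> gunits G"
  by (simp add: gunits_def unit_closed dom_unit)

lemma rep_unit_projection: "v \<in> V \<Longrightarrow> projection B (U (gunit G v))"
  using unitary unit_in_gunits[of v] by (simp add: unitary_rep_def orthogonal_projections_def)

lemma rep_unit_star: "v \<in> V \<Longrightarrow> star B (U (gunit G v)) = U (gunit G v)"
  using rep_unit_projection[of v] by (simp add: projection_def)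

lemma rep_unit_left: "v \<in> V \<Longrightarrow> g \<in> carrier G \<Longrightarrow>
    U (gunit G v) \<otimes>\<^bsub>B\<^esub> U g = (if v = gcod G g then U g else \<zero>\<^bsub>B\<^esub>)"
  by (simp add: rep_mult unit_closed dom_unit unit_left)

lemma rep_unit_right: "v \<in> V \<Longrightarrow> g \<in> carrier G \<Longrightarrow>
    U g \<otimes>\<^bsub>B\<^esub> U (gunit G v) = (if v = gdom G g then U g else \<zero>\<^bsub>B\<^esub>)"
  by (auto simp: rep_mult unit_closed cod_unit unit_right)

lemma rep_units_orthogonal: "v \<in> V \<Longrightarrow> w \<in> V \<Longrightarrow>
    U (gunit G v) \<otimes>\<^bsub>B\<^esub> U (gunit G w) = (if v = w then U (gunit G v) else \<zero>\<^bsub>B\<^esub>)"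
  by (auto simp: rep_unit_left unit_closed cod_unit)

definition unit_sum :: 'b where
  "unit_sum = (\<Oplus>\<^bsub>B\<^esub>v\<in>V. U (gunit G v))"

lemma unit_sum_closed [simp, intro]: "unit_sum \<in> carrier B"
  unfolding unit_sum_def by (intro B.mod.M.finsum_closed) (auto simp: unit_closed)

lemma unit_sum_mult_unit: "v \<in> V \<Longrightarrow> unit_sum \<otimes>\<^bsub>B\<^esub> U (gunit G v) = U (gunit G v)"
proof -
  assume v: "v \<in> V"
  have "unit_sum \<otimes>\<^bsub>B\<^esub> U (gunit G v) = (\<Oplus>\<^bsub>B\<^esub>w\<in>V. U (gunit G w) \<otimes>\<^bsub>B\<^esub> U (gunit G v))"
    unfolding unit_sum_def using finite_objects v
    by (intro B.mult_finsum_left) (auto simp: unit_closed)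
  also have "\<dots> = (\<Oplus>\<^bsub>B\<^esub>w\<in>V. if v = w then U (gunit G w) else \<zero>\<^bsub>B\<^esub>)"
    using v by (intro B.mod.M.finsum_cong') (auto simp: rep_units_orthogonal unit_closed)
  also have "\<dots> = U (gunit G v)"
    using v finite_objects by (intro B.mod.M.finsum_singleton) (auto simp: unit_closed)
  finally show ?thesis .
qed

lemma star_unit_sum: "star B unit_sum = unit_sum"
proof -
  have "star B (\<Oplus>\<^bsub>B\<^esub>v\<in>W. U (gunit G v)) = (\<Oplus>\<^bsub>B\<^esub>v\<in>W. U (gunit G v))" if "finite W" "W \<subseteq> V" for W
    using that
  proof (induction W rule: finite_induct)
    case (insert w W)
    then have "(\<lambda>v. U (gunit G v)) \<in> W \<rightarrow> carrier B"
      by (auto simp: unit_closed)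
    then show ?case
      using insert by (simp add: unit_closed B.star_add rep_unit_star)
  qed simp
  then show ?thesis
    unfolding unit_sum_def using finite_objects by blast
qed

lemma unit_sum_mult:
  assumes "v \<in> V" "x \<in> carrier B" "U (gunit G v) \<otimes>\<^bsub>B\<^esub> x = x"
  shows "unit_sum \<otimes>\<^bsub>B\<^esub> x = x"
  using assms B.mult_assoc[of unit_sum "U (gunit G v)" x] unit_sum_mult_unit[of v] by (simp add: unit_closed)

text \<open>The adjoint of the left-hand version, as the unit projections and their sum are
  self-adjoint.\<close>

lemma mult_unit_sum:
  assumes "v \<in> V" "x \<in> carrier B" "x \<otimes>\<^bsub>B\<^esub> U (gunit G v) = x"
  shows "x \<otimes>\<^bsub>B\<^esub> unit_sum = x"
proof -
  have "star B (U (gunit G v)) \<otimes>\<^bsub>B\<^esub> star B x = star B x"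
    using assms B.star_mult[of x "U (gunit G v)"] by (simp add: unit_closed)
  then have "unit_sum \<otimes>\<^bsub>B\<^esub> star B x = star B x"
    using assms by (intro unit_sum_mult[of v]) (simp_all add: rep_unit_star)
  then show ?thesis
    using assms(2) B.star_mult[of unit_sum "star B x"] by (simp add: star_unit_sum)
qed

text \<open>Each generator absorbs some unit projection on either side, and by orthogonality the sum
  absorbs that projection; so the sum fixes the generators.\<close>

lemma unit_sum_identity:
  assumes "cstar_generated B S = carrier B" "S \<subseteq> carrier B"
    and "\<And>x. x \<in> S \<Longrightarrow> \<exists>v\<in>V. U (gunit G v) \<otimes>\<^bsub>B\<^esub> x = x"
    and "\<And>x. x \<in> S \<Longrightarrow> \<exists>v\<in>V. x \<otimes>\<^bsub>B\<^esub> U (gunit G v) = x"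
  shows "is_identity B unit_sum"
  using assms unit_sum_mult mult_unit_sum star_unit_sum
  by (intro B.is_identity_if_generated[of S]) blast+

end

lemma unitary_rep_image:
  fixes A :: "'a cstar" and B :: "'b cstar"
  assumes f: "cstar_hom A B f" and U: "unitary_rep G A U"
  shows "unitary_rep G B (\<lambda>g. f (U g))"
proof -
  interpret cstar_hom A B f by (rule f)
  have in_A: "U g \<in> carrier A" and pi: "U g \<otimes>\<^bsub>A\<^esub> star A (U g) \<otimes>\<^bsub>A\<^esub> U g = U g"
    and star_U: "star A (U g) = U (ginv G g)" if "g \<in> carrier G" for g
    using U that unfolding unitary_rep_def partial_isometry_def by blast+
  have mult_U: "U g \<otimes>\<^bsub>A\<^esub> U h = (if gdom G g = gcod G h then U (gcomp G g h) else \<zero>\<^bsub>A\<^esub>)"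
    if "g \<in> carrier G" "h \<in> carrier G" for g h
    using U that by (simp add: unitary_rep_def)
  have unit_in: "v \<in> carrier G" if "v \<in> gunits G" for v
    using that by (simp add: gunits_def)
  have proj: "U v \<otimes>\<^bsub>A\<^esub> U v = U v" "star A (U v) = U v" if "v \<in> gunits G" for v
    using U that by (simp_all add: unitary_rep_def orthogonal_projections_def projection_def)
  have orth: "U v \<otimes>\<^bsub>A\<^esub> U w = \<zero>\<^bsub>A\<^esub>" if "v \<in> gunits G" "w \<in> gunits G" "v \<noteq> w" for v w
    using U that by (simp add: unitary_rep_def orthogonal_projections_def)
  show ?thesis
    unfolding unitary_rep_def
  proof (intro conjI ballI)
    show "partial_isometry B (f (U g))" if "g \<in> carrier G" for g
      using in_A[OF that] hom_mult[of "U g \<otimes>\<^bsub>A\<^esub> star A (U g)" "U g"] hom_mult[of "U g" "star A (U g)"]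
        hom_star[of "U g"] pi[OF that] by (simp add: partial_isometry_def)
    show "orthogonal_projections B (gunits G) (\<lambda>g. f (U g))"
      unfolding orthogonal_projections_def projection_def
    proof (intro conjI ballI impI)
      fix v assume v: "v \<in> gunits G"
      note in_v = in_A[OF unit_in[OF v]]
      show "f (U v) \<in> carrier B"
        using in_v by blast
      show "f (U v) \<otimes>\<^bsub>B\<^esub> f (U v) = f (U v)" "star B (f (U v)) = f (U v)"
        using hom_mult[OF in_v in_v] hom_star[OF in_v] proj[OF v] by simp_all
      show "f (U v) \<otimes>\<^bsub>B\<^esub> f (U w) = \<zero>\<^bsub>B\<^esub>" if w: "w \<in> gunits G" "v \<noteq> w" for w
        using hom_mult[OF in_v in_A[OF unit_in[OF w(1)]]] orth[OF v w] by simp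
    qed
    show "star B (f (U g)) = f (U (ginv G g))" if "g \<in> carrier G" for g
      using hom_star[OF in_A[OF that]] star_U[OF that] by simp
    show "f (U g) \<otimes>\<^bsub>B\<^esub> f (U h) = (if gdom G g = gcod G h then f (U (gcomp G g h)) else \<zero>\<^bsub>B\<^esub>)"
      if "g \<in> carrier G" "h \<in> carrier G" for g h
      using hom_mult[OF in_A[OF that(1)] in_A[OF that(2)]] mult_U[OF that]
      by (cases "gdom G g = gcod G h") simp_all
  qed
qed

section \<open>\<open>k\<close>-graphs and self-similar actions\<close>

text \<open>Subtraction is truncated, but p and q lie below their join, so nothing is lost.\<close>

lemma add_join_diff:
  fixes p q :: "nat ^ 'k::finite"
  shows "p + (join p q - p) = join p q" "q + (join p q - q) = join p q"
  by (simp_all add: vec_eq_iff join_def)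

section \<open>Factorisation and common extensions of paths\<close>

context kgraph
begin

text \<open>Equal first degrees force equal second degrees by cancellation, so both pairs factor one
  path along the same splitting of its degree.\<close>

lemma factorisation_unique:
  assumes "\<mu> \<in> carrier \<Lambda>" "\<nu> \<in> carrier \<Lambda>" "src \<Lambda> \<mu> = rng \<Lambda> \<nu>"
    and "\<mu>' \<in> carrier \<Lambda>" "\<nu>' \<in> carrier \<Lambda>" "src \<Lambda> \<mu>' = rng \<Lambda> \<nu>'"
    and "kcomp \<Lambda> \<mu> \<nu> = kcomp \<Lambda> \<mu>' \<nu>'" "deg \<Lambda> \<mu> = deg \<Lambda> \<mu>'"
  shows "\<mu> = \<mu>'" "\<nu> = \<nu>'"
proof -
  have "deg \<Lambda> \<mu> + deg \<Lambda> \<nu> = deg \<Lambda> \<mu> + deg \<Lambda> \<nu>'"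
    using assms deg_comp[of \<mu> \<nu>] deg_comp[of \<mu>' \<nu>'] by simp
  then have "deg \<Lambda> \<nu>' = deg \<Lambda> \<nu>"
    by (simp add: add_left_cancel)
  define P where "P = (\<lambda>(a, b). a \<in> carrier \<Lambda> \<and> b \<in> carrier \<Lambda> \<and> src \<Lambda> a = rng \<Lambda> b \<and>
    kcomp \<Lambda> \<mu> \<nu> = kcomp \<Lambda> a b \<and> deg \<Lambda> a = deg \<Lambda> \<mu> \<and> deg \<Lambda> b = deg \<Lambda> \<nu>)"
  have "\<exists>!x. P x"
    unfolding P_def using assms(1-3) by (intro unique_factorisation comp_closed deg_comp)
  moreover have "P (\<mu>, \<nu>)" "P (\<mu>', \<nu>')"
    unfolding P_def using assms \<open>deg \<Lambda> \<nu>' = deg \<Lambda> \<nu>\<close> by simp_all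
  ultimately have "(\<mu>, \<nu>) = (\<mu>', \<nu>')"
    by blast
  then show "\<mu> = \<mu>'" "\<nu> = \<nu>'"
    by auto
qed

lemma pathsD: "\<alpha> \<in> paths \<Lambda> p \<Longrightarrow> \<alpha> \<in> carrier \<Lambda>" "\<alpha> \<in> paths \<Lambda> p \<Longrightarrow> deg \<Lambda> \<alpha> = p"
  by (simp_all add: paths_def)

lemma paths_toD: "\<alpha> \<in> paths_to \<Lambda> v \<Longrightarrow> \<alpha> \<in> carrier \<Lambda>" "\<alpha> \<in> paths_to \<Lambda> v \<Longrightarrow> rng \<Lambda> \<alpha> = v"
  by (simp_all add: paths_to_def)

lemma rng_vertex: "\<alpha> \<in> carrier \<Lambda> \<Longrightarrow> rng \<Lambda> \<alpha> \<in> vertices \<Lambda>"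
  and src_vertex: "\<alpha> \<in> carrier \<Lambda> \<Longrightarrow> src \<Lambda> \<alpha> \<in> vertices \<Lambda>"
  by (simp_all add: paths_def rng_closed src_closed deg_rng deg_src)

text \<open>A morphism v of degree 0 factors both as v followed by its source identity and as its
  range identity followed by v, all of degree 0; uniqueness identifies v with its range.\<close>

lemma vertex_id:
  assumes "v \<in> vertices \<Lambda>"
  shows "rng \<Lambda> v = v" "src \<Lambda> v = v"
proof -
  have v: "v \<in> carrier \<Lambda>" "deg \<Lambda> v = 0"
    using assms by (auto dest: pathsD)
  have "v = rng \<Lambda> v"
    using factorisation_unique(1)[of v "src \<Lambda> v" "rng \<Lambda> v" v] v
    by (simp add: src_closed rng_closed rng_src src_rng src_id rng_id deg_rng)
  then show "rng \<Lambda> v = v" "src \<Lambda> v = v"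
    using src_rng[OF v(1)] by simp_all
qed

lemma comp_paths:
  "\<alpha> \<in> paths \<Lambda> p \<Longrightarrow> \<mu> \<in> paths \<Lambda> q \<Longrightarrow> src \<Lambda> \<alpha> = rng \<Lambda> \<mu> \<Longrightarrow> kcomp \<Lambda> \<alpha> \<mu> \<in> paths \<Lambda> (p + q)"
  by (simp add: paths_def comp_closed deg_comp)

text \<open>The groupoid axiom of the same name hides this one in \<^locale>\<open>self_similar_action\<close>.\<close>

lemmas path_comp_closed = comp_closed

lemma edgesD: "e \<in> edges \<Lambda> \<Longrightarrow> e \<in> carrier \<Lambda>" "e \<in> edges \<Lambda> \<Longrightarrow> deg \<Lambda> e \<noteq> 0"
proof -
  have "axis j (1 :: nat) \<noteq> 0" for j :: 'k
    by (simp add: axis_eq_0_iff)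
  then show "e \<in> edges \<Lambda> \<Longrightarrow> e \<in> carrier \<Lambda>" "e \<in> edges \<Lambda> \<Longrightarrow> deg \<Lambda> e \<noteq> 0"
    by (auto simp: edges_def paths_def)
qed

text \<open>Induction on the total degree: an edge is split off in a direction in which the degree
  is nonzero.\<close>

lemma edge_factorisation_exists:
  "\<alpha> \<in> carrier \<Lambda> \<Longrightarrow> \<exists>es. edge_factorisation \<Lambda> \<alpha> es"
proof (induction "\<Sum>j\<in>UNIV. deg \<Lambda> \<alpha> $ j" arbitrary: \<alpha> rule: less_induct)
  case less
  show ?case
  proof (cases "deg \<Lambda> \<alpha> = 0")
    case True
    then have "edge_factorisation \<Lambda> \<alpha> []"
      using less.prems by (simp add: paths_def)
    then show ?thesis ..
  next
    case False
    then obtain j where j: "deg \<Lambda> \<alpha> $ j \<noteq> 0"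
      by (auto simp: vec_eq_iff)
    let ?r = "deg \<Lambda> \<alpha> - axis j 1"
    \<comment> \<open>The truncated subtraction is exact because coordinate j is nonzero.\<close>
    have "deg \<Lambda> \<alpha> = axis j 1 + ?r"
      using j by (auto simp: vec_eq_iff axis_def)
    then obtain e \<mu> where *: "e \<in> carrier \<Lambda>" "\<mu> \<in> carrier \<Lambda>" "src \<Lambda> e = rng \<Lambda> \<mu>" "\<alpha> = kcomp \<Lambda> e \<mu>"
        "deg \<Lambda> e = axis j 1" "deg \<Lambda> \<mu> = ?r"
      using unique_factorisation[OF less.prems] by blast
    have "(\<Sum>l\<in>UNIV. deg \<Lambda> \<mu> $ l) < (\<Sum>l\<in>UNIV. deg \<Lambda> \<alpha> $ l)"
      using j by (intro sum_strict_mono_ex1) (auto simp: *(6) axis_def)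
    then obtain es where "edge_factorisation \<Lambda> \<mu> es"
      using less.hyps *(2) by blast
    moreover have "e \<in> edges \<Lambda>" "\<mu> \<in> paths_to \<Lambda> (src \<Lambda> e)"
      using * by (auto simp: edges_def paths_def paths_to_def)
    ultimately have "edge_factorisation \<Lambda> \<alpha> (e # es)"
      using *(4) by auto
    then show ?thesis ..
  qed
qed

text \<open>Degrees add up without cancellation, so a path of degree 0 contains no edge. The
  factorisation chosen in \<open>restriction\<close> is therefore empty at a vertex.\<close>

lemma edge_factorisation_vertex:
  assumes "v \<in> vertices \<Lambda>" "edge_factorisation \<Lambda> v es"
  shows "es = []"
proof (cases es)
  case (Cons e es')
  then obtain \<mu> where *: "e \<in> edges \<Lambda>" "\<mu> \<in> paths_to \<Lambda> (src \<Lambda> e)" "v = kcomp \<Lambda> e \<mu>"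
    using assms(2) by auto
  then have "deg \<Lambda> e + deg \<Lambda> \<mu> = 0"
    using assms(1) deg_comp[of e \<mu>] edgesD[of e] by (simp add: paths_to_def paths_def)
  then have "deg \<Lambda> e = 0"
    by (simp add: vec_eq_iff)
  then show ?thesis
    using edgesD(2)[OF *(1)] by simp
qed

text \<open>The set \<alpha>\<Lambda>^q: here q is the degree added to \<alpha>, not the degree of
  the extended path.\<close>

definition extensions :: "'l \<Rightarrow> nat ^ 'k \<Rightarrow> 'l set" where
  "extensions \<alpha> q = kcomp \<Lambda> \<alpha> ` (paths_to \<Lambda> (src \<Lambda> \<alpha>) \<inter> paths \<Lambda> q)"

lemma extensions_subset: "\<alpha> \<in> paths \<Lambda> p \<Longrightarrow> extensions \<alpha> q \<subseteq> paths \<Lambda> (p + q)"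
  unfolding extensions_def using comp_paths[of \<alpha> p _ q] by (auto dest: paths_toD)

text \<open>Left cancellation, from unique factorisation with a fixed first factor. It allows sums
  over extensions to be reindexed by the added path.\<close>

lemma inj_on_comp: "\<alpha> \<in> carrier \<Lambda> \<Longrightarrow> inj_on (kcomp \<Lambda> \<alpha>) (paths_to \<Lambda> (src \<Lambda> \<alpha>))"
  by (rule inj_onI) (rule factorisation_unique(2)[of \<alpha> _ \<alpha>], auto dest: paths_toD)

text \<open>The path \<gamma> = \<alpha>\<eta> = \<mu>\<zeta> determines \<eta> and \<zeta> by
  unique factorisation. Nica covariance produces sums over \<gamma>, whereas the
  Toeplitz--Cuntz--Krieger relation sums over the pairs.\<close>

lemma min_extensions_bij:
  assumes \<alpha>: "\<alpha> \<in> paths \<Lambda> p" and \<mu>: "\<mu> \<in> paths \<Lambda> q"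
  shows "bij_betw (\<lambda>x. kcomp \<Lambda> \<alpha> (fst x)) (min_extensions \<Lambda> \<alpha> \<mu>)
    (extensions \<alpha> (join p q - p) \<inter> extensions \<mu> (join p q - q))"
proof (rule bij_betw_imageI)
  have c: "\<alpha> \<in> carrier \<Lambda>" "\<mu> \<in> carrier \<Lambda>" "deg \<Lambda> \<alpha> = p" "deg \<Lambda> \<mu> = q"
    using \<alpha> \<mu> by (auto dest: pathsD)
  show "inj_on (\<lambda>x. kcomp \<Lambda> \<alpha> (fst x)) (min_extensions \<Lambda> \<alpha> \<mu>)"
  proof (rule inj_onI)
    fix x y assume "x \<in> min_extensions \<Lambda> \<alpha> \<mu>" "y \<in> min_extensions \<Lambda> \<alpha> \<mu>"
      "kcomp \<Lambda> \<alpha> (fst x) = kcomp \<Lambda> \<alpha> (fst y)"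
    then show "x = y"
      using factorisation_unique(2)[of \<alpha> "fst x" \<alpha> "fst y"]
        factorisation_unique(2)[of \<mu> "snd x" \<mu> "snd y"] c
      by (auto simp: min_extensions_def)
  qed
  show "(\<lambda>x. kcomp \<Lambda> \<alpha> (fst x)) ` min_extensions \<Lambda> \<alpha> \<mu>
      = extensions \<alpha> (join p q - p) \<inter> extensions \<mu> (join p q - q)" (is "?L = ?R")
  proof
    show "?L \<subseteq> ?R"
    proof
      fix \<gamma> assume "\<gamma> \<in> ?L"
      then obtain \<eta> \<zeta> where *: "\<eta> \<in> carrier \<Lambda>" "\<zeta> \<in> carrier \<Lambda>" "src \<Lambda> \<alpha> = rng \<Lambda> \<eta>"
          "src \<Lambda> \<mu> = rng \<Lambda> \<zeta>" "kcomp \<Lambda> \<alpha> \<eta> = kcomp \<Lambda> \<mu> \<zeta>"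
          "deg \<Lambda> (kcomp \<Lambda> \<alpha> \<eta>) = join p q" "\<gamma> = kcomp \<Lambda> \<alpha> \<eta>"
        using c by (auto simp: min_extensions_def)
      have "deg \<Lambda> \<eta> = join p q - p" "deg \<Lambda> \<zeta> = join p q - q"
        using * c deg_comp[of \<alpha> \<eta>] deg_comp[of \<mu> \<zeta>] by (metis add_diff_cancel_left')+
      then have "\<eta> \<in> paths_to \<Lambda> (src \<Lambda> \<alpha>) \<inter> paths \<Lambda> (join p q - p)"
        "\<zeta> \<in> paths_to \<Lambda> (src \<Lambda> \<mu>) \<inter> paths \<Lambda> (join p q - q)"
        using * by (simp_all add: paths_def paths_to_def)
      then show "\<gamma> \<in> ?R"
        using *(5,7) unfolding extensions_def by blast
    qed
    show "?R \<subseteq> ?L"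
    proof
      fix \<gamma> assume "\<gamma> \<in> ?R"
      then obtain \<eta> \<zeta> where *: "\<eta> \<in> paths_to \<Lambda> (src \<Lambda> \<alpha>)" "\<eta> \<in> paths \<Lambda> (join p q - p)"
          "\<gamma> = kcomp \<Lambda> \<alpha> \<eta>" "\<zeta> \<in> paths_to \<Lambda> (src \<Lambda> \<mu>)" "\<gamma> = kcomp \<Lambda> \<mu> \<zeta>"
        by (auto simp: extensions_def)
      then have "deg \<Lambda> \<gamma> = join p q"
        using c deg_comp[of \<alpha> \<eta>] add_join_diff(1)[of p q] by (simp add: paths_to_def paths_def)
      then have "(\<eta>, \<zeta>) \<in> min_extensions \<Lambda> \<alpha> \<mu>"
        using * c by (auto simp: min_extensions_def paths_to_def)
      then show "\<gamma> \<in> ?L"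
        using *(3) by force
    qed
  qed
qed

end

section \<open>Actions and restrictions\<close>

context self_similar_action
begin

lemma action_in_PIso:
  assumes g: "g \<in> carrier G"
  shows "\<pi> g = (gdom G g, gcod G g, act \<pi> g)" "\<pi> g \<in> carrier (PIso \<Lambda>)"
proof -
  show "\<pi> g \<in> carrier (PIso \<Lambda>)"
    using action g by (auto simp: unit_preserving_hom_def)
  have "gdom (PIso \<Lambda>) (\<pi> g) = gdom G g" "gcod (PIso \<Lambda>) (\<pi> g) = gcod G g"
    using action g by (auto simp: unit_preserving_hom_def)
  then show "\<pi> g = (gdom G g, gcod G g, act \<pi> g)"
    by (cases "\<pi> g") (simp add: PIso_def act_def)
qed

lemma act_bij:
  assumes g: "g \<in> carrier G"
  shows "act \<pi> g \<in> extensional (paths_to \<Lambda> (gdom G g))"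
    and "act \<pi> g ` (paths_to \<Lambda> (gdom G g) \<inter> paths \<Lambda> p) = paths_to \<Lambda> (gcod G g) \<inter> paths \<Lambda> p"
proof -
  have "(gdom G g, gcod G g, act \<pi> g) \<in> carrier (PIso \<Lambda>)"
    using action_in_PIso[OF g] by simp
  then show "act \<pi> g \<in> extensional (paths_to \<Lambda> (gdom G g))"
    "act \<pi> g ` (paths_to \<Lambda> (gdom G g) \<inter> paths \<Lambda> p) = paths_to \<Lambda> (gcod G g) \<inter> paths \<Lambda> p"
    by (auto simp: PIso_def)
qed

lemma act_path:
  assumes "g \<in> carrier G" "\<alpha> \<in> paths \<Lambda> p" "rng \<Lambda> \<alpha> = gdom G g"
  shows "act \<pi> g \<alpha> \<in> paths \<Lambda> p" "rng \<Lambda> (act \<pi> g \<alpha>) = gcod G g"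
  using act_bij(2)[OF assms(1), of p] assms(2,3) unfolding paths_to_def paths_def by blast+

lemma act_closed:
  assumes "g \<in> carrier G" "\<alpha> \<in> paths_to \<Lambda> (gdom G g)"
  shows "act \<pi> g \<alpha> \<in> carrier \<Lambda>" "rng \<Lambda> (act \<pi> g \<alpha>) = gcod G g" "deg \<Lambda> (act \<pi> g \<alpha>) = deg \<Lambda> \<alpha>"
  using act_path[of g \<alpha> "deg \<Lambda> \<alpha>"] assms by (auto simp: paths_def paths_to_def)

text \<open>The image has degree 0 and range \<open>gcod G g\<close>, and a vertex is its own
  range.\<close>

lemma act_vertex: "g \<in> carrier G \<Longrightarrow> act \<pi> g (gdom G g) = gcod G g"
  using act_path[of g "gdom G g" 0] vertex_id dom_closed[of g] by simp

lemma act_unit: "v \<in> vertices \<Lambda> \<Longrightarrow> \<mu> \<in> paths_to \<Lambda> v \<Longrightarrow> act \<pi> (gunit G v) \<mu> = \<mu>"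
  using action by (simp add: unit_preserving_hom_def act_def PIso_def)

text \<open>Cancelling g \<cdot> e on the left shows that h and h' act alike on the paths with range
  s(e), and both actions are extensional there; domains and codomains agree too, so faithfulness
  gives h = h'.\<close>

lemma edge_restriction_unique:
  assumes g: "g \<in> carrier G" "e \<in> edges \<Lambda>" "rng \<Lambda> e = gdom G g"
    and h: "is_edge_restriction \<Lambda> G \<pi> g e h" and h': "is_edge_restriction \<Lambda> G \<pi> g e h'"
  shows "h = h'"
proof -
  have H: "h \<in> carrier G" "h' \<in> carrier G" "gdom G h = src \<Lambda> e" "gdom G h' = src \<Lambda> e"
    "gcod G h = src \<Lambda> (act \<pi> g e)" "gcod G h' = src \<Lambda> (act \<pi> g e)"
    using h h' by (auto simp: is_edge_restriction_def)
  have e: "act \<pi> g e \<in> carrier \<Lambda>"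
    using act_closed(1)[OF g(1)] g edgesD by (simp add: paths_to_def)
  have "act \<pi> h = act \<pi> h'"
  proof (rule extensionalityI)
    show "act \<pi> h \<in> extensional (paths_to \<Lambda> (src \<Lambda> e))" "act \<pi> h' \<in> extensional (paths_to \<Lambda> (src \<Lambda> e))"
      using act_bij(1) H by metis+
    fix \<alpha> assume \<alpha>: "\<alpha> \<in> paths_to \<Lambda> (src \<Lambda> e)"
    then have "\<alpha> \<in> paths_to \<Lambda> (gdom G h)" "\<alpha> \<in> paths_to \<Lambda> (gdom G h')"
      using H by simp_all
    note closed = act_closed[OF H(1) this(1)] act_closed[OF H(2) this(2)]
    show "act \<pi> h \<alpha> = act \<pi> h' \<alpha>"
    proof (rule factorisation_unique(2))
      have "act \<pi> g (kcomp \<Lambda> e \<alpha>) = kcomp \<Lambda> (act \<pi> g e) (act \<pi> h \<alpha>)"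
        "act \<pi> g (kcomp \<Lambda> e \<alpha>) = kcomp \<Lambda> (act \<pi> g e) (act \<pi> h' \<alpha>)"
        using h h' \<alpha> unfolding is_edge_restriction_def by blast+
      then show "kcomp \<Lambda> (act \<pi> g e) (act \<pi> h \<alpha>) = kcomp \<Lambda> (act \<pi> g e) (act \<pi> h' \<alpha>)"
        by metis
    qed (use e H closed in simp_all)
  qed
  then have "\<pi> h = \<pi> h'"
    using action_in_PIso(1)[OF H(1)] action_in_PIso(1)[OF H(2)] H by simp
  then show ?thesis
    using faithful H by (auto dest: inj_onD)
qed

lemma edge_restriction_eq:
  assumes "g \<in> carrier G" "e \<in> edges \<Lambda>" "rng \<Lambda> e = gdom G g" "is_edge_restriction \<Lambda> G \<pi> g e h"
  shows "edge_restriction \<Lambda> G \<pi> g e = h"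
  unfolding edge_restriction_def using assms edge_restriction_unique by (intro the_equality) blast+

lemma edge_restriction_spec:
  assumes "g \<in> carrier G" "e \<in> edges \<Lambda>" "rng \<Lambda> e = gdom G g"
  shows "is_edge_restriction \<Lambda> G \<pi> g e (edge_restriction \<Lambda> G \<pi> g e)"
proof -
  have "e \<in> edges \<Lambda> \<inter> paths_to \<Lambda> (gdom G g)"
    using assms edgesD(1) by (simp add: paths_to_def)
  then obtain h where "is_edge_restriction \<Lambda> G \<pi> g e h"
    using self_similar assms(1) by blast
  then show ?thesis
    using edge_restriction_eq[OF assms] by simp
qed

text \<open>By uniqueness it is enough that the unit at s(e) meets the specification, and both sides
  of that equation are e\<alpha>.\<close>

lemma edge_restriction_unit:
  assumes "e \<in> edges \<Lambda>"
  shows "edge_restriction \<Lambda> G \<pi> (gunit G (rng \<Lambda> e)) e = gunit G (src \<Lambda> e)"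
proof (rule edge_restriction_eq)
  have e: "e \<in> carrier \<Lambda>"
    using assms edgesD by blast
  show "gunit G (rng \<Lambda> e) \<in> carrier G" "rng \<Lambda> e = gdom G (gunit G (rng \<Lambda> e))"
    using rng_vertex[OF e] unit_closed dom_unit by simp_all
  show "is_edge_restriction \<Lambda> G \<pi> (gunit G (rng \<Lambda> e)) e (gunit G (src \<Lambda> e))"
    unfolding is_edge_restriction_def
  proof (intro conjI ballI)
    have e': "e \<in> paths_to \<Lambda> (rng \<Lambda> e)"
      using e by (simp add: paths_to_def)
    show "gunit G (src \<Lambda> e) \<in> carrier G" "gdom G (gunit G (src \<Lambda> e)) = src \<Lambda> e"
      "gcod G (gunit G (src \<Lambda> e)) = src \<Lambda> (act \<pi> (gunit G (rng \<Lambda> e)) e)"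
      using src_vertex[OF e] act_unit[OF rng_vertex[OF e] e'] by (simp_all add: unit_closed dom_unit cod_unit)
    fix \<alpha> assume \<alpha>: "\<alpha> \<in> paths_to \<Lambda> (src \<Lambda> e)"
    then have "kcomp \<Lambda> e \<alpha> \<in> paths_to \<Lambda> (rng \<Lambda> e)"
      using e path_comp_closed[of e \<alpha>] rng_comp[of e \<alpha>] by (simp add: paths_to_def)
    then show "act \<pi> (gunit G (rng \<Lambda> e)) (kcomp \<Lambda> e \<alpha>)
        = kcomp \<Lambda> (act \<pi> (gunit G (rng \<Lambda> e)) e) (act \<pi> (gunit G (src \<Lambda> e)) \<alpha>)"
      using act_unit[OF rng_vertex[OF e]] act_unit[OF src_vertex[OF e] \<alpha>] e' by simp
  qed
qed (rule assms)

text \<open>The invariant of the fold, with g and \<alpha> generalised: the restriction to the first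
  edge has as its domain the range of the remaining path, so the next restriction is defined, and
  the image of \<alpha> ends in the image of that remaining path.\<close>

lemma foldl_edge_restriction:
  assumes "g \<in> carrier G" "edge_factorisation \<Lambda> \<alpha> es" "rng \<Lambda> \<alpha> = gdom G g"
  defines "h \<equiv> foldl (edge_restriction \<Lambda> G \<pi>) g es"
  shows "h \<in> carrier G \<and> gdom G h = src \<Lambda> \<alpha> \<and> gcod G h = src \<Lambda> (act \<pi> g \<alpha>)"
  using assms(1-3) unfolding h_def
proof (induction es arbitrary: g \<alpha>)
  case Nil
  then show ?case
    using vertex_id[of \<alpha>] act_vertex[of g] cod_closed[of g] vertex_id[of "gcod G g"] by simp
next
  case (Cons e es)
  then obtain \<mu> where *: "e \<in> edges \<Lambda>" "\<mu> \<in> paths_to \<Lambda> (src \<Lambda> e)" "\<alpha> = kcomp \<Lambda> e \<mu>"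
      "edge_factorisation \<Lambda> \<mu> es"
    by auto
  let ?h = "edge_restriction \<Lambda> G \<pi> g e"
  have e: "e \<in> carrier \<Lambda>" "rng \<Lambda> e = gdom G g"
    using * edgesD Cons.prems rng_comp[of e \<mu>] by (auto simp: paths_to_def)
  have h: "is_edge_restriction \<Lambda> G \<pi> g e ?h"
    by (rule edge_restriction_spec[OF Cons.prems(1) *(1) e(2)])
  then have h': "?h \<in> carrier G" "gdom G ?h = src \<Lambda> e" "gcod G ?h = src \<Lambda> (act \<pi> g e)"
    "act \<pi> g \<alpha> = kcomp \<Lambda> (act \<pi> g e) (act \<pi> ?h \<mu>)"
    using * by (auto simp: is_edge_restriction_def)
  have "src \<Lambda> (act \<pi> g \<alpha>) = src \<Lambda> (act \<pi> ?h \<mu>)"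
    unfolding h'(4) using act_closed[of g e] act_closed[of ?h \<mu>] e h' *(2) Cons.prems(1)
    by (intro src_comp) (auto simp: paths_to_def)
  moreover have "src \<Lambda> \<alpha> = src \<Lambda> \<mu>"
    using src_comp[of e \<mu>] * e by (simp add: paths_to_def)
  moreover have "rng \<Lambda> \<mu> = gdom G ?h"
    using *(2) h'(2) by (simp add: paths_to_def)
  ultimately show ?case
    using Cons.IH[OF h'(1) *(4)] by simp
qed

lemma foldl_edge_restriction_unit:
  assumes "edge_factorisation \<Lambda> \<alpha> es"
  shows "foldl (edge_restriction \<Lambda> G \<pi>) (gunit G (rng \<Lambda> \<alpha>)) es = gunit G (src \<Lambda> \<alpha>)"
  using assms
proof (induction es arbitrary: \<alpha>)
  case Nil
  then show ?case
    using vertex_id[of \<alpha>] by simp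
next
  case (Cons e es)
  then obtain \<mu> where *: "e \<in> edges \<Lambda>" "\<mu> \<in> paths_to \<Lambda> (src \<Lambda> e)" "\<alpha> = kcomp \<Lambda> e \<mu>"
      "edge_factorisation \<Lambda> \<mu> es"
    by auto
  have "rng \<Lambda> \<alpha> = rng \<Lambda> e" "src \<Lambda> \<alpha> = src \<Lambda> \<mu>" "rng \<Lambda> \<mu> = src \<Lambda> e"
    using * edgesD rng_comp[of e \<mu>] src_comp[of e \<mu>] by (auto simp: paths_to_def)
  then show ?case
    using Cons.IH[OF *(4)] edge_restriction_unit[OF *(1)] by simp
qed

text \<open>Proved for every edge factorisation, hence true of the one picked by
  \<open>SOME\<close>.\<close>

lemma restriction_closed:
  assumes "g \<in> carrier G" "\<alpha> \<in> carrier \<Lambda>" "rng \<Lambda> \<alpha> = gdom G g"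
  shows "restriction \<Lambda> G \<pi> g \<alpha> \<in> carrier G" "gdom G (restriction \<Lambda> G \<pi> g \<alpha>) = src \<Lambda> \<alpha>"
    "gcod G (restriction \<Lambda> G \<pi> g \<alpha>) = src \<Lambda> (act \<pi> g \<alpha>)"
  using foldl_edge_restriction[OF assms(1) someI_ex[OF edge_factorisation_exists[OF assms(2)]] assms(3)]
  by (simp_all add: restriction_def)

lemma restriction_unit:
  "\<alpha> \<in> carrier \<Lambda> \<Longrightarrow> restriction \<Lambda> G \<pi> (gunit G (rng \<Lambda> \<alpha>)) \<alpha> = gunit G (src \<Lambda> \<alpha>)"
  unfolding restriction_def
  using foldl_edge_restriction_unit[OF someI_ex[OF edge_factorisation_exists]] .

lemma restriction_vertex:
  assumes "v \<in> vertices \<Lambda>"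
  shows "restriction \<Lambda> G \<pi> g v = g"
proof -
  have "edge_factorisation \<Lambda> v (SOME es. edge_factorisation \<Lambda> v es)"
    using someI_ex[OF edge_factorisation_exists[OF pathsD(1)[OF assms]]] .
  then have "(SOME es. edge_factorisation \<Lambda> v es) = []"
    using edge_factorisation_vertex[OF assms] by blast
  then show ?thesis
    by (simp add: restriction_def)
qed

end

section \<open>The product system of a self-similar action\<close>

locale self_similar_setting =
  self_similar_action \<Lambda> G \<pi> + self_similar_system \<Lambda> G \<pi> A i M tens
  for \<Lambda> :: "('l, 'k::finite) kgraph" and G :: "('g, 'l) groupoid"
    and \<pi> :: "'g \<Rightarrow> 'l \<times> 'l \<times> ('l \<Rightarrow> 'l)"
    and A :: "'m cstar" and i :: "'g \<Rightarrow> 'm" and M :: "('m, 'k) psystem"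
    and tens :: "nat ^ 'k \<Rightarrow> ('l \<Rightarrow> complex) \<Rightarrow> 'm \<Rightarrow> 'm" +
  assumes finite_graph: "finite_kgraph \<Lambda>"
    and groupoid_algebra: "groupoid_cstar G A i"
begin

lemma finite_paths [simp]: "finite (paths \<Lambda> p)"
  using finite_graph by (simp add: finite_kgraph_def)

sublocale A: cstar_algebra A
  using groupoid_algebra by (simp add: groupoid_cstar_def)

sublocale gen: groupoid_rep "vertices \<Lambda>" G A i
  using groupoid_algebra by unfold_locales (simp_all add: groupoid_cstar_def)

sublocale fib: correspondence A "pmod M p" for p
  by (rule fibre_correspondence)

lemma algebra_generated: "cstar_generated A (i ` carrier G) = carrier A"
  using groupoid_algebra by (simp add: groupoid_cstar_def)

text \<open>C*(G) is unital because there are finitely many vertices; this makes contractivity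
  applicable to \<psi>_0.\<close>

lemma algebra_identity: "is_identity A gen.unit_sum"
proof (rule gen.unit_sum_identity[OF algebra_generated])
  fix x assume "x \<in> i ` carrier G"
  then obtain g where g: "g \<in> carrier G" "x = i g"
    by blast
  show "\<exists>v\<in>vertices \<Lambda>. i (gunit G v) \<otimes>\<^bsub>A\<^esub> x = x"
    using g gen.rep_unit_left[of "gcod G g" g] cod_closed[of g] by (intro bexI[of _ "gcod G g"]) auto
  show "\<exists>v\<in>vertices \<Lambda>. x \<otimes>\<^bsub>A\<^esub> i (gunit G v) = x"
    using g gen.rep_unit_right[of "gdom G g" g] dom_closed[of g] by (intro bexI[of _ "gdom G g"]) auto
qed auto

lemma fibre_zero_simps [simp]:
  "carrier (pmod M 0) = carrier A" "\<zero>\<^bsub>pmod M 0\<^esub> = \<zero>\<^bsub>A\<^esub>"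
  "ract (pmod M 0) x a = x \<otimes>\<^bsub>A\<^esub> a" "inner_prod (pmod M 0) x y = star A x \<otimes>\<^bsub>A\<^esub> y"
  "lact (pmod M 0) a x = a \<otimes>\<^bsub>A\<^esub> x"
  by (simp_all add: fibre_zero std_bimodule_def)

section \<open>Vertex projections and elementary tensors\<close>

abbreviation vproj :: "'l \<Rightarrow> 'm" where
  "vproj v \<equiv> i (gunit G v)"

lemma vproj_in [simp, intro]: "v \<in> vertices \<Lambda> \<Longrightarrow> vproj v \<in> carrier A"
  using unit_closed by blast

lemma vproj_src_in [simp, intro]: "\<alpha> \<in> paths \<Lambda> p \<Longrightarrow> vproj (src \<Lambda> \<alpha>) \<in> carrier A"
  by (intro vproj_in src_vertex) (rule pathsD)

lemma vproj_idem: "v \<in> vertices \<Lambda> \<Longrightarrow> a \<in> carrier A \<Longrightarrow> vproj v \<otimes>\<^bsub>A\<^esub> (vproj v \<otimes>\<^bsub>A\<^esub> a) = vproj v \<otimes>\<^bsub>A\<^esub> a"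
  using A.mult_assoc[of "vproj v" "vproj v" a] by (simp add: gen.rep_units_orthogonal)

lemma point_mass_in: "\<alpha> \<in> paths \<Lambda> p \<Longrightarrow> point_mass \<alpha> \<in> carrier (path_module \<Lambda> p)"
  by (auto simp: path_module_def fun_algebra_def point_mass_def)

lemma vertex_hom_point_mass: "v \<in> vertices \<Lambda> \<Longrightarrow> vertex_hom \<Lambda> G A i (point_mass v) = vproj v"
proof -
  assume v: "v \<in> vertices \<Lambda>"
  have "vertex_hom \<Lambda> G A i (point_mass v) = (\<Oplus>\<^bsub>A\<^esub>w\<in>vertices \<Lambda>. if v = w then vproj w else \<zero>\<^bsub>A\<^esub>)"
    unfolding vertex_hom_def by (rule A.mod.M.finsum_cong') (auto simp: point_mass_def)
  also have "\<dots> = vproj v"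
    using v by (intro A.mod.M.finsum_singleton) auto
  finally show ?thesis .
qed

lemma vertex_hom_zero: "vertex_hom \<Lambda> G A i (\<lambda>v. 0) = \<zero>\<^bsub>A\<^esub>"
proof -
  have "vertex_hom \<Lambda> G A i (\<lambda>v. 0) = (\<Oplus>\<^bsub>A\<^esub>w\<in>vertices \<Lambda>. \<zero>\<^bsub>A\<^esub>)"
    unfolding vertex_hom_def by (rule A.mod.M.finsum_cong') auto
  then show ?thesis
    by simp
qed

lemma path_inner_prod_point_mass:
  assumes "\<alpha> \<in> paths \<Lambda> p" "\<beta> \<in> paths \<Lambda> p"
  shows "inner_prod (path_module \<Lambda> p) (point_mass \<alpha>) (point_mass \<beta>) =
    (if \<alpha> = \<beta> then point_mass (src \<Lambda> \<alpha>) else (\<lambda>v. 0))"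
proof -
  have "(\<Sum>\<gamma>\<in>{\<gamma> \<in> paths \<Lambda> p. src \<Lambda> \<gamma> = v}. cnj (point_mass \<alpha> \<gamma>) * point_mass \<beta> \<gamma>)
      = (\<Sum>\<gamma>\<in>{\<gamma> \<in> paths \<Lambda> p. src \<Lambda> \<gamma> = v}. if \<gamma> = \<alpha> then (if \<alpha> = \<beta> then 1 else 0) else 0)" for v
    by (rule sum.cong) (auto simp: point_mass_def)
  also have "\<dots> v = (if \<alpha> = \<beta> then point_mass (src \<Lambda> \<alpha>) v else 0)" for v
    using assms by (simp add: point_mass_def)
  finally show ?thesis
    by (auto simp: path_module_def path_inner_prod_def)
qed

lemma
  assumes "p \<noteq> 0"
  shows tens_linear_left: "a \<in> carrier A \<Longrightarrow> linear_on (path_module \<Lambda> p) (pmod M p) (\<lambda>x. tens p x a)"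
    and tens_linear_right: "x \<in> carrier (path_module \<Lambda> p) \<Longrightarrow> linear_on A (pmod M p) (tens p x)"
    and tens_balanced: "x \<in> carrier (path_module \<Lambda> p) \<Longrightarrow> c \<in> carrier (fun_algebra (vertices \<Lambda>))
      \<Longrightarrow> a \<in> carrier A \<Longrightarrow> tens p (ract (path_module \<Lambda> p) x c) a = tens p x (vertex_hom \<Lambda> G A i c \<otimes>\<^bsub>A\<^esub> a)"
    and tens_ract: "x \<in> carrier (path_module \<Lambda> p) \<Longrightarrow> a \<in> carrier A \<Longrightarrow> b \<in> carrier A
      \<Longrightarrow> ract (pmod M p) (tens p x a) b = tens p x (a \<otimes>\<^bsub>A\<^esub> b)"
    and tens_ip: "x \<in> carrier (path_module \<Lambda> p) \<Longrightarrow> y \<in> carrier (path_module \<Lambda> p)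
      \<Longrightarrow> a \<in> carrier A \<Longrightarrow> b \<in> carrier A
      \<Longrightarrow> inner_prod (pmod M p) (tens p x a) (tens p y b)
        = star A a \<otimes>\<^bsub>A\<^esub> vertex_hom \<Lambda> G A i (inner_prod (path_module \<Lambda> p) x y) \<otimes>\<^bsub>A\<^esub> b"
    and tens_span: "closed_span (pmod M p) {tens p x a |x a. x \<in> carrier (path_module \<Lambda> p) \<and> a \<in> carrier A}
        = fibre M p"
  using fibre_tensor[OF assms] unfolding interior_tensor_def by blast+

lemma tens_in: "p \<noteq> 0 \<Longrightarrow> x \<in> carrier (path_module \<Lambda> p) \<Longrightarrow> a \<in> carrier A \<Longrightarrow> tens p x a \<in> fibre M p"
  using tens_linear_right[of p x] by (auto simp: linear_on_def)

lemma tens_point_in [simp, intro]: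
  "p \<noteq> 0 \<Longrightarrow> \<alpha> \<in> paths \<Lambda> p \<Longrightarrow> a \<in> carrier A \<Longrightarrow> tens p (point_mass \<alpha>) a \<in> fibre M p"
  by (intro tens_in point_mass_in)

text \<open>Balancing over C(\<Lambda>^0): the point mass at \<alpha> is unchanged by the right
  action of the point mass at s(\<alpha>), which acts on A as the vertex projection.\<close>

lemma tens_point_absorb:
  assumes "p \<noteq> 0" "\<alpha> \<in> paths \<Lambda> p" "a \<in> carrier A"
  shows "tens p (point_mass \<alpha>) (vproj (src \<Lambda> \<alpha>) \<otimes>\<^bsub>A\<^esub> a) = tens p (point_mass \<alpha>) a"
proof -
  have v: "src \<Lambda> \<alpha> \<in> vertices \<Lambda>"
    using assms(2) by (intro src_vertex) (rule pathsD)
  then have "point_mass (src \<Lambda> \<alpha>) \<in> carrier (fun_algebra (vertices \<Lambda>))"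
    by (auto simp: fun_algebra_def point_mass_def)
  moreover have "ract (path_module \<Lambda> p) (point_mass \<alpha>) (point_mass (src \<Lambda> \<alpha>)) = point_mass \<alpha>"
    by (auto simp: path_module_def point_mass_def)
  ultimately show ?thesis
    using tens_balanced[OF assms(1) point_mass_in[OF assms(2)] _ assms(3), of "point_mass (src \<Lambda> \<alpha>)"] v
    by (simp add: vertex_hom_point_mass)
qed

text \<open>The generator \<open>\<delta>\<^sub>\<alpha> \<otimes> i\<^sub>s\<^sub>(\<^sub>\<alpha>\<^sub>)\<close> of \<open>M\<^sub>p\<close>; the case \<open>p = 0\<close>, where \<open>\<alpha>\<close> is a vertex, is set apart because
  \<open>M\<^sub>0\<close> is \<open>C\<^sup>*(G)\<close> itself and not a tensor product.\<close>

definition point :: "nat ^ 'k \<Rightarrow> 'l \<Rightarrow> 'm" where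
  "point p \<alpha> = (if p = 0 then vproj \<alpha> else tens p (point_mass \<alpha>) (vproj (src \<Lambda> \<alpha>)))"

lemma point_in [simp, intro]: "\<alpha> \<in> paths \<Lambda> p \<Longrightarrow> point p \<alpha> \<in> fibre M p"
  by (auto simp: point_def)

lemma point_ract:
  assumes "p \<noteq> 0" "\<alpha> \<in> paths \<Lambda> p" "a \<in> carrier A"
  shows "ract (pmod M p) (point p \<alpha>) a = tens p (point_mass \<alpha>) a"
  using assms tens_ract[OF assms(1) point_mass_in[OF assms(2)] vproj_src_in[OF assms(2)] assms(3)]
  by (simp add: point_def tens_point_absorb)

lemma point_tens_ip:
  assumes "p \<noteq> 0" "\<alpha> \<in> paths \<Lambda> p" "\<beta> \<in> paths \<Lambda> p" "a \<in> carrier A"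
  shows "inner_prod (pmod M p) (point p \<alpha>) (tens p (point_mass \<beta>) a)
    = (if \<alpha> = \<beta> then vproj (src \<Lambda> \<alpha>) \<otimes>\<^bsub>A\<^esub> a else \<zero>\<^bsub>A\<^esub>)"
proof -
  have v: "src \<Lambda> \<alpha> \<in> vertices \<Lambda>"
    using assms(2) by (intro src_vertex) (rule pathsD)
  show ?thesis
    using assms v
    by (cases "\<alpha> = \<beta>")
      (simp_all add: point_def tens_ip point_mass_in path_inner_prod_point_mass vertex_hom_point_mass
        vertex_hom_zero gen.rep_unit_star gen.rep_units_orthogonal)
qed

lemma point_ip:
  assumes "\<alpha> \<in> paths \<Lambda> p" "\<beta> \<in> paths \<Lambda> p"
  shows "inner_prod (pmod M p) (point p \<alpha>) (point p \<beta>) = (if \<alpha> = \<beta> then vproj (src \<Lambda> \<alpha>) else \<zero>\<^bsub>A\<^esub>)"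
proof (cases "p = 0")
  case True
  then show ?thesis
    using assms vertex_id by (simp add: point_def gen.rep_unit_star gen.rep_units_orthogonal)
next
  case False
  then show ?thesis
    using assms point_tens_ip[OF False assms vproj_src_in[OF assms(2)]] src_vertex pathsD(1)
    by (auto simp: point_def gen.rep_units_orthogonal)
qed

lemma point_ract_unit:
  assumes "\<alpha> \<in> paths \<Lambda> p"
  shows "ract (pmod M p) (point p \<alpha>) (vproj (src \<Lambda> \<alpha>)) = point p \<alpha>"
proof (cases "p = 0")
  case True
  then show ?thesis
    using assms vertex_id by (simp add: point_def gen.rep_units_orthogonal)
next
  case False
  then show ?thesis
    using point_ract[OF False assms vproj_src_in[OF assms]] by (simp add: point_def)
qed

lemma point_family: "S \<subseteq> paths \<Lambda> p \<Longrightarrow> point p \<in> S \<rightarrow> fibre M p"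
  by auto

text \<open>Testing against an arbitrary y turns the frame sum into a sum in A, of which only the
  term \<alpha> = \<beta> survives.\<close>

lemma frame_tens_point:
  assumes "p \<noteq> 0" "\<beta> \<in> paths \<Lambda> p" "a \<in> carrier A"
  shows "frame_sum (pmod M p) (point p) (paths \<Lambda> p) (tens p (point_mass \<beta>) a) = tens p (point_mass \<beta>) a"
proof (rule fib.ip_eqI)
  have z: "tens p (point_mass \<beta>) a \<in> fibre M p"
    using assms by blast
  show "tens p (point_mass \<beta>) a \<in> fibre M p"
    by (rule z)
  show "frame_sum (pmod M p) (point p) (paths \<Lambda> p) (tens p (point_mass \<beta>) a) \<in> fibre M p"
    by (rule fib.adjoint_pair_closed[OF fib.adjoint_pair_frame_sum[OF finite_paths point_family[OF order_refl]] z])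
  fix y assume y: "y \<in> fibre M p"
  let ?b = "inner_prod (pmod M p) y (point p \<beta>) \<otimes>\<^bsub>A\<^esub> (vproj (src \<Lambda> \<beta>) \<otimes>\<^bsub>A\<^esub> a)"
  have b: "?b \<in> carrier A"
    using y assms by blast
  have "inner_prod (pmod M p) y (frame_sum (pmod M p) (point p) (paths \<Lambda> p) (tens p (point_mass \<beta>) a))
      = (\<Oplus>\<^bsub>A\<^esub>\<alpha>\<in>paths \<Lambda> p. if \<beta> = \<alpha> then ?b else \<zero>\<^bsub>A\<^esub>)"
    unfolding fib.ip_frame_sum[OF finite_paths point_family[OF order_refl] z y]
    using assms y b by (intro A.mod.M.finsum_cong') (auto simp: point_tens_ip)
  also have "\<dots> = ?b"
    using assms b by (intro A.mod.M.finsum_singleton) auto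
  also have "\<dots> = inner_prod (pmod M p) y (ract (pmod M p) (point p \<beta>) (vproj (src \<Lambda> \<beta>) \<otimes>\<^bsub>A\<^esub> a))"
    using assms y by (intro fib.ip_ract[symmetric]) auto
  also have "\<dots> = inner_prod (pmod M p) y (tens p (point_mass \<beta>) a)"
    using assms vproj_src_in[OF assms(2)] by (simp add: point_ract tens_point_absorb)
  finally show "inner_prod (pmod M p) y (frame_sum (pmod M p) (point p) (paths \<Lambda> p) (tens p (point_mass \<beta>) a))
      = inner_prod (pmod M p) y (tens p (point_mass \<beta>) a)" .
qed

text \<open>Point masses span the functions on the finite set of paths of degree p; the induction
  runs over a finite set that contains the support of x.\<close>

lemma tens_in_subspace:
  assumes p: "p \<noteq> 0" and C: "closed_subspace (pmod M p) C" and a: "a \<in> carrier A"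
    and pts: "\<And>\<beta>. \<beta> \<in> paths \<Lambda> p \<Longrightarrow> tens p (point_mass \<beta>) a \<in> C"
    and x: "x \<in> carrier (path_module \<Lambda> p)"
  shows "tens p x a \<in> C"
proof -
  have lin: "linear_on (path_module \<Lambda> p) (pmod M p) (\<lambda>x. tens p x a)"
    by (rule tens_linear_left[OF p a])
  have smult_pm: "c \<odot>\<^bsub>path_module \<Lambda> p\<^esub> f = (\<lambda>\<alpha>. c * f \<alpha>)" and add_pm: "f \<oplus>\<^bsub>path_module \<Lambda> p\<^esub> h = (\<lambda>\<alpha>. f \<alpha> + h \<alpha>)"
    and carrier_pm: "carrier (path_module \<Lambda> p) = {f. \<forall>\<alpha>. \<alpha> \<notin> paths \<Lambda> p \<longrightarrow> f \<alpha> = 0}" for c f h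
    by (simp_all add: path_module_def fun_algebra_def)
  have "finite S \<Longrightarrow> S \<subseteq> paths \<Lambda> p \<Longrightarrow> \<forall>\<alpha>. \<alpha> \<notin> S \<longrightarrow> f \<alpha> = 0 \<Longrightarrow> tens p f a \<in> C" for S f
  proof (induction S arbitrary: f rule: finite_induct)
    case empty
    then have "f = 0 \<odot>\<^bsub>path_module \<Lambda> p\<^esub> (\<lambda>\<alpha>. 0)" "(\<lambda>\<alpha>. 0) \<in> carrier (path_module \<Lambda> p)"
      by (auto simp: smult_pm carrier_pm)
    then have "tens p f a = 0 \<odot>\<^bsub>pmod M p\<^esub> tens p (\<lambda>\<alpha>. 0) a" "tens p (\<lambda>\<alpha>. 0) a \<in> fibre M p"
      using lin tens_in[OF p _ a] unfolding linear_on_def by blast+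
    then have "tens p f a = \<zero>\<^bsub>pmod M p\<^esub>"
      by simp
    then show ?case
      using C by (simp add: closed_subspace_def)
  next
    case (insert \<beta> S)
    let ?h = "f(\<beta> := 0)"
    have in_pm: "?h \<in> carrier (path_module \<Lambda> p)" "point_mass \<beta> \<in> carrier (path_module \<Lambda> p)"
      "f \<beta> \<odot>\<^bsub>path_module \<Lambda> p\<^esub> point_mass \<beta> \<in> carrier (path_module \<Lambda> p)"
      using insert.prems by (auto simp: carrier_pm smult_pm point_mass_def)
    have "f = f \<beta> \<odot>\<^bsub>path_module \<Lambda> p\<^esub> point_mass \<beta> \<oplus>\<^bsub>path_module \<Lambda> p\<^esub> ?h"
      by (auto simp: smult_pm add_pm point_mass_def)
    then have "tens p f a = f \<beta> \<odot>\<^bsub>pmod M p\<^esub> tens p (point_mass \<beta>) a \<oplus>\<^bsub>pmod M p\<^esub> tens p ?h a"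
      using lin in_pm unfolding linear_on_def by metis
    moreover have "tens p ?h a \<in> C"
      using insert by (intro insert.IH) auto
    moreover have "tens p (point_mass \<beta>) a \<in> C"
      using insert.prems by (intro pts) auto
    ultimately show ?case
      using C unfolding closed_subspace_def by simp
  qed
  from this[of "paths \<Lambda> p" x] x show ?thesis
    by (simp add: carrier_pm)
qed

text \<open>For p = 0 this says that the vertex projections add up to the identity of A. Otherwise
  the fixed vectors form a closed subspace, because the frame sum and the identity have adjoints,
  and that subspace contains all elementary tensors.\<close>

lemma frame_point:
  assumes z: "z \<in> fibre M p"
  shows "frame_sum (pmod M p) (point p) (paths \<Lambda> p) z = z"
proof (cases "p = 0")
  case True
  have z: "z \<in> carrier A"
    using z True by simp
  have adj: "adjoint_pair (pmod M 0) (frame_sum (pmod M 0) (point 0) (vertices \<Lambda>))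
      (frame_sum (pmod M 0) (point 0) (vertices \<Lambda>))"
    by (rule fib.adjoint_pair_frame_sum[OF finite_paths point_family[OF order_refl]])
  have "frame_sum (pmod M 0) (point 0) (vertices \<Lambda>) z = z"
  proof (rule fib.ip_eqI)
    show "frame_sum (pmod M 0) (point 0) (vertices \<Lambda>) z \<in> fibre M 0" "z \<in> fibre M 0"
      using fib.adjoint_pair_closed[OF adj] z by simp_all
    fix y assume "y \<in> fibre M 0"
    then have y: "y \<in> carrier A"
      by simp
    have "inner_prod (pmod M 0) y (frame_sum (pmod M 0) (point 0) (vertices \<Lambda>) z)
        = (\<Oplus>\<^bsub>A\<^esub>v\<in>vertices \<Lambda>. star A y \<otimes>\<^bsub>A\<^esub> (vproj v \<otimes>\<^bsub>A\<^esub> z))"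
      unfolding fib.ip_frame_sum[OF finite_paths point_family[OF order_refl] \<open>z \<in> fibre M 0\<close> \<open>y \<in> fibre M 0\<close>]
      using y z
      by (intro A.mod.M.finsum_cong') (auto simp: point_def A.mult_assoc gen.rep_unit_star vproj_idem)
    also have "\<dots> = star A y \<otimes>\<^bsub>A\<^esub> (\<Oplus>\<^bsub>A\<^esub>v\<in>vertices \<Lambda>. vproj v \<otimes>\<^bsub>A\<^esub> z)"
      using y z by (intro A.mult_finsum_right[symmetric]) auto
    also have "(\<Oplus>\<^bsub>A\<^esub>v\<in>vertices \<Lambda>. vproj v \<otimes>\<^bsub>A\<^esub> z) = gen.unit_sum \<otimes>\<^bsub>A\<^esub> z"
      unfolding gen.unit_sum_def using z by (intro A.mult_finsum_left[symmetric]) auto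
    also have "\<dots> = z"
      using algebra_identity z by (simp add: is_identity_def)
    finally show "inner_prod (pmod M 0) y (frame_sum (pmod M 0) (point 0) (vertices \<Lambda>) z)
        = inner_prod (pmod M 0) y z"
      by simp
  qed
  then show ?thesis
    using True by simp
next
  case False
  let ?F = "frame_sum (pmod M p) (point p) (paths \<Lambda> p)"
  have "closed_subspace (pmod M p) {z \<in> fibre M p. ?F z = (\<lambda>z\<in>fibre M p. z) z}"
    by (rule fib.closed_subspace_adjoint_equaliser[OF
      fib.adjoint_pair_frame_sum[OF finite_paths point_family[OF order_refl]] fib.adjoint_pair_id])
  moreover have "{z \<in> fibre M p. ?F z = (\<lambda>z\<in>fibre M p. z) z} = {z \<in> fibre M p. ?F z = z}"
    by auto
  ultimately have C: "closed_subspace (pmod M p) {z \<in> fibre M p. ?F z = z}"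
    by simp
  have "tens p x a \<in> {z \<in> fibre M p. ?F z = z}" if "x \<in> carrier (path_module \<Lambda> p)" "a \<in> carrier A" for x a
  proof (rule tens_in_subspace[OF False C that(2) _ that(1)])
    fix \<beta> assume \<beta>: "\<beta> \<in> paths \<Lambda> p"
    show "tens p (point_mass \<beta>) a \<in> {z \<in> fibre M p. ?F z = z}"
      using frame_tens_point[OF False \<beta> that(2)] tens_point_in[OF False \<beta> that(2)] by simp
  qed
  moreover have "z \<in> closed_span (pmod M p) {tens p x a |x a. x \<in> carrier (path_module \<Lambda> p) \<and> a \<in> carrier A}"
    using z tens_span[OF False] by simp
  ultimately show ?thesis
    using fib.E.closed_span_induct[OF _ C, of z] by blast
qed

section \<open>Left action and products of the frame vectors\<close>

lemma lact_adjoint: "a \<in> carrier A \<Longrightarrow> \<exists>R. adjoint_pair (pmod M p) (\<lambda>x\<in>fibre M p. lact (pmod M p) a x) R"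
  using fib.left_action[of p] by (auto simp: star_hom_def linear_on_def adjointables_simps)

lemma lact_closed [simp, intro]:
  "a \<in> carrier A \<Longrightarrow> x \<in> fibre M p \<Longrightarrow> lact (pmod M p) a x \<in> fibre M p"
  using lact_adjoint[of a p] fib.adjoint_pair_closed[of p _ _ x] by fastforce

text \<open>One formula serves all degrees. For p = 0 and v = dom(g) it reads i_g i_v = i_w i_g with
  w = cod(g), the restriction of g to a vertex being g itself.\<close>

lemma lact_point:
  assumes g: "g \<in> carrier G" and \<alpha>: "\<alpha> \<in> paths \<Lambda> p"
  shows "lact (pmod M p) (i g) (point p \<alpha>) =
    (if gdom G g = rng \<Lambda> \<alpha> then ract (pmod M p) (point p (act \<pi> g \<alpha>)) (i (restriction \<Lambda> G \<pi> g \<alpha>))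
     else \<zero>\<^bsub>pmod M p\<^esub>)"
proof (cases "p = 0")
  case True
  then have v: "\<alpha> \<in> vertices \<Lambda>"
    using \<alpha> by simp
  have "vproj (gcod G g) \<otimes>\<^bsub>A\<^esub> i g = i g"
    using g cod_closed by (simp add: gen.rep_unit_left)
  then show ?thesis
    using True v g vertex_id[OF v] act_vertex[OF g]
    by (auto simp: point_def gen.rep_unit_right restriction_vertex)
next
  case False
  have c: "\<alpha> \<in> carrier \<Lambda>"
    using \<alpha> by (rule pathsD)
  have f: "lact (pmod M p) (i g) (point p \<alpha>) =
      (if rng \<Lambda> \<alpha> = gdom G g
       then tens p (point_mass (act \<pi> g \<alpha>)) (i (restriction \<Lambda> G \<pi> g \<alpha>) \<otimes>\<^bsub>A\<^esub> vproj (src \<Lambda> \<alpha>))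
       else \<zero>\<^bsub>pmod M p\<^esub>)"
    using left_action_formula[OF False g \<alpha> vproj_src_in[OF \<alpha>]] False by (simp add: point_def)
  show ?thesis
  proof (cases "gdom G g = rng \<Lambda> \<alpha>")
    case True
    note r = restriction_closed[OF g c True[symmetric]]
    have "i (restriction \<Lambda> G \<pi> g \<alpha>) \<otimes>\<^bsub>A\<^esub> vproj (src \<Lambda> \<alpha>) = i (restriction \<Lambda> G \<pi> g \<alpha>)"
      using r src_vertex[OF c] by (simp add: gen.rep_unit_right)
    moreover have "ract (pmod M p) (point p (act \<pi> g \<alpha>)) (i (restriction \<Lambda> G \<pi> g \<alpha>))
        = tens p (point_mass (act \<pi> g \<alpha>)) (i (restriction \<Lambda> G \<pi> g \<alpha>))"
      using r act_path[OF g \<alpha> True[symmetric]] by (intro point_ract[OF False]) auto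
    ultimately show ?thesis
      using f True by simp
  qed (use f in auto)
qed

text \<open>The frame vector absorbs the projection at its source, which is orthogonal to those at
  the other vertices.\<close>

lemma ract_point_vproj:
  assumes \<alpha>: "\<alpha> \<in> paths \<Lambda> p" and v: "v \<in> vertices \<Lambda>"
  shows "ract (pmod M p) (point p \<alpha>) (vproj v) = (if src \<Lambda> \<alpha> = v then point p \<alpha> else \<zero>\<^bsub>pmod M p\<^esub>)"
proof -
  have s: "src \<Lambda> \<alpha> \<in> vertices \<Lambda>"
    using pathsD(1)[OF \<alpha>] by (rule src_vertex)
  show ?thesis
  proof (cases "src \<Lambda> \<alpha> = v")
    case False
    have "ract (pmod M p) (point p \<alpha>) (vproj v) = ract (pmod M p) (point p \<alpha>) (vproj (src \<Lambda> \<alpha>) \<otimes>\<^bsub>A\<^esub> vproj v)"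
      using fib.ract_ract[OF point_in[OF \<alpha>] vproj_in[OF s] vproj_in[OF v]] point_ract_unit[OF \<alpha>] by simp
    also have "\<dots> = ract (pmod M p) (point p \<alpha>) \<zero>\<^bsub>A\<^esub>"
      using gen.rep_units_orthogonal[OF s v] False by simp
    also have "\<dots> = \<zero>\<^bsub>pmod M p\<^esub>"
      using fib.ract_smult_right[OF point_in[OF \<alpha>], of "\<zero>\<^bsub>A\<^esub>" 0] \<alpha> by simp
    finally show ?thesis
      using False by simp
  qed (use point_ract_unit[OF \<alpha>] in simp)
qed

text \<open>If p or q is 0, the product is a module action of a vertex projection. Otherwise the
  multiplication formula applies with unit elements of G, which act trivially and restrict to
  units.\<close>

lemma point_mult:
  assumes \<alpha>: "\<alpha> \<in> paths \<Lambda> p" and \<mu>: "\<mu> \<in> paths \<Lambda> q"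
  shows "pmul M p q (point p \<alpha>) (point q \<mu>)
    = (if src \<Lambda> \<alpha> = rng \<Lambda> \<mu> then point (p + q) (kcomp \<Lambda> \<alpha> \<mu>) else \<zero>\<^bsub>pmod M (p + q)\<^esub>)"
proof -
  have c: "\<alpha> \<in> carrier \<Lambda>" "\<mu> \<in> carrier \<Lambda>"
    using \<alpha> \<mu> by (auto dest: pathsD)
  have s: "src \<Lambda> \<alpha> \<in> vertices \<Lambda>" "src \<Lambda> \<mu> \<in> vertices \<Lambda>" "rng \<Lambda> \<mu> \<in> vertices \<Lambda>"
    using c by (auto intro: src_vertex rng_vertex)
  have \<mu>_to: "\<mu> \<in> paths_to \<Lambda> (rng \<Lambda> \<mu>)"
    using c by (simp add: paths_to_def)
  consider (left) "p = 0" | (right) "p \<noteq> 0" "q = 0" | (both) "p \<noteq> 0" "q \<noteq> 0"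
    by blast
  then show ?thesis
  proof cases
    case left
    then have v: "\<alpha> \<in> vertices \<Lambda>" "src \<Lambda> \<alpha> = \<alpha>"
      using \<alpha> vertex_id by auto
    have "point p \<alpha> = vproj \<alpha>"
      using left by (simp add: point_def)
    then have "pmul M p q (point p \<alpha>) (point q \<mu>) = lact (pmod M q) (vproj \<alpha>) (point q \<mu>)"
      using left mul_zero_left[OF vproj_in[OF v(1)] point_in[OF \<mu>]] by simp
    also have "\<dots> = (if src \<Lambda> \<alpha> = rng \<Lambda> \<mu> then point q \<mu> else \<zero>\<^bsub>pmod M q\<^esub>)"
      using lact_point[OF unit_closed[OF v(1)] \<mu>] v s restriction_unit[OF c(2)] act_unit[OF s(3) \<mu>_to]
        point_ract_unit[OF \<mu>] by (auto simp: dom_unit)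
    finally show ?thesis
      using left v rng_id[OF c(2)] by auto
  next
    case right
    then have v: "\<mu> \<in> vertices \<Lambda>" "rng \<Lambda> \<mu> = \<mu>"
      using \<mu> vertex_id by auto
    have "point q \<mu> = vproj \<mu>"
      using right by (simp add: point_def)
    then have "pmul M p q (point p \<alpha>) (point q \<mu>) = ract (pmod M p) (point p \<alpha>) (vproj \<mu>)"
      using right mul_zero_right[OF point_in[OF \<alpha>] vproj_in[OF v(1)]] by simp
    then show ?thesis
      using ract_point_vproj[OF \<alpha> v(1)] right v src_id[OF c(1)] by auto
  next
    case both
    \<comment> \<open>Hence \<open>point (p + q)\<close> is an elementary tensor, in agreement with
      the multiplication formula.\<close>
    have pq: "p + q \<noteq> 0"
      using both(1) by (auto simp: vec_eq_iff)
    have "pmul M p q (point p \<alpha>) (point q \<mu>) = (if rng \<Lambda> \<mu> = gdom G (gunit G (src \<Lambda> \<alpha>))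
       then tens (p + q) (point_mass (kcomp \<Lambda> \<alpha> (act \<pi> (gunit G (src \<Lambda> \<alpha>)) \<mu>)))
              (i (gcomp G (restriction \<Lambda> G \<pi> (gunit G (src \<Lambda> \<alpha>)) \<mu>) (gunit G (src \<Lambda> \<mu>))))
       else \<zero>\<^bsub>pmod M (p + q)\<^esub>)"
      using multiplication_formula[OF both \<alpha> \<mu> unit_closed[OF s(1)] unit_closed[OF s(2)]] both s
      by (simp add: point_def cod_unit)
    also have "\<dots> = (if src \<Lambda> \<alpha> = rng \<Lambda> \<mu> then point (p + q) (kcomp \<Lambda> \<alpha> \<mu>) else \<zero>\<^bsub>pmod M (p + q)\<^esub>)"
      using pq s restriction_unit[OF c(2)] act_unit[OF s(3) \<mu>_to] src_comp[OF c]
        unit_left[OF unit_closed[OF s(2)]]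
      by (auto simp: point_def dom_unit cod_unit)
    finally show ?thesis .
  qed
qed

section \<open>Operators extended along the multiplication\<close>

lemma mult_in: "x \<in> fibre M p \<Longrightarrow> y \<in> fibre M q \<Longrightarrow> pmul M p q x y \<in> fibre M (p + q)"
  using mul_linear_right[of x p q] by (auto simp: linear_on_def)

text \<open>Multiplication is A-balanced: this is associativity with the middle factor in M_0 =
  A.\<close>

lemma mult_ract_left:
  assumes "x \<in> fibre M p" "a \<in> carrier A" "y \<in> fibre M q"
  shows "pmul M p q (ract (pmod M p) x a) y = pmul M p q x (lact (pmod M q) a y)"
  using mul_assoc[of x p a 0 y q] mul_zero_left[of a y q] mul_zero_right[of x p a] assms by simp

lemma mult_ract_right:
  assumes "x \<in> fibre M p" "y \<in> fibre M q" "a \<in> carrier A"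
  shows "pmul M p q x (ract (pmod M q) y a) = ract (pmod M (p + q)) (pmul M p q x y) a"
proof -
  have "pmul M p q x y \<in> fibre M (p + q)"
    using assms(1,2) by (rule mult_in)
  then show ?thesis
    using mul_assoc[of x p y q a 0] mul_zero_right[of y q a] mul_zero_right[of "pmul M p q x y" "p + q" a] assms
    by simp
qed

lemma finite_extensions: "\<alpha> \<in> paths \<Lambda> p \<Longrightarrow> finite (extensions \<alpha> q)"
  using finite_subset[OF extensions_subset] finite_paths by blast

text \<open>The right side is x_\<alpha> z with z = \<langle>x_\<alpha>, x\<rangle>y. Expand z in
  the frame of M_q: x_\<alpha> x_\<eta> is the frame vector of \<alpha>\<eta> when the paths compose
  and zero otherwise, and the coefficient \<langle>x_\<eta>, z\<rangle> equals \<langle>x_\<alpha>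
  x_\<eta>, xy\<rangle>.\<close>

lemma frame_sum_extensions:
  assumes \<alpha>: "\<alpha> \<in> paths \<Lambda> p" and x: "x \<in> fibre M p" and y: "y \<in> fibre M q"
  shows "frame_sum (pmod M (p + q)) (point (p + q)) (extensions \<alpha> q) (pmul M p q x y)
    = pmul M p q (Theta (pmod M p) (point p \<alpha>) (point p \<alpha>) x) y"
proof -
  let ?E = "pmod M (p + q)" and ?a = "inner_prod (pmod M p) (point p \<alpha>) x"
  let ?z = "lact (pmod M q) ?a y"
  let ?S = "paths_to \<Lambda> (src \<Lambda> \<alpha>) \<inter> paths \<Lambda> q"
  let ?f = "\<lambda>\<eta>. ract (pmod M q) (point q \<eta>) (inner_prod (pmod M q) (point q \<eta>) ?z)"
  have c: "\<alpha> \<in> carrier \<Lambda>"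
    using \<alpha> by (rule pathsD)
  have lin: "linear_on (pmod M q) ?E (pmul M p q (point p \<alpha>))"
    using mul_linear_right[OF point_in[OF \<alpha>]] .
  have z: "?z \<in> fibre M q"
    using \<alpha> x y by blast
  have xy: "pmul M p q x y \<in> fibre M (p + q)"
    using x y by (rule mult_in)
  have comp: "kcomp \<Lambda> \<alpha> \<eta> \<in> paths \<Lambda> (p + q)"
    "point (p + q) (kcomp \<Lambda> \<alpha> \<eta>) = pmul M p q (point p \<alpha>) (point q \<eta>)" if "\<eta> \<in> ?S" for \<eta>
    using that \<alpha> comp_paths[of \<alpha> p \<eta> q] point_mult[OF \<alpha>, of \<eta> q] by (auto simp: paths_to_def)
  have f_term: "pmul M p q (point p \<alpha>) (?f \<eta>) = (if \<eta> \<in> ?S then ract ?E (point (p + q) (kcomp \<Lambda> \<alpha> \<eta>))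
      (inner_prod ?E (point (p + q) (kcomp \<Lambda> \<alpha> \<eta>)) (pmul M p q x y)) else \<zero>\<^bsub>?E\<^esub>)"
    if \<eta>: "\<eta> \<in> paths \<Lambda> q" for \<eta>
  proof -
    have "pmul M p q (point p \<alpha>) (?f \<eta>)
        = ract ?E (pmul M p q (point p \<alpha>) (point q \<eta>)) (inner_prod (pmod M q) (point q \<eta>) ?z)"
      using \<alpha> \<eta> z by (intro mult_ract_right) auto
    moreover have "inner_prod (pmod M q) (point q \<eta>) ?z
        = inner_prod ?E (pmul M p q (point p \<alpha>) (point q \<eta>)) (pmul M p q x y)"
      using \<alpha> \<eta> x y by (intro mul_inner_prod[symmetric]) auto
    moreover have "ract ?E \<zero>\<^bsub>?E\<^esub> (inner_prod (pmod M q) (point q \<eta>) ?z) = \<zero>\<^bsub>?E\<^esub>"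
      using \<eta> z by (intro fib.EE.linear_zero[OF fib.ract_linear]) auto
    ultimately show ?thesis
      using comp(2)[of \<eta>] point_mult[OF \<alpha> \<eta>] pathsD(1)[OF \<eta>] \<eta> by (auto simp: paths_to_def)
  qed
  have in_E: "ract ?E (point (p + q) (kcomp \<Lambda> \<alpha> \<eta>))
      (inner_prod ?E (point (p + q) (kcomp \<Lambda> \<alpha> \<eta>)) (pmul M p q x y)) \<in> carrier ?E" if "\<eta> \<in> ?S" for \<eta>
    using comp(1)[OF that] xy by blast
  have "pmul M p q (Theta (pmod M p) (point p \<alpha>) (point p \<alpha>) x) y = pmul M p q (point p \<alpha>) ?z"
    using \<alpha> x y by (simp add: Theta_def mult_ract_left)
  also have "\<dots> = pmul M p q (point p \<alpha>) (\<Oplus>\<^bsub>pmod M q\<^esub>\<eta>\<in>paths \<Lambda> q. ?f \<eta>)"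
    using frame_point[OF z] z by (simp add: frame_sum_def)
  also have "\<dots> = (\<Oplus>\<^bsub>?E\<^esub>\<eta>\<in>paths \<Lambda> q. pmul M p q (point p \<alpha>) (?f \<eta>))"
  proof -
    interpret EE: banach_pair "pmod M q" ?E ..
    show ?thesis
      using z by (intro EE.linear_finsum[OF lin finite_paths]) auto
  qed
  also have "\<dots> = (\<Oplus>\<^bsub>?E\<^esub>\<eta>\<in>paths \<Lambda> q. if \<eta> \<in> ?S then ract ?E (point (p + q) (kcomp \<Lambda> \<alpha> \<eta>))
      (inner_prod ?E (point (p + q) (kcomp \<Lambda> \<alpha> \<eta>)) (pmul M p q x y)) else \<zero>\<^bsub>?E\<^esub>)"
    using f_term in_E by (intro fib.E.mod.M.finsum_cong') auto
  also have "\<dots> = (\<Oplus>\<^bsub>?E\<^esub>\<eta>\<in>?S. ract ?E (point (p + q) (kcomp \<Lambda> \<alpha> \<eta>))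
      (inner_prod ?E (point (p + q) (kcomp \<Lambda> \<alpha> \<eta>)) (pmul M p q x y)))"
    using in_E by (intro fib.E.mod.M.add.finprod_mono_neutral_cong_right) auto
  also have "\<dots> = (\<Oplus>\<^bsub>?E\<^esub>\<gamma>\<in>extensions \<alpha> q. ract ?E (point (p + q) \<gamma>)
      (inner_prod ?E (point (p + q) \<gamma>) (pmul M p q x y)))"
    unfolding extensions_def using in_E inj_on_subset[OF inj_on_comp[OF c]]
    by (intro fib.E.mod.M.finsum_reindex[symmetric]) auto
  finally show ?thesis
    using xy by (simp add: frame_sum_def)
qed

text \<open>The frame sum satisfies the description in \<open>extend_op\<close>; any other solution
  is adjointable and agrees with it on products, which are total in the fibre.\<close>

lemma extend_op_Theta:
  assumes \<alpha>: "\<alpha> \<in> paths \<Lambda> p"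
  shows "extend_op M p (p + q) (Theta (pmod M p) (point p \<alpha>) (point p \<alpha>))
    = frame_sum (pmod M (p + q)) (point (p + q)) (extensions \<alpha> q)"
proof -
  let ?E = "pmod M (p + q)" and ?F = "frame_sum (pmod M (p + q)) (point (p + q)) (extensions \<alpha> q)"
  have adj: "adjoint_pair ?E ?F ?F"
    by (rule fib.adjoint_pair_frame_sum[OF finite_extensions[OF \<alpha>] point_family[OF extensions_subset[OF \<alpha>]]])
  show ?thesis
    unfolding extend_op_def add_diff_cancel_left'
  proof (rule the_equality)
    show "?F \<in> carrier (adjointables ?E) \<and> (\<forall>x\<in>fibre M p. \<forall>y\<in>fibre M q.
        ?F (pmul M p q x y) = pmul M p q (Theta (pmod M p) (point p \<alpha>) (point p \<alpha>) x) y)"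
      using adj frame_sum_extensions[OF \<alpha>] by (auto simp: adjointables_simps)
  next
    fix R assume R: "R \<in> carrier (adjointables ?E) \<and> (\<forall>x\<in>fibre M p. \<forall>y\<in>fibre M q.
        R (pmul M p q x y) = pmul M p q (Theta (pmod M p) (point p \<alpha>) (point p \<alpha>) x) y)"
    then obtain R' where R': "adjoint_pair ?E R R'"
      by (auto simp: adjointables_simps)
    have C: "closed_subspace ?E {z \<in> carrier ?E. R z = ?F z}"
      by (rule fib.closed_subspace_adjoint_equaliser[OF R' adj])
    have "R z = ?F z" if "z \<in> carrier ?E" for z
    proof -
      have "z \<in> closed_span ?E {pmul M p q x y |x y. x \<in> fibre M p \<and> y \<in> fibre M q}"
        using that mul_dense by simp
      then show ?thesis
      proof (rule fib.E.closed_span_induct[OF _ C])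
        fix w assume "w \<in> {pmul M p q x y |x y. x \<in> fibre M p \<and> y \<in> fibre M q}"
        then obtain x y where w: "w = pmul M p q x y" "x \<in> fibre M p" "y \<in> fibre M q"
          by blast
        then have "w \<in> carrier ?E"
          using mult_in by simp
        then show "w \<in> carrier ?E \<and> R w = ?F w"
          using R w frame_sum_extensions[OF \<alpha> w(2,3)] by simp
      qed
    qed
    moreover have "R \<in> extensional (carrier ?E)" "?F \<in> extensional (carrier ?E)"
      using R' adj by (auto simp: adjoint_pair_def PiE_def)
    ultimately show "R = ?F"
      by (metis extensionalityI)
  qed
qed

end

section \<open>The Nica--Toeplitz algebra of a self-similar action\<close>

text \<open>\<open>t_eq\<close> joins the two clauses that define t, for vertices and for nonzero
  degree, by means of \<open>point\<close>.\<close>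

locale nica_toeplitz_setting = self_similar_setting \<Lambda> G \<pi> A i M tens
  for \<Lambda> :: "('l, 'k::finite) kgraph" and G :: "('g, 'l) groupoid"
    and \<pi> :: "'g \<Rightarrow> 'l \<times> 'l \<times> ('l \<Rightarrow> 'l)"
    and A :: "'m cstar" and i :: "'g \<Rightarrow> 'm" and M :: "('m, 'k) psystem"
    and tens :: "nat ^ 'k \<Rightarrow> ('l \<Rightarrow> complex) \<Rightarrow> 'm \<Rightarrow> 'm" +
  fixes NT :: "'b cstar" and \<psi> :: "nat ^ 'k \<Rightarrow> 'm \<Rightarrow> 'b" and u :: "'g \<Rightarrow> 'b" and t :: "'l \<Rightarrow> 'b"
  assumes nica_toeplitz: "nica_toeplitz_algebra A M NT \<psi>"
    and u_eq: "g \<in> carrier G \<Longrightarrow> u g = \<psi> 0 (i g)"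
    and t_eq: "\<alpha> \<in> paths \<Lambda> p \<Longrightarrow> t \<alpha> = \<psi> p (point p \<alpha>)"
begin

section \<open>The representation and its generators\<close>

lemma toeplitz: "toeplitz_rep A M NT \<psi>"
  using nica_toeplitz by (simp add: nica_toeplitz_algebra_def nica_covariant_def)

sublocale T: cstar_algebra NT
  using nica_toeplitz by (simp add: nica_toeplitz_algebra_def)

sublocale hom: cstar_hom A NT "\<psi> 0"
  using toeplitz by unfold_locales (simp add: toeplitz_rep_def)

sublocale rep: banach_pair "pmod M p" NT for p ..

lemma rep_linear: "linear_on (pmod M p) NT (\<psi> p)"
  and rep_ip: "x \<in> fibre M p \<Longrightarrow> y \<in> fibre M p \<Longrightarrow>
    star NT (\<psi> p x) \<otimes>\<^bsub>NT\<^esub> \<psi> p y = \<psi> 0 (inner_prod (pmod M p) x y)"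
  and rep_mult: "x \<in> fibre M p \<Longrightarrow> y \<in> fibre M q \<Longrightarrow> \<psi> (p + q) (pmul M p q x y) = \<psi> p x \<otimes>\<^bsub>NT\<^esub> \<psi> q y"
  using toeplitz unfolding toeplitz_rep_def by blast+

lemmas rep_in [simp, intro] = rep.linear_closed[OF rep_linear]
  and rep_zero [simp] = rep.linear_zero[OF rep_linear]

lemma rep_ract: "x \<in> fibre M p \<Longrightarrow> a \<in> carrier A \<Longrightarrow> \<psi> p (ract (pmod M p) x a) = \<psi> p x \<otimes>\<^bsub>NT\<^esub> \<psi> 0 a"
  using rep_mult[of x p a 0] mul_zero_right[of x p a] by simp

lemma rep_lact: "a \<in> carrier A \<Longrightarrow> x \<in> fibre M p \<Longrightarrow> \<psi> p (lact (pmod M p) a x) = \<psi> 0 a \<otimes>\<^bsub>NT\<^esub> \<psi> p x"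
  using rep_mult[of a 0 x p] mul_zero_left[of a x p] by simp

lemma in_own_degree: "\<alpha> \<in> carrier \<Lambda> \<Longrightarrow> \<alpha> \<in> paths \<Lambda> (deg \<Lambda> \<alpha>)"
  by (simp add: paths_def)

lemma t_in [simp, intro]: "\<alpha> \<in> carrier \<Lambda> \<Longrightarrow> t \<alpha> \<in> carrier NT"
  using rep_in[OF point_in[OF in_own_degree]] t_eq[OF in_own_degree] by simp

lemma t_path_in: "\<alpha> \<in> paths \<Lambda> p \<Longrightarrow> t \<alpha> \<in> carrier NT"
  using t_in pathsD(1) by blast

lemma u_unit: "v \<in> vertices \<Lambda> \<Longrightarrow> u (gunit G v) = t v"
  using t_eq[of v 0] u_eq[OF unit_closed] by (simp add: point_def)

lemma rep_vproj: "v \<in> vertices \<Lambda> \<Longrightarrow> \<psi> 0 (vproj v) = t v"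
  using u_unit u_eq[OF unit_closed] by simp

lemma unitary_rep_u: "unitary_rep G NT u"
proof -
  have "cstar_hom A NT (\<psi> 0)" "unitary_rep G A i"
    using hom.cstar_hom_axioms groupoid_algebra by (simp_all add: groupoid_cstar_def)
  then have "unitary_rep G NT (\<lambda>g. \<psi> 0 (i g))"
    by (rule unitary_rep_image)
  \<comment> \<open>u is prescribed on the carrier of G alone, which contains all units, inverses
    and composites that occur in the clauses.\<close>
  moreover have "unitary_rep G NT u \<longleftrightarrow> unitary_rep G NT (\<lambda>g. \<psi> 0 (i g))"
  proof -
    have "v \<in> carrier G" if "v \<in> gunits G" for v
      using that by (simp add: gunits_def)
    then show ?thesis
      unfolding unitary_rep_def orthogonal_projections_def
      using u_eq ginv_closed comp_closed by simp
  qed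
  ultimately show ?thesis
    by blast
qed

sublocale urep: groupoid_rep "vertices \<Lambda>" G NT u
  using unitary_rep_u by unfold_locales simp_all

section \<open>Relations between the generators\<close>

lemma t_mult:
  assumes "\<alpha> \<in> carrier \<Lambda>" "\<mu> \<in> carrier \<Lambda>"
  shows "t \<alpha> \<otimes>\<^bsub>NT\<^esub> t \<mu> = (if src \<Lambda> \<alpha> = rng \<Lambda> \<mu> then t (kcomp \<Lambda> \<alpha> \<mu>) else \<zero>\<^bsub>NT\<^esub>)"
proof -
  note p = in_own_degree[OF assms(1)] in_own_degree[OF assms(2)]
  show ?thesis
    using rep_mult[OF point_in[OF p(1)] point_in[OF p(2)], symmetric] point_mult[OF p]
      t_eq[OF p(1)] t_eq[OF p(2)] t_eq[OF comp_paths[OF p]] by auto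
qed

text \<open>The image under \<psi> of the left action of i_g on a frame vector; the right factor
  from A becomes the unitary of the restriction.\<close>

lemma u_mult_t:
  assumes g: "g \<in> carrier G" and \<alpha>: "\<alpha> \<in> carrier \<Lambda>"
  shows "u g \<otimes>\<^bsub>NT\<^esub> t \<alpha> =
    (if gdom G g = rng \<Lambda> \<alpha> then t (act \<pi> g \<alpha>) \<otimes>\<^bsub>NT\<^esub> u (restriction \<Lambda> G \<pi> g \<alpha>) else \<zero>\<^bsub>NT\<^esub>)"
proof -
  note p = in_own_degree[OF \<alpha>]
  have "u g \<otimes>\<^bsub>NT\<^esub> t \<alpha> = \<psi> (deg \<Lambda> \<alpha>) (lact (pmod M (deg \<Lambda> \<alpha>)) (i g) (point (deg \<Lambda> \<alpha>) \<alpha>))"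
    using rep_lact[OF gen.rep_closed[OF g] point_in[OF p]] u_eq[OF g] t_eq[OF p] by simp
  then show ?thesis
  proof (cases "gdom G g = rng \<Lambda> \<alpha>")
    case True
    note r = restriction_closed(1)[OF g \<alpha> True[symmetric]] and a = act_path(1)[OF g p True[symmetric]]
    show ?thesis
      using \<open>u g \<otimes>\<^bsub>NT\<^esub> t \<alpha> = _\<close> lact_point[OF g p] True rep_ract[OF point_in[OF a] gen.rep_closed[OF r]]
        t_eq[OF a] u_eq[OF r] by simp
  qed (use lact_point[OF g p] in simp)
qed

lemma t_star_t_same_degree:
  assumes "\<alpha> \<in> paths \<Lambda> p" "\<beta> \<in> paths \<Lambda> p"
  shows "star NT (t \<alpha>) \<otimes>\<^bsub>NT\<^esub> t \<beta> = (if \<alpha> = \<beta> then t (src \<Lambda> \<alpha>) else \<zero>\<^bsub>NT\<^esub>)"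
  using rep_ip[OF point_in[OF assms(1)] point_in[OF assms(2)]] point_ip[OF assms]
    t_eq[OF assms(1)] t_eq[OF assms(2)] rep_vproj[OF src_vertex[OF pathsD(1)[OF assms(1)]]]
  by (cases "\<alpha> = \<beta>") simp_all

lemma t_src: "\<alpha> \<in> carrier \<Lambda> \<Longrightarrow> t \<alpha> \<otimes>\<^bsub>NT\<^esub> t (src \<Lambda> \<alpha>) = t \<alpha>"
  by (simp add: t_mult src_closed rng_src src_id)

lemma t_rng: "\<alpha> \<in> carrier \<Lambda> \<Longrightarrow> t (rng \<Lambda> \<alpha>) \<otimes>\<^bsub>NT\<^esub> t \<alpha> = t \<alpha>"
  by (simp add: t_mult rng_closed src_rng rng_id)

lemma t_star_t: "\<alpha> \<in> carrier \<Lambda> \<Longrightarrow> star NT (t \<alpha>) \<otimes>\<^bsub>NT\<^esub> t \<alpha> = t (src \<Lambda> \<alpha>)"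
  using t_star_t_same_degree[OF in_own_degree in_own_degree] by simp

lemma t_partial_isometry: "\<alpha> \<in> carrier \<Lambda> \<Longrightarrow> partial_isometry NT (t \<alpha>)"
  by (simp add: partial_isometry_def T.mult_assoc t_star_t t_src)

lemma t_orthogonal: "orthogonal_projections NT (vertices \<Lambda>) t"
  unfolding orthogonal_projections_def
proof (intro conjI ballI impI)
  fix v assume v: "v \<in> vertices \<Lambda>"
  show "projection NT (t v)"
    using urep.rep_unit_projection[OF v] u_unit[OF v] by simp
  show "t v \<otimes>\<^bsub>NT\<^esub> t w = \<zero>\<^bsub>NT\<^esub>" if "w \<in> vertices \<Lambda>" "v \<noteq> w" for w
    using urep.rep_units_orthogonal[OF v that(1)] u_unit[OF v] u_unit[OF that(1)] that(2) by simp
qed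

lemma t_star_t_extension:
  assumes "\<alpha> \<in> carrier \<Lambda>" "\<eta> \<in> carrier \<Lambda>" "src \<Lambda> \<alpha> = rng \<Lambda> \<eta>"
  shows "star NT (t \<alpha>) \<otimes>\<^bsub>NT\<^esub> t (kcomp \<Lambda> \<alpha> \<eta>) = t \<eta>"
proof -
  have "star NT (t \<alpha>) \<otimes>\<^bsub>NT\<^esub> t (kcomp \<Lambda> \<alpha> \<eta>) = (star NT (t \<alpha>) \<otimes>\<^bsub>NT\<^esub> t \<alpha>) \<otimes>\<^bsub>NT\<^esub> t \<eta>"
    using assms by (simp add: t_mult T.mult_assoc)
  then show ?thesis
    using assms by (simp add: t_star_t t_rng)
qed

text \<open>Nica covariance enters only here.\<close>

lemma range_projections_mult:
  assumes \<alpha>: "\<alpha> \<in> paths \<Lambda> p" and \<mu>: "\<mu> \<in> paths \<Lambda> q"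
  shows "(t \<alpha> \<otimes>\<^bsub>NT\<^esub> star NT (t \<alpha>)) \<otimes>\<^bsub>NT\<^esub> (t \<mu> \<otimes>\<^bsub>NT\<^esub> star NT (t \<mu>)) =
    (\<Oplus>\<^bsub>NT\<^esub>\<gamma>\<in>extensions \<alpha> (join p q - p) \<inter> extensions \<mu> (join p q - q). t \<gamma> \<otimes>\<^bsub>NT\<^esub> star NT (t \<gamma>))"
proof -
  let ?r = "join p q"
  let ?S = "extensions \<alpha> (?r - p)" and ?T = "extensions \<mu> (?r - q)"
  have S: "finite ?S" "?S \<subseteq> paths \<Lambda> ?r" and T: "finite ?T" "?T \<subseteq> paths \<Lambda> ?r"
    using finite_extensions[OF \<alpha>] finite_extensions[OF \<mu>] extensions_subset[OF \<alpha>, of "?r - p"]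
      extensions_subset[OF \<mu>, of "?r - q"] by (simp_all add: add_join_diff)
  have "nica_covariant A M NT \<psi>"
    using nica_toeplitz by (simp add: nica_toeplitz_algebra_def)
  then obtain \<Psi> where \<Psi>: "\<forall>p. star_hom (compacts (pmod M p)) NT (\<Psi> p) \<and>
        (\<forall>x\<in>fibre M p. \<forall>y\<in>fibre M p. \<Psi> p (Theta (pmod M p) x y) = \<psi> p x \<otimes>\<^bsub>NT\<^esub> star NT (\<psi> p y))"
      "\<forall>p q. \<forall>S\<in>carrier (compacts (pmod M p)). \<forall>T\<in>carrier (compacts (pmod M q)).
        \<Psi> p S \<otimes>\<^bsub>NT\<^esub> \<Psi> q T = \<Psi> (join p q) (extend_op M p (join p q) S
          \<otimes>\<^bsub>adjointables (pmod M (join p q))\<^esub> extend_op M q (join p q) T)"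
    unfolding nica_covariant_def by (elim conjE exE)
  have \<Psi>_hom: "\<And>p. star_hom (compacts (pmod M p)) NT (\<Psi> p)"
    and \<Psi>_Theta: "\<And>p x y. x \<in> fibre M p \<Longrightarrow> y \<in> fibre M p \<Longrightarrow>
        \<Psi> p (Theta (pmod M p) x y) = \<psi> p x \<otimes>\<^bsub>NT\<^esub> star NT (\<psi> p y)"
    using \<Psi>(1) by blast+
  note \<Psi>_mult = \<Psi>(2)[rule_format]
  have range: "\<Psi> s (Theta (pmod M s) (point s \<gamma>) (point s \<gamma>)) = t \<gamma> \<otimes>\<^bsub>NT\<^esub> star NT (t \<gamma>)"
    if "\<gamma> \<in> paths \<Lambda> s" for s \<gamma>
    using \<Psi>_Theta[OF point_in[OF that] point_in[OF that]] t_eq[OF that] by simp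
  \<comment> \<open>Both rank-one operators are lifted to the common degree r, where they become
    frame sums over extensions.\<close>
  have ext: "extend_op M p ?r (Theta (pmod M p) (point p \<alpha>) (point p \<alpha>)) = frame_sum (pmod M ?r) (point ?r) ?S"
    "extend_op M q ?r (Theta (pmod M q) (point q \<mu>) (point q \<mu>)) = frame_sum (pmod M ?r) (point ?r) ?T"
    using extend_op_Theta[OF \<alpha>, of "?r - p"] extend_op_Theta[OF \<mu>, of "?r - q"] by (simp_all add: add_join_diff)
  \<comment> \<open>All frame vectors of degree r are mutually orthogonal, so only the common
    extensions remain in the product.\<close>
  have comp: "compose (fibre M ?r) (frame_sum (pmod M ?r) (point ?r) ?S) (frame_sum (pmod M ?r) (point ?r) ?T)
      = frame_sum (pmod M ?r) (point ?r) (?S \<inter> ?T)"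
  proof (rule fib.frame_sum_compose[OF S(1) point_family[OF S(2)] T(1) point_family[OF T(2)]])
    fix j assume j: "j \<in> ?S"
    then have j_path: "j \<in> paths \<Lambda> ?r"
      using S(2) by blast
    show "inner_prod (pmod M ?r) (point ?r j) (point ?r k) = \<zero>\<^bsub>A\<^esub>" if "k \<in> ?T" "j \<noteq> k" for k
      using point_ip[OF j_path, of k] that T(2) by auto
    show "ract (pmod M ?r) (point ?r j) (inner_prod (pmod M ?r) (point ?r j) (point ?r j)) = point ?r j"
      using point_ip[OF j_path j_path] point_ract_unit[OF j_path] by simp
  qed
  have "(t \<alpha> \<otimes>\<^bsub>NT\<^esub> star NT (t \<alpha>)) \<otimes>\<^bsub>NT\<^esub> (t \<mu> \<otimes>\<^bsub>NT\<^esub> star NT (t \<mu>))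
      = \<Psi> ?r (frame_sum (pmod M ?r) (point ?r) (?S \<inter> ?T))"
    using \<Psi>_mult[OF Theta_in_compacts[OF point_in[OF \<alpha>] point_in[OF \<alpha>]]
        Theta_in_compacts[OF point_in[OF \<mu>] point_in[OF \<mu>]]]
    unfolding ext adjointables_simps comp range[OF \<alpha>] range[OF \<mu>] .
  also have "\<dots> = (\<Oplus>\<^bsub>NT\<^esub>\<gamma>\<in>?S \<inter> ?T. \<Psi> ?r (Theta (pmod M ?r) (point ?r \<gamma>) (point ?r \<gamma>)))"
  proof (rule fib.linear_frame_sum[OF T.complex_banach_axioms])
    show "linear_on (compacts (pmod M ?r)) NT (\<Psi> ?r)"
      using \<Psi>_hom[of ?r] by (simp add: star_hom_def)
    show "finite (?S \<inter> ?T)" "point ?r \<in> ?S \<inter> ?T \<rightarrow> fibre M ?r"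
      using S by auto
  qed
  also have "\<dots> = (\<Oplus>\<^bsub>NT\<^esub>\<gamma>\<in>?S \<inter> ?T. t \<gamma> \<otimes>\<^bsub>NT\<^esub> star NT (t \<gamma>))"
    using S(2) t_path_in by (intro T.mod.M.finsum_cong') (auto simp: range subset_iff)
  finally show ?thesis .
qed

text \<open>Insert the range projections of \<alpha> and \<mu> between the two factors and use their
  product formula; the outer factors then strip \<alpha> and \<mu> from every term.\<close>

lemma tck_relation:
  assumes \<alpha>: "\<alpha> \<in> carrier \<Lambda>" and \<mu>: "\<mu> \<in> carrier \<Lambda>"
  shows "star NT (t \<alpha>) \<otimes>\<^bsub>NT\<^esub> t \<mu> =
    (\<Oplus>\<^bsub>NT\<^esub>x\<in>min_extensions \<Lambda> \<alpha> \<mu>. t (fst x) \<otimes>\<^bsub>NT\<^esub> star NT (t (snd x)))"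
proof -
  let ?X = "min_extensions \<Lambda> \<alpha> \<mu>" and ?h = "\<lambda>x. kcomp \<Lambda> \<alpha> (fst x)"
  let ?S = "extensions \<alpha> (join (deg \<Lambda> \<alpha>) (deg \<Lambda> \<mu>) - deg \<Lambda> \<alpha>)
    \<inter> extensions \<mu> (join (deg \<Lambda> \<alpha>) (deg \<Lambda> \<mu>) - deg \<Lambda> \<mu>)"
  let ?r = "\<lambda>\<gamma>. t \<gamma> \<otimes>\<^bsub>NT\<^esub> star NT (t \<gamma>)"
  note p = in_own_degree[OF \<alpha>] in_own_degree[OF \<mu>]
  have bij: "inj_on ?h ?X" "?h ` ?X = ?S"
    using min_extensions_bij[OF p] by (simp_all add: bij_betw_def)
  have S: "finite ?S" "?S \<subseteq> carrier \<Lambda>"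
    using finite_extensions[OF p(1)] extensions_subset[OF p(1)] pathsD(1) by blast+
  have X: "finite ?X"
    using bij S(1) finite_imageD by metis
  have X': "fst x \<in> carrier \<Lambda>" "snd x \<in> carrier \<Lambda>" "src \<Lambda> \<alpha> = rng \<Lambda> (fst x)" "src \<Lambda> \<mu> = rng \<Lambda> (snd x)"
    "kcomp \<Lambda> \<alpha> (fst x) = kcomp \<Lambda> \<mu> (snd x)" if "x \<in> ?X" for x
    using that by (auto simp: min_extensions_def)
  have h_in: "?h x \<in> carrier \<Lambda>" if "x \<in> ?X" for x
    using path_comp_closed[OF \<alpha> X'(1,3)[OF that]] .
  have r_in: "?r (?h x) \<in> carrier NT" if "x \<in> ?X" for x
    using h_in[OF that] by blast
  have "star NT (t \<alpha>) \<otimes>\<^bsub>NT\<^esub> (t \<alpha> \<otimes>\<^bsub>NT\<^esub> star NT (t \<alpha>)) = star NT (t \<alpha>)"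
    using \<alpha> t_partial_isometry[OF \<alpha>] T.star_mult[of "t \<alpha> \<otimes>\<^bsub>NT\<^esub> star NT (t \<alpha>)" "t \<alpha>"]
    by (simp add: partial_isometry_def T.star_mult)
  moreover have "(t \<mu> \<otimes>\<^bsub>NT\<^esub> star NT (t \<mu>)) \<otimes>\<^bsub>NT\<^esub> t \<mu> = t \<mu>"
    using t_partial_isometry[OF \<mu>] by (simp add: partial_isometry_def)
  ultimately have "star NT (t \<alpha>) \<otimes>\<^bsub>NT\<^esub> t \<mu>
      = star NT (t \<alpha>) \<otimes>\<^bsub>NT\<^esub> ((?r \<alpha> \<otimes>\<^bsub>NT\<^esub> ?r \<mu>) \<otimes>\<^bsub>NT\<^esub> t \<mu>)"
    using \<alpha> \<mu> T.mult_assoc[of "star NT (t \<alpha>)" "?r \<alpha>" "?r \<mu> \<otimes>\<^bsub>NT\<^esub> t \<mu>"] T.mult_assoc[of "?r \<alpha>" "?r \<mu>" "t \<mu>"]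
    by simp
  \<comment> \<open>Passage from common extensions \<gamma> to pairs (\<eta>, \<zeta>) with \<gamma>
    = \<alpha>\<eta>.\<close>
  also have "?r \<alpha> \<otimes>\<^bsub>NT\<^esub> ?r \<mu> = (\<Oplus>\<^bsub>NT\<^esub>x\<in>?X. ?r (?h x))"
    unfolding range_projections_mult[OF p] bij(2)[symmetric] using r_in
    by (intro T.mod.M.finsum_reindex[OF _ bij(1)]) blast
  also have "star NT (t \<alpha>) \<otimes>\<^bsub>NT\<^esub> ((\<Oplus>\<^bsub>NT\<^esub>x\<in>?X. ?r (?h x)) \<otimes>\<^bsub>NT\<^esub> t \<mu>)
      = (\<Oplus>\<^bsub>NT\<^esub>x\<in>?X. star NT (t \<alpha>) \<otimes>\<^bsub>NT\<^esub> (?r (?h x) \<otimes>\<^bsub>NT\<^esub> t \<mu>))"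
  proof -
    have "(\<Oplus>\<^bsub>NT\<^esub>x\<in>?X. ?r (?h x)) \<otimes>\<^bsub>NT\<^esub> t \<mu> = (\<Oplus>\<^bsub>NT\<^esub>x\<in>?X. ?r (?h x) \<otimes>\<^bsub>NT\<^esub> t \<mu>)"
      using r_in \<mu> X by (intro T.mult_finsum_left) auto
    then show ?thesis
      using r_in \<alpha> \<mu> X T.mult_finsum_right[of "star NT (t \<alpha>)" ?X "\<lambda>x. ?r (?h x) \<otimes>\<^bsub>NT\<^esub> t \<mu>"] by auto
  qed
  also have "\<dots> = (\<Oplus>\<^bsub>NT\<^esub>x\<in>?X. t (fst x) \<otimes>\<^bsub>NT\<^esub> star NT (t (snd x)))"
  proof (rule T.mod.M.finsum_cong'[OF refl])
    show "(\<lambda>x. t (fst x) \<otimes>\<^bsub>NT\<^esub> star NT (t (snd x))) \<in> ?X \<rightarrow> carrier NT"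
      using X' by auto
    fix x assume x: "x \<in> ?X"
    note x' = X'[OF x]
    note c = h_in[OF x]
    \<comment> \<open>The same path is also \<mu>\<zeta>, so the rule for stripping \<mu> applies
      after taking adjoints.\<close>
    have "star NT (t (?h x)) \<otimes>\<^bsub>NT\<^esub> t \<mu> = star NT (star NT (t \<mu>) \<otimes>\<^bsub>NT\<^esub> t (kcomp \<Lambda> \<mu> (snd x)))"
      using c \<mu> x'(5) by (simp add: T.star_mult)
    also have "\<dots> = star NT (t (snd x))"
      using t_star_t_extension[OF \<mu> x'(2,4)] by simp
    finally have "star NT (t (?h x)) \<otimes>\<^bsub>NT\<^esub> t \<mu> = star NT (t (snd x))" .
    then have "star NT (t \<alpha>) \<otimes>\<^bsub>NT\<^esub> (?r (?h x) \<otimes>\<^bsub>NT\<^esub> t \<mu>)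
        = (star NT (t \<alpha>) \<otimes>\<^bsub>NT\<^esub> t (?h x)) \<otimes>\<^bsub>NT\<^esub> star NT (t (snd x))"
      using c \<alpha> \<mu> x'(2) by (simp add: T.mult_assoc)
    then show "star NT (t \<alpha>) \<otimes>\<^bsub>NT\<^esub> (?r (?h x) \<otimes>\<^bsub>NT\<^esub> t \<mu>) = t (fst x) \<otimes>\<^bsub>NT\<^esub> star NT (t (snd x))"
      using t_star_t_extension[OF \<alpha> x'(1,3)] by simp
  qed
  finally show ?thesis .
qed

section \<open>Generation and the identity\<close>

lemma rep_expansion:
  assumes z: "z \<in> fibre M p"
  shows "\<psi> p z = (\<Oplus>\<^bsub>NT\<^esub>\<alpha>\<in>paths \<Lambda> p. t \<alpha> \<otimes>\<^bsub>NT\<^esub> \<psi> 0 (inner_prod (pmod M p) (point p \<alpha>) z))"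
proof -
  let ?f = "\<lambda>\<alpha>. ract (pmod M p) (point p \<alpha>) (inner_prod (pmod M p) (point p \<alpha>) z)"
  have "\<psi> p z = \<psi> p (\<Oplus>\<^bsub>pmod M p\<^esub>\<alpha>\<in>paths \<Lambda> p. ?f \<alpha>)"
    using frame_point[OF z] z by (simp add: frame_sum_def)
  \<comment> \<open>The frame expansion is a finite sum, so linearity of \<psi>_p suffices.\<close>
  also have "\<dots> = (\<Oplus>\<^bsub>NT\<^esub>\<alpha>\<in>paths \<Lambda> p. \<psi> p (?f \<alpha>))"
    using z by (intro rep.linear_finsum[OF rep_linear]) auto
  also have "\<dots> = (\<Oplus>\<^bsub>NT\<^esub>\<alpha>\<in>paths \<Lambda> p. t \<alpha> \<otimes>\<^bsub>NT\<^esub> \<psi> 0 (inner_prod (pmod M p) (point p \<alpha>) z))"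
    using z t_path_in by (intro T.mod.M.finsum_cong') (auto simp: rep_ract t_eq)
  finally show ?thesis .
qed

lemma finsum_in_subalgebra:
  assumes "cstar_subalgebra NT C" "finite I" "\<And>j. j \<in> I \<Longrightarrow> f j \<in> C"
  shows "finsum NT f I \<in> C"
  using assms(2,3)
proof (induction I rule: finite_induct)
  case empty
  then show ?case
    using assms(1) by (simp add: cstar_subalgebra_def closed_subspace_def)
next
  case (insert j I)
  have "C \<subseteq> carrier NT" "\<And>x y. x \<in> C \<Longrightarrow> y \<in> C \<Longrightarrow> x \<oplus>\<^bsub>NT\<^esub> y \<in> C"
    using assms(1) by (auto simp: cstar_subalgebra_def closed_subspace_def)
  then show ?case
    using insert by (subst T.mod.M.finsum_insert) auto
qed

text \<open>A C*-subalgebra C that contains every u_g contains \<psi>_0(A), since its preimage in A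
  contains the generators i_g. With the t_\<alpha> in C, the frame expansion puts every \<psi>_p(z)
  into C.\<close>

lemma generated: "cstar_generated NT (u ` carrier G \<union> t ` carrier \<Lambda>) = carrier NT"
proof (rule T.cstar_generated_eqI)
  show "u ` carrier G \<union> t ` carrier \<Lambda> \<subseteq> carrier NT"
    by auto
  fix C assume C: "cstar_subalgebra NT C" and sub: "u ` carrier G \<union> t ` carrier \<Lambda> \<subseteq> C"
  have "cstar_subalgebra A {a \<in> carrier A. \<psi> 0 a \<in> C}"
    by (rule hom.cstar_subalgebra_vimage[OF algebra_identity C])
  moreover have "i ` carrier G \<subseteq> {a \<in> carrier A. \<psi> 0 a \<in> C}"
    using sub u_eq by auto
  ultimately have "carrier A \<subseteq> {a \<in> carrier A. \<psi> 0 a \<in> C}"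
    using algebra_generated unfolding cstar_generated_def by blast
  then have coeff: "\<psi> 0 a \<in> C" if "a \<in> carrier A" for a
    using that by blast
  have "\<psi> p z \<in> C" if z: "z \<in> fibre M p" for p z
    unfolding rep_expansion[OF z]
  proof (rule finsum_in_subalgebra[OF C finite_paths])
    fix \<alpha> assume \<alpha>: "\<alpha> \<in> paths \<Lambda> p"
    have "t \<alpha> \<in> C"
      using sub pathsD(1)[OF \<alpha>] by blast
    moreover have "\<psi> 0 (inner_prod (pmod M p) (point p \<alpha>) z) \<in> C"
      using \<alpha> z by (intro coeff) auto
    ultimately show "t \<alpha> \<otimes>\<^bsub>NT\<^esub> \<psi> 0 (inner_prod (pmod M p) (point p \<alpha>) z) \<in> C"
      using C by (simp add: cstar_subalgebra_def)
  qed
  then have "(\<Union>p. \<psi> p ` fibre M p) \<subseteq> C"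
    by blast
  moreover have "cstar_generated NT (\<Union>p. \<psi> p ` fibre M p) = carrier NT"
    using nica_toeplitz by (simp add: nica_toeplitz_algebra_def)
  ultimately show "carrier NT \<subseteq> C"
    using C unfolding cstar_generated_def by blast
qed

text \<open>As t_v = u_v, the sum is the unit sum of u. The generator u_g absorbs the projections at
  its codomain and domain, and t_\<alpha> those at its range and source.\<close>

lemma vertex_sum_identity: "is_identity NT (\<Oplus>\<^bsub>NT\<^esub>v\<in>vertices \<Lambda>. t v)"
proof -
  have "(\<Oplus>\<^bsub>NT\<^esub>v\<in>vertices \<Lambda>. t v) = urep.unit_sum"
    unfolding urep.unit_sum_def
    by (intro T.mod.M.finsum_cong') (auto simp: u_unit unit_closed)
  moreover have "is_identity NT urep.unit_sum"
  proof (rule urep.unit_sum_identity[OF generated])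
    show "u ` carrier G \<union> t ` carrier \<Lambda> \<subseteq> carrier NT"
      by auto
    fix x assume "x \<in> u ` carrier G \<union> t ` carrier \<Lambda>"
    then consider (u) g where "g \<in> carrier G" "x = u g" | (t) \<alpha> where "\<alpha> \<in> carrier \<Lambda>" "x = t \<alpha>"
      by blast
    then show "\<exists>v\<in>vertices \<Lambda>. u (gunit G v) \<otimes>\<^bsub>NT\<^esub> x = x"
    proof cases
      case u
      then show ?thesis
        using urep.rep_unit_left[of "gcod G g" g] cod_closed[of g] by (intro bexI[of _ "gcod G g"]) auto
    next
      case t
      then show ?thesis
        using t_rng[of \<alpha>] rng_vertex[of \<alpha>] u_unit by (intro bexI[of _ "rng \<Lambda> \<alpha>"]) auto
    qed
    from \<open>x \<in> u ` carrier G \<union> t ` carrier \<Lambda>\<close>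
    consider (u) g where "g \<in> carrier G" "x = u g" | (t) \<alpha> where "\<alpha> \<in> carrier \<Lambda>" "x = t \<alpha>"
      by blast
    then show "\<exists>v\<in>vertices \<Lambda>. x \<otimes>\<^bsub>NT\<^esub> u (gunit G v) = x"
    proof cases
      case u
      then show ?thesis
        using urep.rep_unit_right[of "gdom G g" g] dom_closed[of g] by (intro bexI[of _ "gdom G g"]) auto
    next
      case t
      then show ?thesis
        using t_src[of \<alpha>] src_vertex[of \<alpha>] u_unit by (intro bexI[of _ "src \<Lambda> \<alpha>"]) auto
    qed
  qed
  ultimately show ?thesis
    by simp
qed

lemma tck_family_t: "tck_family \<Lambda> NT t"
  unfolding tck_family_def
  using t_partial_isometry t_orthogonal t_mult tck_relation by simp

end

theorem proposition6p1:
  fixes \<Lambda> :: "('l, 'k::finite) kgraph" and G :: "('g, 'l) groupoid"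
    and \<pi> :: "'g \<Rightarrow> 'l \<times> 'l \<times> ('l \<Rightarrow> 'l)"
    and A :: "'m cstar" and i :: "'g \<Rightarrow> 'm"
    and M :: "('m, 'k) psystem" and tens :: "nat ^ 'k \<Rightarrow> ('l \<Rightarrow> complex) \<Rightarrow> 'm \<Rightarrow> 'm"
    and NT :: "'b cstar" and \<psi> :: "nat ^ 'k \<Rightarrow> 'm \<Rightarrow> 'b"
    and u :: "'g \<Rightarrow> 'b" and t :: "'l \<Rightarrow> 'b"
  assumes "kgraph \<Lambda>" and "finite_kgraph \<Lambda>"
    and "self_similar_action \<Lambda> G \<pi>"
    and "groupoid_cstar G A i"
    and "self_similar_system \<Lambda> G \<pi> A i M tens"
    and "nica_toeplitz_algebra A M NT \<psi>"
    and "\<And>g. g \<in> carrier G \<Longrightarrow> u g = \<psi> 0 (i g)"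
    and "\<And>v. v \<in> vertices \<Lambda> \<Longrightarrow> t v = \<psi> 0 (i (gunit G v))"
    and "\<And>p \<alpha>. p \<noteq> 0 \<Longrightarrow> \<alpha> \<in> paths \<Lambda> p
           \<Longrightarrow> t \<alpha> = \<psi> p (tens p (point_mass \<alpha>) (i (gunit G (src \<Lambda> \<alpha>))))"
  shows "cstar_generated NT (u ` carrier G \<union> t ` carrier \<Lambda>) = carrier NT \<and>
    (unitary_rep G NT u \<and> (\<forall>v\<in>vertices \<Lambda>. u (gunit G v) = t v)) \<and>
    (tck_family \<Lambda> NT t \<and> is_identity NT (\<Oplus>\<^bsub>NT\<^esub>v\<in>vertices \<Lambda>. t v)) \<and>
    (\<forall>g\<in>carrier G. \<forall>\<alpha>\<in>carrier \<Lambda>.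
       u g \<otimes>\<^bsub>NT\<^esub> t \<alpha> =
         (if gdom G g = rng \<Lambda> \<alpha>
          then t (act \<pi> g \<alpha>) \<otimes>\<^bsub>NT\<^esub> u (restriction \<Lambda> G \<pi> g \<alpha>)
          else \<zero>\<^bsub>NT\<^esub>))"
proof -
  interpret S: self_similar_setting \<Lambda> G \<pi> A i M tens
    using assms(2-5) by (simp add: self_similar_setting_def self_similar_setting_axioms_def)
  interpret nica_toeplitz_setting \<Lambda> G \<pi> A i M tens NT \<psi> u t
  proof unfold_locales
    \<comment> \<open>A path of degree 0 is a vertex, so the two prescriptions for t cover all
      paths.\<close>
    show "t \<alpha> = \<psi> p (S.point p \<alpha>)" if "\<alpha> \<in> paths \<Lambda> p" for p \<alpha>
      using that assms(8)[of \<alpha>] assms(9)[of p \<alpha>] by (cases "p = 0") (simp_all add: S.point_def)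
  qed (use assms(6,7) in auto)
  show ?thesis
    using generated unitary_rep_u u_unit tck_family_t vertex_sum_identity u_mult_t by blast
qed

end
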